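(* The integral $$B_{\xi,\lambda}^{\eta,\nu}f(h)=\int_{\mathbb{R}}|t|_{\xi_1+\eta}^{\lambda_1-\nu+\frac n2}f\big(h(I_{2n}+tE_{2n,n})\big)\frac{dt}{|t|}\qquad(f\in\pi_{\xi,\lambda},\ h\in H)$$ converges when $\operatorname{Re}(\lambda_1-\nu)>-\frac n2$ and $\operatorname{Re}(\nu-\lambda_2)>-\frac n2$. The family $\mathbf{B}_{\xi,\lambda}^{\eta,\nu}=n_{\mathbf{B}}(\xi,\lambda,\eta,\nu)^{-1}B_{\xi,\lambda}^{\eta,\nu}$, where $$n_{\mathbf{B}}(\xi,\lambda,\eta,\nu)=\Gamma\big(\tfrac{\lambda_1-\nu+\frac n2+[\xi_1+\eta]}{2}\big)\Gamma\big(\tfrac{\nu-\lambda_2+\frac n2+[\xi_2+\eta]}{2}\big),$$ can be extended analytically such that it depends holomorphically on $(\lambda,\nu)\in\mathbb{C}^2\times\mathbb{C}$ for all $(\xi,\eta)\in(\mathbb{Z}/2\mathbb{Z})^2\times(\mathbb{Z}/2\mathbb{Z})$, and it defines a family of $H$-intertwining operators in $\operatorname{Hom}_H(\pi_{\xi,\lambda}|_H,\tau_{(\xi_1,\eta,\xi_2),(\lambda_1,\nu,\lambda_2)})$.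
   Context: For $\varepsilon\in\mathbb{Z}/2\mathbb{Z}$, $\mu\in\mathbb{C}$, $x\in\mathbb{R}^\times$ put $|x|_\varepsilon^\mu=\operatorname{sgn}(x)^\varepsilon|x|^\mu$; $[\varepsilon]\in\{0,1\}$ denotes the representative of $\varepsilon$; $E_{i,j}$ is the elementary matrix. Let $G=\mathrm{GL}(2n,\mathbb{R})$ and $H=\mathrm{GL}(2n-1,\mathbb{R})\subseteq G$ (upper left corner). $\pi_{\xi,\lambda}$ is the left regular representation of $G$ on the space of $f\in C^\infty(G)$ with $f\big(g\begin{pmatrix}g_1&*\\0&g_2\end{pmatrix}\big)=|\det g_1|_{\xi_1}^{-\lambda_1-\frac n2}|\det g_2|_{\xi_2}^{-\lambda_2+\frac n2}f(g)$, $g_1,g_2\in\mathrm{GL}(n,\mathbb{R})$. $\tau_{\eta,\nu}$ ($\eta\in(\mathbb{Z}/2\mathbb{Z})^3,\nu\in\mathbb{C}^3$) is the left regular representation of $H$ on the space of $f\in C^\infty(H)$ with $f(hp)=|\det p_1|_{\eta_1}^{-\nu_1-\frac n2}|p_2|_{\eta_2}^{-\nu_2}|\det p_3|_{\eta_3}^{-\nu_3+\frac n2}f(h)$ for block upper triangular $p\in H$ with diagonal blocks $p_1\in\mathrm{GL}(n-1,\mathbb{R})$, $p_2\in\mathrm{GL}(1,\mathbb{R})$, $p_3\in\mathrm{GL}(n-1,\mathbb{R})$. Holomorphic dependence is understood in the compact picture: restriction to $O(2n)$ resp. $O(2n-1)$ identifies the representation spaces with function spaces independent of $(\lambda,\nu)$.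 *)

theory Defs
  imports "HOL-Analysis.Analysis" "HOL-Library.Z2"
begin

type_synonym 'k sqmat = "real ^ 'k ^ 'k"

section \<open>General linear groups in the coordinates of a set of indices\<close>

text \<open>
  \<open>pad J A\<close> is the matrix which agrees with \<open>A\<close> on \<open>J \<times> J\<close> and with the identity elsewhere.
  \<open>GL J\<close> is the copy of \<open>GL(|J|, \<real>)\<close> acting on the coordinates in \<open>J\<close> and fixing the other
  coordinate vectors; thus \<open>GL UNIV\<close> is the full general linear group, and removing the last
  index gives the general linear group of size one less, embedded as the upper left corner.
  The determinant of the diagonal block with index set \<open>J\<close> is \<open>det (pad J A)\<close>; this is \<open>1\<close> for
  an empty block.
\<close>

definition pad :: "'k set \<Rightarrow> 'k::finite sqmat \<Rightarrow> 'k sqmat" where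
  "pad J A = (\<chi> i j. if i \<in> J \<and> j \<in> J then A $ i $ j else if i = j then 1 else 0)"

definition block_det :: "'k set \<Rightarrow> 'k::finite sqmat \<Rightarrow> real" where
  "block_det J A = det (pad J A)"

definition GL :: "'k set \<Rightarrow> 'k::finite sqmat set" where
  "GL J = {A. invertible A \<and> pad J A = A}"

definition Orth :: "'k set \<Rightarrow> 'k::finite sqmat set" where
  "Orth J = {A \<in> GL J. orthogonal_matrix A}"

definition elem_mat :: "'k \<Rightarrow> 'k \<Rightarrow> 'k::finite sqmat" where
  "elem_mat i j = (\<chi> a b. if a = i \<and> b = j then 1 else 0)"

section \<open>Smooth functions and their Frechet topology\<close>

text \<open>
  \<open>GL J\<close> is open in the space of \<open>J \<times> J\<close>-matrices, so smoothness means that the iterated partial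
  derivatives with respect to the entries in \<open>J \<times> J\<close> all exist and are continuous.
  Functions on \<open>GL J\<close> are represented by total functions vanishing outside \<open>GL J\<close>.
\<close>

definition partial_deriv :: "'k \<times> 'k \<Rightarrow> ('k::finite sqmat \<Rightarrow> complex) \<Rightarrow> 'k sqmat \<Rightarrow> complex" where
  "partial_deriv ij f g =
     vector_derivative (\<lambda>s. f (g + s *\<^sub>R elem_mat (fst ij) (snd ij))) (at 0)"

fun partial_derivs :: "('k \<times> 'k) list \<Rightarrow> ('k::finite sqmat \<Rightarrow> complex) \<Rightarrow> 'k sqmat \<Rightarrow> complex" where
  "partial_derivs [] f = f"
| "partial_derivs (ij # ijs) f = partial_deriv ij (partial_derivs ijs f)"

definition smooth_GL :: "'k set \<Rightarrow> ('k::finite sqmat \<Rightarrow> complex) set" where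
  "smooth_GL J = {f. (\<forall>g. g \<notin> GL J \<longrightarrow> f g = 0) \<and>
     (\<forall>ijs. set ijs \<subseteq> J \<times> J \<longrightarrow>
        continuous_on (GL J) (partial_derivs ijs f) \<and>
        (\<forall>i\<in>J. \<forall>j\<in>J. \<forall>g\<in>GL J.
           (\<lambda>s::real. partial_derivs ijs f (g + s *\<^sub>R elem_mat i j)) differentiable (at 0)))}"

text \<open>Uniform convergence of all partial derivatives on compact subsets: the topology is generated
  by the open balls of the seminorms \<open>f \<mapsto> sup\<^bsub>g\<in>K\<^esub> |\<partial>\<^sup>\<alpha> f(g)|\<close>.\<close>

definition smooth_GL_topology :: "'k set \<Rightarrow> ('k::finite sqmat \<Rightarrow> complex) topology" where
  "smooth_GL_topology J = topology_generated_by
     {{f \<in> smooth_GL J. \<forall>g\<in>K. cmod (partial_derivs ijs f g - partial_derivs ijs f0 g) < e}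
       | f0 K ijs e. f0 \<in> smooth_GL J \<and> compact K \<and> K \<subseteq> GL J \<and> set ijs \<subseteq> J \<times> J \<and> (0::real) < e}"

text \<open>
  The orthogonal group \<open>Orth J\<close> is a closed submanifold of \<open>GL J\<close>. Hence the smooth functions on
  it are the restrictions of smooth functions on \<open>GL J\<close>, and, restriction being a continuous
  linear surjection of Frechet spaces and therefore open, the usual topology on them is the
  quotient topology.
\<close>

definition restrict_Orth :: "'k set \<Rightarrow> ('k::finite sqmat \<Rightarrow> complex) \<Rightarrow> 'k sqmat \<Rightarrow> complex" where
  "restrict_Orth J f = (\<lambda>k. if k \<in> Orth J then f k else 0)"

definition smooth_Orth :: "'k set \<Rightarrow> ('k::finite sqmat \<Rightarrow> complex) set" where
  "smooth_Orth J = restrict_Orth J ` smooth_GL J"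

definition smooth_Orth_topology :: "'k set \<Rightarrow> ('k::finite sqmat \<Rightarrow> complex) topology" where
  "smooth_Orth_topology J = topology (\<lambda>U. U \<subseteq> smooth_Orth J \<and>
     openin (smooth_GL_topology J) {f \<in> smooth_GL J. restrict_Orth J f \<in> U})"

lemma topspace_smooth_GL_topology: "topspace (smooth_GL_topology J) = smooth_GL J"
proof -
  have "f \<in> topspace (smooth_GL_topology J)" if f: "f \<in> smooth_GL J" for f
  proof -
    let ?U = "{h \<in> smooth_GL J.
      \<forall>g\<in>{}. cmod (partial_derivs [] h g - partial_derivs [] f g) < (1::real)}"
    have "openin (smooth_GL_topology J) ?U"
      unfolding smooth_GL_topology_def
      by (rule topology_generated_by_Basis, rule CollectI,
          rule exI[of _ f], rule exI[of _ "{}"], rule exI[of _ "[]"], rule exI[of _ 1])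
        (use f in auto)
    then have "?U \<subseteq> topspace (smooth_GL_topology J)" by (rule openin_subset)
    with f show ?thesis by auto
  qed
  moreover have "topspace (smooth_GL_topology J) \<subseteq> smooth_GL J"
    unfolding smooth_GL_topology_def topology_generated_by_topspace by auto
  ultimately show ?thesis by blast
qed

lemma openin_smooth_Orth_topology:
  "openin (smooth_Orth_topology J) U \<longleftrightarrow> U \<subseteq> smooth_Orth J \<and>
     openin (smooth_GL_topology J) {f \<in> smooth_GL J. restrict_Orth J f \<in> U}"
proof -
  let ?P = "\<lambda>U. {f \<in> smooth_GL J. restrict_Orth J f \<in> U}"
  have "?P (S \<inter> T) = ?P S \<inter> ?P T" "?P (\<Union>\<K>) = \<Union> (?P ` \<K>)" for S T \<K> by auto
  then have "istopology (\<lambda>U. U \<subseteq> smooth_Orth J \<and> openin (smooth_GL_topology J) (?P U))"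
    unfolding istopology_def by (auto intro!: openin_Union)
  then show ?thesis
    unfolding smooth_Orth_topology_def by (simp add: topology_inverse')
qed

lemma topspace_smooth_Orth_topology: "topspace (smooth_Orth_topology J) = smooth_Orth J"
proof -
  have "openin (smooth_Orth_topology J) (smooth_Orth J)"
  proof -
    have "{f \<in> smooth_GL J. restrict_Orth J f \<in> smooth_Orth J} = topspace (smooth_GL_topology J)"
      by (auto simp: smooth_Orth_def topspace_smooth_GL_topology)
    then show ?thesis by (simp add: openin_smooth_Orth_topology)
  qed
  then show ?thesis
    by (metis openin_smooth_Orth_topology openin_subset openin_topspace subset_antisym)
qed

section \<open>Holomorphic maps into function spaces\<close>

text \<open>A map on \<open>\<complex>\<^sup>3\<close> with values in a topological vector space of functions is holomorphic if it is
  continuous and complex differentiable along every complex line.\<close>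

definition holomorphic_into ::
    "('a \<Rightarrow> complex) topology \<Rightarrow> (complex \<times> complex \<times> complex \<Rightarrow> 'a \<Rightarrow> complex) \<Rightarrow> bool" where
  "holomorphic_into T F \<longleftrightarrow> continuous_map euclidean T F \<and>
     (\<forall>z1 z2 z3 w1 w2 w3. \<exists>L.
        limitin T (\<lambda>\<zeta> x. (F (z1 + \<zeta> * w1, z2 + \<zeta> * w2, z3 + \<zeta> * w3) x - F (z1, z2, z3) x) / \<zeta>)
          L (at (0::complex)))"

section \<open>The groups and the induced representations\<close>

text \<open>
  The indices \<open>1, \<dots>, 2n\<close> are the elements of \<open>'n + 'n\<close> with \<open>n = CARD('n)\<close>: \<open>Inl\<close> enumerates
  \<open>1, \<dots>, n\<close> and \<open>Inr\<close> enumerates \<open>n+1, \<dots>, 2n\<close>, both in the order of \<open>'n\<close>. In particular \<open>ix_n\<close>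
  is the index \<open>n\<close> and \<open>ix_2n\<close> is the index \<open>2n\<close>.
\<close>

definition ix_n :: "'n::{finite,linorder} + 'n" where
  "ix_n = Inl (Max UNIV)"

definition ix_2n :: "'n::{finite,linorder} + 'n" where
  "ix_2n = Inr (Max UNIV)"

abbreviation ixs_H :: "('n::{finite,linorder} + 'n) set" where
  "ixs_H \<equiv> UNIV - {ix_2n}"

abbreviation grp_G :: "('n::{finite,linorder} + 'n) sqmat set" where
  "grp_G \<equiv> GL UNIV"

abbreviation grp_H :: "('n::{finite,linorder} + 'n) sqmat set" where
  "grp_H \<equiv> GL ixs_H"

definition sgn_powr :: "bit \<Rightarrow> complex \<Rightarrow> real \<Rightarrow> complex" where
  "sgn_powr \<epsilon> \<mu> x = of_real (sgn x) ^ of_bit \<epsilon> * of_real \<bar>x\<bar> powr \<mu>"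

text \<open>Below, \<open>l1\<close> and \<open>l2\<close> stand for the components of the parameter \<open>\<lambda> \<in> \<complex>\<^sup>2\<close>.\<close>

definition parab_G :: "('n::{finite,linorder} + 'n) sqmat set" where
  "parab_G = {p \<in> grp_G. \<forall>i j. p $ Inr i $ Inl j = 0}"

text \<open>The three diagonal blocks of \<open>H\<close> have sizes \<open>n - 1\<close>, \<open>1\<close> and \<open>n - 1\<close>.\<close>

definition blk1 :: "('n::{finite,linorder} + 'n) set" where
  "blk1 = range Inl - {ix_n}"

definition blk2 :: "('n::{finite,linorder} + 'n) set" where
  "blk2 = {ix_n}"

definition blk3 :: "('n::{finite,linorder} + 'n) set" where
  "blk3 = range Inr - {ix_2n}"

definition parab_H :: "('n::{finite,linorder} + 'n) sqmat set" where
  "parab_H = {p \<in> grp_H.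
     (\<forall>i\<in>blk2. \<forall>j\<in>blk1. p $ i $ j = 0) \<and> (\<forall>i\<in>blk3. \<forall>j\<in>blk1 \<union> blk2. p $ i $ j = 0)}"

definition rep_pi :: "bit \<times> bit \<Rightarrow> complex \<times> complex \<Rightarrow>
    (('n::{finite,linorder} + 'n) sqmat \<Rightarrow> complex) set" where
  "rep_pi = (\<lambda>(\<xi>1, \<xi>2) (l1, l2). {f \<in> smooth_GL UNIV. \<forall>g\<in>grp_G. \<forall>p\<in>parab_G.
     f (g ** p) =
       sgn_powr \<xi>1 (- l1 - of_nat CARD('n) / 2) (block_det (range Inl) p) *
       sgn_powr \<xi>2 (- l2 + of_nat CARD('n) / 2) (block_det (range Inr) p) * f g})"

definition rep_tau :: "bit \<times> bit \<times> bit \<Rightarrow> complex \<times> complex \<times> complex \<Rightarrow>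
    (('n::{finite,linorder} + 'n) sqmat \<Rightarrow> complex) set" where
  "rep_tau = (\<lambda>(\<eta>1, \<eta>2, \<eta>3) (\<nu>1, \<nu>2, \<nu>3). {f \<in> smooth_GL ixs_H. \<forall>h\<in>grp_H. \<forall>p\<in>parab_H.
     f (h ** p) =
       sgn_powr \<eta>1 (- \<nu>1 - of_nat CARD('n) / 2) (block_det blk1 p) *
       sgn_powr \<eta>2 (- \<nu>2) (block_det blk2 p) *
       sgn_powr \<eta>3 (- \<nu>3 + of_nat CARD('n) / 2) (block_det blk3 p) * f h})"

definition left_reg :: "'k::finite sqmat \<Rightarrow> ('k sqmat \<Rightarrow> complex) \<Rightarrow> 'k sqmat \<Rightarrow> complex" where
  "left_reg g f = (\<lambda>x. f (matrix_inv g ** x))"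

text \<open>Continuous \<open>\<complex>\<close>-linear \<open>H\<close>-intertwining operators; only the values of \<open>T\<close> on \<open>V\<close> matter.\<close>

definition Hom_H :: "(('n::{finite,linorder} + 'n) sqmat \<Rightarrow> complex) set \<Rightarrow>
    (('n + 'n) sqmat \<Rightarrow> complex) set \<Rightarrow>
    ((('n + 'n) sqmat \<Rightarrow> complex) \<Rightarrow> ('n + 'n) sqmat \<Rightarrow> complex) set" where
  "Hom_H V W = {T.
     (\<forall>f\<in>V. T f \<in> W) \<and>
     (\<forall>f1\<in>V. \<forall>f2\<in>V. T (\<lambda>x. f1 x + f2 x) = (\<lambda>x. T f1 x + T f2 x)) \<and>
     (\<forall>c. \<forall>f\<in>V. T (\<lambda>x. c * f x) = (\<lambda>x. c * T f x)) \<and>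
     continuous_map (subtopology (smooth_GL_topology UNIV) V)
       (subtopology (smooth_GL_topology ixs_H) W) T \<and>
     (\<forall>h\<in>grp_H. \<forall>f\<in>V. T (left_reg h f) = left_reg h (T f))}"

text \<open>
  A vector of the compact picture of the family \<open>\<pi>\<^bsub>\<xi>,\<lambda>\<^esub>\<close> is the same as a flat section: a choice of
  \<open>F \<lambda> \<in> \<pi>\<^bsub>\<xi>,\<lambda>\<^esub>\<close> for all \<open>\<lambda>\<close> such that the restriction of \<open>F \<lambda>\<close> to \<open>O(2n)\<close> does not depend on \<open>\<lambda>\<close>.
  Holomorphic dependence of a family of operators \<open>T\<close> in the compact picture means that each
  vector of the compact picture of \<open>\<pi>\<close> is mapped to a holomorphic function with values in the
  smooth functions on \<open>O(2n-1)\<close>.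
\<close>

definition flat_section :: "bit \<times> bit \<Rightarrow>
    (complex \<times> complex \<Rightarrow> ('n::{finite,linorder} + 'n) sqmat \<Rightarrow> complex) \<Rightarrow> bool" where
  "flat_section \<xi> F \<longleftrightarrow> (\<forall>l. F l \<in> rep_pi \<xi> l) \<and>
     (\<forall>l l'. restrict_Orth UNIV (F l) = restrict_Orth UNIV (F l'))"

definition holomorphic_family :: "bit \<times> bit \<Rightarrow>
    (complex \<times> complex \<Rightarrow> complex \<Rightarrow> (('n::{finite,linorder} + 'n) sqmat \<Rightarrow> complex) \<Rightarrow>
      ('n + 'n) sqmat \<Rightarrow> complex) \<Rightarrow> bool" where
  "holomorphic_family \<xi> T \<longleftrightarrow> (\<forall>F. flat_section \<xi> F \<longrightarrow>
     holomorphic_into (smooth_Orth_topology ixs_H)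
       (\<lambda>(l1, l2, \<nu>). restrict_Orth ixs_H (T (l1, l2) \<nu> (F (l1, l2)))))"

section \<open>The integral operator and its normalization\<close>

definition B_integrand :: "bit \<Rightarrow> complex \<Rightarrow> bit \<Rightarrow> complex \<Rightarrow>
    (('n::{finite,linorder} + 'n) sqmat \<Rightarrow> complex) \<Rightarrow> ('n + 'n) sqmat \<Rightarrow> real \<Rightarrow> complex" where
  "B_integrand \<xi>1 l1 \<eta> \<nu> f h t =
     sgn_powr (\<xi>1 + \<eta>) (l1 - \<nu> + of_nat CARD('n) / 2) t *
     f (h ** (mat 1 + t *\<^sub>R elem_mat ix_2n ix_n)) / of_real \<bar>t\<bar>"

definition n_B :: "nat \<Rightarrow> bit \<times> bit \<Rightarrow> complex \<times> complex \<Rightarrow> bit \<Rightarrow> complex \<Rightarrow> complex" where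
  "n_B n = (\<lambda>(\<xi>1, \<xi>2) (l1, l2) \<eta> \<nu>.
     Gamma ((l1 - \<nu> + of_nat n / 2 + of_bit (\<xi>1 + \<eta>)) / 2) *
     Gamma ((\<nu> - l2 + of_nat n / 2 + of_bit (\<xi>2 + \<eta>)) / 2))"

end

theory Submission
  imports Defs "HOL-Complex_Analysis.Conformal_Mappings"
begin

text \<open>
  The integral runs over the affine part of a projective line, and everything comes from looking
  at it in the two charts of that line. Write \<open>chart0 t\<close> for \<open>I + t E\<close> with \<open>E\<close> the elementary
  matrix at position \<open>(2n, n)\<close>. For \<open>t \<noteq> 0\<close> one has \<open>chart0 t = chart1 (1 / t) ** transition t\<close>
  with \<open>chart1\<close> affine in its argument and \<open>transition t\<close> in the parabolic subgroup, with block
  determinants \<open>t\<close> and \<open>1 / t\<close> (lemma \<open>chart_transition\<close>). So for \<open>f\<close> in the induced representation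
  the substitution \<open>u = 1 / t\<close> turns the part \<open>\<bar>t\<bar> \<ge> 1\<close> of the integral into one over \<open>\<bar>u\<bar> \<le> 1\<close>
  of the same kind: the integral is
  \<open>\<integral> |t|\<^sup>s f(h chart0(t)) dt/|t| + \<integral> |u|\<^sup>s' f(h chart1(u)) du/|u|\<close>, both over \<open>[-1, 1]\<close>, where
  \<open>s = \<lambda>1 - \<nu> + n/2\<close> comes with the sign character \<open>\<xi>1 + \<eta>\<close> and \<open>s' = \<nu> - \<lambda>2 + n/2\<close> with the
  sign character \<open>\<xi>2 + \<eta>\<close> (lemma \<open>B_integral\<close>). These are local zeta integrals of smooth
  functions. They converge if \<open>Re s > 0\<close> and \<open>Re s' > 0\<close>, and after division by
  \<open>\<Gamma>((s + [\<epsilon>]) / 2)\<close> each of them continues to all \<open>s\<close>: splitting off the value at \<open>0\<close> of the even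
  part moves the integral one step to the left and produces one pole, which the reciprocal Gamma
  function cancels (\<open>local_zeta_Suc\<close>, \<open>zeta_distr\<close>). The normalizing factor is the product of the
  two Gamma functions, so each continued zeta integral is multiplied by the other reciprocal Gamma
  function; this gives \<open>B_extended\<close> for all parameters.

  The values have to be smooth in \<open>h\<close>, to depend continuously on \<open>f\<close>, and to depend holomorphically on
  the parameters as elements of a function space. All this is expressed by one notion, that of a
  \<open>smooth_family\<close>: a function \<open>W y p\<close>, smooth in \<open>p\<close>, with all derivatives in \<open>p\<close> jointly
  continuous in \<open>(y, p)\<close>, where \<open>y\<close> ranges over any topology. Evaluation \<open>(f, g) \<mapsto> f g\<close> is such a
  family over the Frechet topology (\<open>smooth_family_evaluation\<close>), the construction of the operator stays
  within smooth families (\<open>smooth_family_zeta_distr\<close>), and every smooth family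
  on the group is a continuous map into the Frechet space (\<open>continuous_map_smooth_GL\<close>). Complex
  differentiability in the Frechet space then follows from holomorphy of the single values
  (\<open>holomorphic_zeta_distr\<close>), because the difference quotient \<open>\<integral> \<partial>W(r \<zeta>) dr\<close> over \<open>[0, 1]\<close> is again
  a smooth family (\<open>difference_quotient_limit\<close>).

  The flat sections are explicit: by the Iwasawa decomposition they are \<open>F 0\<close> times
  \<open>twist \<lambda>1 \<lambda>2\<close>, an exponential which is entire in \<open>\<lambda>\<close> (\<open>flat_section_eq\<close>).

  Left translations by \<open>H\<close> visibly commute with the operator. The
  transformation law under the parabolic subgroup of \<open>H\<close> is a substitution \<open>t \<mapsto> c t\<close> in the
  integral (\<open>B_integral_equivariant\<close>). For the other parameters it follows by analytic continuation
  along \<open>(\<lambda>1 + \<zeta>, \<lambda>2 - \<zeta>)\<close>, a line which enters the domain of convergence as \<open>Re \<zeta>\<close> grows, with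
  \<open>f\<close> replaced by its flat continuation (\<open>B_extended_equivariant\<close>).
\<close>

section \<open>Jointly continuous families over a topology\<close>

text \<open>The parameter \<open>y\<close> ranges over a topology and not over a topological type, because it will be an
  element of a function space. For open \<open>S\<close> this is continuity of the uncurried map on the product
  of \<open>Y\<close> and \<open>S\<close>; the formulation with filters makes it compose well.\<close>

definition jointly_continuous ::
    "'y topology \<Rightarrow> 'a::t2_space set \<Rightarrow> ('y \<Rightarrow> 'a \<Rightarrow> 'b::topological_space) \<Rightarrow> bool" where
  "jointly_continuous Y S W \<longleftrightarrow> (\<forall>y\<in>topspace Y. \<forall>p\<in>S.
     ((\<lambda>(y', p'). W y' p') \<longlongrightarrow> W y p) (nhdsin Y y \<times>\<^sub>F nhds p))"

lemma jointly_continuousD: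
  assumes "jointly_continuous Y S W" "y \<in> topspace Y" "p \<in> S"
  shows "((\<lambda>(y', p'). W y' p') \<longlongrightarrow> W y p) (nhdsin Y y \<times>\<^sub>F nhds p)"
  using assms by (auto simp: jointly_continuous_def)

lemma eventually_in_topspace:
  assumes "y \<in> topspace Y" shows "eventually (\<lambda>y'. y' \<in> topspace Y) (nhdsin Y y)"
  using assms unfolding eventually_nhdsin by blast

lemma eventually_in_family_domain:
  assumes "y \<in> topspace Y" "open S" "p \<in> S"
  shows "eventually (\<lambda>(y', p'). y' \<in> topspace Y \<and> p' \<in> S) (nhdsin Y y \<times>\<^sub>F nhds p)"
  using eventually_prodI[OF eventually_in_topspace[OF assms(1)] eventually_nhds_in_open[OF assms(2,3)]]
  by (simp add: case_prod_unfold)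

lemma filterlim_nhdsin:
  assumes "continuous_map Y' Y \<sigma>" "y \<in> topspace Y'"
  shows "filterlim \<sigma> (nhdsin Y (\<sigma> y)) (nhdsin Y' y)"
  unfolding filterlim_iff
proof (intro allI impI)
  fix P assume "eventually P (nhdsin Y (\<sigma> y))"
  moreover have "\<sigma> y \<in> topspace Y"
    using assms by (auto simp: continuous_map_def)
  ultimately obtain U where U: "openin Y U" "\<sigma> y \<in> U" "\<forall>x\<in>U. P x"
    by (auto simp: eventually_nhdsin)
  have "openin Y' {x \<in> topspace Y'. \<sigma> x \<in> U}"
    using assms(1) U(1) by (auto simp: continuous_map_def)
  then show "eventually (\<lambda>x. P (\<sigma> x)) (nhdsin Y' y)"
    unfolding eventually_nhdsin using U assms(2)
    by (intro disjI2 exI[of _ "{x \<in> topspace Y'. \<sigma> x \<in> U}"]) auto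
qed

lemma jointly_continuous_const_param:
  assumes "open S" "continuous_on S g"
  shows "jointly_continuous Y S (\<lambda>_. g)"
  unfolding jointly_continuous_def
proof (intro ballI)
  fix y p assume "y \<in> topspace Y" "p \<in> S"
  then have "(g \<longlongrightarrow> g p) (nhds p)"
    using assms by (simp add: continuous_on_eq_continuous_at isCont_def tendsto_at_iff_tendsto_nhds)
  then have "filterlim (\<lambda>x. g (snd x)) (nhds (g p)) (nhdsin Y y \<times>\<^sub>F nhds p)"
    by (rule filterlim_compose) (rule filterlim_snd)
  then show "((\<lambda>(y', p'). g p') \<longlongrightarrow> g p) (nhdsin Y y \<times>\<^sub>F nhds p)"
    by (simp add: case_prod_unfold)
qed

lemma jointly_continuous_compose:
  assumes W: "jointly_continuous Y S W" and \<Phi>: "jointly_continuous Y' T \<Phi>"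
    and \<sigma>: "continuous_map Y' Y \<sigma>"
    and sub: "\<And>y p. y \<in> topspace Y' \<Longrightarrow> p \<in> T \<Longrightarrow> \<Phi> y p \<in> S"
  shows "jointly_continuous Y' T (\<lambda>y p. W (\<sigma> y) (\<Phi> y p))"
  unfolding jointly_continuous_def
proof (intro ballI)
  fix y p assume y: "y \<in> topspace Y'" and p: "p \<in> T"
  have "filterlim (\<lambda>x. (\<sigma> (fst x), (\<lambda>(y', p'). \<Phi> y' p') x))
      (nhdsin Y (\<sigma> y) \<times>\<^sub>F nhds (\<Phi> y p)) (nhdsin Y' y \<times>\<^sub>F nhds p)"
    by (intro filterlim_Pair filterlim_compose[OF filterlim_nhdsin[OF \<sigma> y] filterlim_fst]
          jointly_continuousD[OF \<Phi> y p])
  moreover have "\<sigma> y \<in> topspace Y" using \<sigma> y by (auto simp: continuous_map_def)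
  ultimately show "((\<lambda>(y', p'). W (\<sigma> y') (\<Phi> y' p')) \<longlongrightarrow> W (\<sigma> y) (\<Phi> y p)) (nhdsin Y' y \<times>\<^sub>F nhds p)"
    using filterlim_compose[OF jointly_continuousD[OF W]] sub[OF y p]
    by (fastforce simp: case_prod_unfold)
qed

lemma jointly_continuous_cong:
  assumes "open S" "jointly_continuous Y S W"
    and eq: "\<And>y p. y \<in> topspace Y \<Longrightarrow> p \<in> S \<Longrightarrow> W y p = V y p"
  shows "jointly_continuous Y S V"
  unfolding jointly_continuous_def
proof (intro ballI)
  fix y p assume y: "y \<in> topspace Y" and p: "p \<in> S"
  have "eventually (\<lambda>x. (\<lambda>(y', p'). W y' p') x = (\<lambda>(y', p'). V y' p') x) (nhdsin Y y \<times>\<^sub>F nhds p)"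
    using eventually_in_family_domain[OF y assms(1) p] by eventually_elim (auto simp: eq)
  then show "((\<lambda>(y', p'). V y' p') \<longlongrightarrow> V y p) (nhdsin Y y \<times>\<^sub>F nhds p)"
    using jointly_continuousD[OF assms(2) y p] eq[OF y p] by (simp cong: filterlim_cong)
qed

lemma jointly_continuous_bilinear:
  assumes B: "bounded_bilinear B"
    and V: "jointly_continuous Y S V" and W: "jointly_continuous Y S W"
  shows "jointly_continuous Y S (\<lambda>y p. B (V y p) (W y p))"
  unfolding jointly_continuous_def
proof (intro ballI)
  fix y p assume "y \<in> topspace Y" "p \<in> S"
  from bounded_bilinear.tendsto[OF B jointly_continuousD[OF V this] jointly_continuousD[OF W this]]
  show "((\<lambda>(y', p'). B (V y' p') (W y' p')) \<longlongrightarrow> B (V y p) (W y p)) (nhdsin Y y \<times>\<^sub>F nhds p)"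
    by (simp add: case_prod_unfold)
qed

lemma jointly_continuous_imp_continuous_on:
  assumes "jointly_continuous Y S W" "y \<in> topspace Y"
  shows "continuous_on S (W y)"
proof (intro continuous_at_imp_continuous_on ballI)
  fix p assume p: "p \<in> S"
  have "filterlim (\<lambda>x. (y, x)) (nhdsin Y y \<times>\<^sub>F nhds p) (nhds p)"
    by (intro filterlim_Pair filterlim_ident)
       (use assms(2) in \<open>auto simp: filterlim_iff eventually_nhdsin\<close>)
  from filterlim_compose[OF jointly_continuousD[OF assms p] this]
  show "isCont (W y) p" by (simp add: isCont_def flip: tendsto_at_iff_tendsto_nhds)
qed

section \<open>Families with jointly continuous derivatives\<close>

text \<open>Only the derivatives in \<open>p\<close> count, and they are taken in fixed directions \<open>v\<close>, so that the
  recursion stays within families with values in the same space.\<close>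

primrec Ck_family :: "nat \<Rightarrow> 'y topology \<Rightarrow> 'a::real_normed_vector set \<Rightarrow>
    ('y \<Rightarrow> 'a \<Rightarrow> 'b::real_normed_vector) \<Rightarrow> bool" where
  "Ck_family 0 Y S W \<longleftrightarrow> jointly_continuous Y S W"
| "Ck_family (Suc k) Y S W \<longleftrightarrow> jointly_continuous Y S W \<and>
     (\<forall>y\<in>topspace Y. \<forall>p\<in>S. W y differentiable (at p)) \<and>
     (\<forall>v. Ck_family k Y S (\<lambda>y p. frechet_derivative (W y) (at p) v))"

lemma Ck_family_cong:
  assumes "open S" "Ck_family k Y S W"
    and "\<And>y p. y \<in> topspace Y \<Longrightarrow> p \<in> S \<Longrightarrow> W y p = V y p"
  shows "Ck_family k Y S V"
  using assms(2,3)
proof (induction k arbitrary: W V)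
  case 0
  show ?case unfolding Ck_family.simps
    by (rule jointly_continuous_cong[OF assms(1), of Y W V]) (use 0 in simp_all)
next
  case (Suc k)
  have d: "(V y has_derivative frechet_derivative (W y) (at p)) (at p)"
    if "y \<in> topspace Y" "p \<in> S" for y p
  proof (rule has_derivative_transform_within_open[of "W y" _ p UNIV S])
    show "(W y has_derivative frechet_derivative (W y) (at p)) (at p)"
      using Suc.prems(1) that by (simp flip: frechet_derivative_works)
  qed (use that assms(1) Suc.prems(2) in simp_all)
  have e: "frechet_derivative (V y) (at p) = frechet_derivative (W y) (at p)"
    if "y \<in> topspace Y" "p \<in> S" for y p
    by (rule frechet_derivative_at[OF d[OF that], symmetric])
  have "jointly_continuous Y S V"
    using Suc.prems jointly_continuous_cong[OF assms(1), of Y W V] by auto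
  moreover have "Ck_family k Y S (\<lambda>y p. frechet_derivative (V y) (at p) v)" for v
  proof (rule Suc.IH)
    show "Ck_family k Y S (\<lambda>y p. frechet_derivative (W y) (at p) v)"
      using Suc.prems(1) by simp
  qed (simp add: e)
  ultimately show ?case using d unfolding Ck_family.simps differentiable_def by blast
qed

lemma Ck_family_SucI:
  assumes "open S" "jointly_continuous Y S W"
    and d: "\<And>y p. y \<in> topspace Y \<Longrightarrow> p \<in> S \<Longrightarrow> (W y has_derivative W' y p) (at p)"
    and "\<And>v. Ck_family k Y S (\<lambda>y p. W' y p v)"
  shows "Ck_family (Suc k) Y S W"
proof -
  have "Ck_family k Y S (\<lambda>y p. frechet_derivative (W y) (at p) v)" for v
    by (rule Ck_family_cong[OF assms(1) assms(4)[of v]]) (simp add: frechet_derivative_at[OF d])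
  then show ?thesis using assms(2) d unfolding Ck_family.simps differentiable_def by blast
qed

lemma Ck_family_imp_jointly_continuous: "Ck_family k Y S W \<Longrightarrow> jointly_continuous Y S W"
  by (cases k) auto

lemma Ck_family_SucD: "Ck_family (Suc k) Y S W \<Longrightarrow> Ck_family k Y S W"
proof (induction k arbitrary: W)
  case (Suc k)
  from Suc.prems have *: "Ck_family (Suc k) Y S (\<lambda>y p. frechet_derivative (W y) (at p) v)" for v
    unfolding Ck_family.simps(2)[of "Suc k"] by blast
  show ?case
    unfolding Ck_family.simps(2)[of k] using Suc.prems Suc.IH[OF *]
    unfolding Ck_family.simps(2)[of "Suc k"] by blast
qed simp

lemma Ck_family_has_derivative:
  assumes "Ck_family (Suc k) Y S W" "y \<in> topspace Y" "p \<in> S"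
  shows "(W y has_derivative frechet_derivative (W y) (at p)) (at p)"
  using assms by (simp flip: frechet_derivative_works)

lemma Ck_family_const:
  assumes "open S" shows "Ck_family k Y S (\<lambda>y p. c)"
proof (induction k arbitrary: c)
  case 0 then show ?case using assms by (simp add: jointly_continuous_const_param)
next
  case (Suc k)
  show ?case
    by (rule Ck_family_SucI[where W' = "\<lambda>y p v. 0"])
       (use Suc assms in \<open>auto simp: jointly_continuous_const_param\<close>)
qed

lemma Ck_family_linear:
  assumes "open S" "bounded_linear L" shows "Ck_family k Y S (\<lambda>y p. L p)"
proof (cases k)
  case 0 then show ?thesis using assms
    by (simp add: jointly_continuous_const_param linear_continuous_on)
next
  case (Suc k)
  have "Ck_family (Suc k) Y S (\<lambda>y p. L p)"
    using assms
    by (intro Ck_family_SucI[where W' = "\<lambda>y p v. L v"] bounded_linear_imp_has_derivative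
          Ck_family_const) (auto simp: jointly_continuous_const_param linear_continuous_on)
  then show ?thesis using Suc by simp
qed

lemma Ck_family_add:
  assumes "open S" "Ck_family k Y S V" "Ck_family k Y S W"
  shows "Ck_family k Y S (\<lambda>y p. V y p + W y p)"
  using assms(2,3)
proof (induction k arbitrary: V W)
  case 0
  then show ?case
    by (auto simp: jointly_continuous_def case_prod_unfold intro!: tendsto_add)
next
  case (Suc k)
  show ?case
  proof (rule Ck_family_SucI[OF assms(1), where W' = "\<lambda>y p v.
      frechet_derivative (V y) (at p) v + frechet_derivative (W y) (at p) v"])
    show "jointly_continuous Y S (\<lambda>y p. V y p + W y p)"
      using Suc.prems by (auto simp: jointly_continuous_def case_prod_unfold intro!: tendsto_add)
    show "((\<lambda>p. V y p + W y p) has_derivative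
        (\<lambda>v. frechet_derivative (V y) (at p) v + frechet_derivative (W y) (at p) v)) (at p)"
      if "y \<in> topspace Y" "p \<in> S" for y p
      using that Suc.prems by (intro has_derivative_add Ck_family_has_derivative)
    show "Ck_family k Y S (\<lambda>y p. frechet_derivative (V y) (at p) v + frechet_derivative (W y) (at p) v)" for v
      by (rule Suc.IH) (use Suc.prems in simp_all)
  qed
qed

lemma Ck_family_sum:
  assumes "open S" "\<And>i. i \<in> I \<Longrightarrow> Ck_family k Y S (W i)"
  shows "Ck_family k Y S (\<lambda>y p. \<Sum>i\<in>I. W i y p)"
  using assms(2)
  by (induction I rule: infinite_finite_induct)
     (auto simp: Ck_family_const Ck_family_add assms(1))

lemma Ck_family_bilinear:
  assumes "open S" "bounded_bilinear B" "Ck_family k Y S V" "Ck_family k Y S W"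
  shows "Ck_family k Y S (\<lambda>y p. B (V y p) (W y p))"
  using assms(3,4)
proof (induction k arbitrary: V W)
  case 0
  then show ?case by (simp add: jointly_continuous_bilinear[OF assms(2)])
next
  case (Suc k)
  show ?case
  proof (rule Ck_family_SucI[OF assms(1), where W' = "\<lambda>y p v.
      B (V y p) (frechet_derivative (W y) (at p) v) + B (frechet_derivative (V y) (at p) v) (W y p)"])
    show "jointly_continuous Y S (\<lambda>y p. B (V y p) (W y p))"
      using Suc.prems by (simp add: jointly_continuous_bilinear[OF assms(2)])
    show "((\<lambda>p. B (V y p) (W y p)) has_derivative (\<lambda>v. B (V y p) (frechet_derivative (W y) (at p) v)
        + B (frechet_derivative (V y) (at p) v) (W y p))) (at p)"
      if "y \<in> topspace Y" "p \<in> S" for y p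
      using that Suc.prems by (intro bounded_bilinear.FDERIV[OF assms(2)] Ck_family_has_derivative)
    show "Ck_family k Y S (\<lambda>y p. B (V y p) (frechet_derivative (W y) (at p) v)
        + B (frechet_derivative (V y) (at p) v) (W y p))" for v
      using Suc.prems Ck_family_SucD[OF Suc.prems(1)] Ck_family_SucD[OF Suc.prems(2)]
      by (intro Ck_family_add assms(1) Suc.IH) simp_all
  qed
qed

text \<open>By the chain rule the derivative of the composition in direction \<open>v\<close> is the sum over basis vectors
  \<open>b\<close> of the coordinate of the inner derivative along \<open>b\<close> times the outer derivative along \<open>b\<close>.
  Writing it in coordinates reduces the induction step to products of families of lower order.\<close>

lemma Ck_family_compose:
  fixes W :: "'y \<Rightarrow> 'b::euclidean_space \<Rightarrow> 'c::real_normed_vector"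
  assumes "open S" "open T"
    and W: "Ck_family k Y S W" and \<Phi>: "Ck_family k Y' T \<Phi>"
    and \<sigma>: "continuous_map Y' Y \<sigma>"
    and sub: "\<And>y p. y \<in> topspace Y' \<Longrightarrow> p \<in> T \<Longrightarrow> \<Phi> y p \<in> S"
  shows "Ck_family k Y' T (\<lambda>y p. W (\<sigma> y) (\<Phi> y p))"
  using W \<Phi>
proof (induction k arbitrary: W)
  case 0
  show ?case unfolding Ck_family.simps
    by (rule jointly_continuous_compose[OF _ _ \<sigma> sub]) (use 0 in simp_all)
next
  case (Suc k)
  have \<sigma>Y: "\<sigma> y \<in> topspace Y" if "y \<in> topspace Y'" for y
    using \<sigma> that by (auto simp: continuous_map_def)
  let ?D = "\<lambda>y p. frechet_derivative (W y) (at p)"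
  show ?case
  proof (rule Ck_family_SucI[OF assms(2), where W' = "\<lambda>y p v.
      \<Sum>b\<in>Basis. (frechet_derivative (\<Phi> y) (at p) v \<bullet> b) *\<^sub>R ?D (\<sigma> y) (\<Phi> y p) b"])
    show "jointly_continuous Y' T (\<lambda>y p. W (\<sigma> y) (\<Phi> y p))"
      by (rule jointly_continuous_compose[OF _ _ \<sigma> sub]) (use Suc.prems in simp_all)
    show "((\<lambda>p. W (\<sigma> y) (\<Phi> y p)) has_derivative (\<lambda>v.
      \<Sum>b\<in>Basis. (frechet_derivative (\<Phi> y) (at p) v \<bullet> b) *\<^sub>R ?D (\<sigma> y) (\<Phi> y p) b)) (at p)"
      if "y \<in> topspace Y'" "p \<in> T" for y p
    proof -
      have dW: "(W (\<sigma> y) has_derivative ?D (\<sigma> y) (\<Phi> y p)) (at (\<Phi> y p))"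
        by (rule Ck_family_has_derivative[OF Suc.prems(1) \<sigma>Y[OF that(1)] sub[OF that]])
      have lin: "linear (?D (\<sigma> y) (\<Phi> y p))"
        using dW has_derivative_linear by blast
      have "(\<Sum>b\<in>Basis. (u \<bullet> b) *\<^sub>R ?D (\<sigma> y) (\<Phi> y p) b) = ?D (\<sigma> y) (\<Phi> y p) u" for u
      proof -
        have "?D (\<sigma> y) (\<Phi> y p) u = ?D (\<sigma> y) (\<Phi> y p) (\<Sum>b\<in>Basis. (u \<bullet> b) *\<^sub>R b)"
          by (simp only: euclidean_representation)
        then show ?thesis by (simp only: linear_sum[OF lin] linear_scale[OF lin])
      qed
      then show ?thesis
        using has_derivative_compose[OF Ck_family_has_derivative[OF Suc.prems(2) that] dW] by (simp only:)
    qed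
    have "Ck_family k Y' T (\<lambda>y p. frechet_derivative (\<Phi> y) (at p) v \<bullet> b)" for v b
    proof (rule Ck_family_bilinear[OF assms(2) bounded_bilinear_inner])
      show "Ck_family k Y' T (\<lambda>y p. frechet_derivative (\<Phi> y) (at p) v)"
        using Suc.prems(2) by simp
    qed (rule Ck_family_const[OF assms(2)])
    moreover have "Ck_family k Y' T (\<lambda>y p. ?D (\<sigma> y) (\<Phi> y p) b)" for b
      using Suc.prems(1) Ck_family_SucD[OF Suc.prems(2)] by (intro Suc.IH) simp_all
    ultimately show "Ck_family k Y' T (\<lambda>y p. \<Sum>b\<in>Basis.
        (frechet_derivative (\<Phi> y) (at p) v \<bullet> b) *\<^sub>R ?D (\<sigma> y) (\<Phi> y p) b)" for v
      by (intro Ck_family_sum[OF assms(2)] Ck_family_bilinear[OF assms(2) bounded_bilinear_scaleR]) simp_all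
  qed
qed

lemma Ck_family_holomorphic:
  assumes "open S" "F holomorphic_on S"
  shows "Ck_family k Y S (\<lambda>y. F)"
  using assms(2)
proof (induction k arbitrary: F)
  case 0
  then show ?case
    using assms(1) by (simp add: jointly_continuous_const_param holomorphic_on_imp_continuous_on)
next
  case (Suc k)
  show ?case
  proof (rule Ck_family_SucI[OF assms(1), where W' = "\<lambda>y p v. deriv F p * v"])
    show "jointly_continuous Y S (\<lambda>y. F)"
      using Suc.prems assms(1) by (intro jointly_continuous_const_param holomorphic_on_imp_continuous_on)
    show "(F has_derivative (*) (deriv F p)) (at p)" if "p \<in> S" for p
      using holomorphic_derivI[OF Suc.prems assms(1) that] by (simp add: has_field_derivative_def)
    show "Ck_family k Y S (\<lambda>y p. deriv F p * v)" for v
      by (rule Ck_family_bilinear[OF assms(1) bounded_bilinear_mult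
            Suc.IH[OF holomorphic_deriv[OF Suc.prems assms(1)]] Ck_family_const[OF assms(1)]])
  qed
qed

lemma Ck_family_Union:
  assumes "\<And>i. i \<in> I \<Longrightarrow> Ck_family k Y (S i) W"
  shows "Ck_family k Y (\<Union>i\<in>I. S i) W"
  using assms
proof (induction k arbitrary: W)
  case 0 then show ?case by (auto simp: jointly_continuous_def)
next
  case (Suc k)
  then have "jointly_continuous Y (S i) W" if "i \<in> I" for i
    using that by simp
  then have "jointly_continuous Y (\<Union>i\<in>I. S i) W"
    by (auto simp: jointly_continuous_def)
  moreover have "Ck_family k Y (\<Union>i\<in>I. S i) (\<lambda>y p. frechet_derivative (W y) (at p) v)" for v
    by (rule Suc.IH) (use Suc.prems in simp)
  moreover have "W y differentiable (at p)" if "y \<in> topspace Y" "p \<in> (\<Union>i\<in>I. S i)" for y p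
    using Suc.prems that by auto
  ultimately show ?case by simp
qed

section \<open>Smooth families\<close>

definition smooth_family :: "'y topology \<Rightarrow> 'a::real_normed_vector set \<Rightarrow>
    ('y \<Rightarrow> 'a \<Rightarrow> 'b::real_normed_vector) \<Rightarrow> bool" where
  "smooth_family Y S W \<longleftrightarrow> (\<forall>k. Ck_family k Y S W)"

text \<open>A function of the parameter alone is constant in \<open>p\<close>, so that its derivatives vanish.\<close>

lemma Ck_family_param:
  assumes "open S" "continuous_map Y euclidean g"
  shows "Ck_family k Y S (\<lambda>y p. g y)"
proof -
  have jc: "jointly_continuous Y S (\<lambda>y p. g y)"
    unfolding jointly_continuous_def
  proof (intro ballI)
    fix y p assume y: "y \<in> topspace Y"
    have "((\<lambda>x. g (fst x)) \<longlongrightarrow> g y) (nhdsin Y y \<times>\<^sub>F nhds p)"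
    proof (rule filterlim_compose[OF _ filterlim_fst])
      show "(g \<longlongrightarrow> g y) (nhdsin Y y)"
        unfolding tendsto_def
      proof (intro allI impI)
        fix U assume U: "open U" "g y \<in> U"
        have "openin Y {x \<in> topspace Y. g x \<in> U}"
          using assms(2) U(1) by (auto simp: continuous_map_def)
        then show "eventually (\<lambda>x. g x \<in> U) (nhdsin Y y)"
          unfolding eventually_nhdsin using U(2) y
          by (intro disjI2 exI[of _ "{x \<in> topspace Y. g x \<in> U}"]) auto
      qed
    qed
    then show "((\<lambda>(y', p'). g y') \<longlongrightarrow> g y) (nhdsin Y y \<times>\<^sub>F nhds p)"
      by (simp add: case_prod_unfold)
  qed
  show ?thesis
  proof (cases k)
    case (Suc l)
    have "Ck_family (Suc l) Y S (\<lambda>y p. g y)"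
      by (rule Ck_family_SucI[OF assms(1) jc, where W' = "\<lambda>y p v. 0"])
        (simp_all add: Ck_family_const[OF assms(1)])
    then show ?thesis using Suc by simp
  qed (use jc in simp)
qed

lemma smooth_family_cong:
  assumes "open S" "smooth_family Y S W"
    and "\<And>y p. y \<in> topspace Y \<Longrightarrow> p \<in> S \<Longrightarrow> W y p = V y p"
  shows "smooth_family Y S V"
  using assms(2) Ck_family_cong[OF assms(1), of _ Y W V] assms(3) unfolding smooth_family_def by simp

lemma smooth_family_const: "open S \<Longrightarrow> smooth_family Y S (\<lambda>y p. c)"
  by (simp add: smooth_family_def Ck_family_const)

lemma smooth_family_param:
  "open S \<Longrightarrow> continuous_map Y euclidean g \<Longrightarrow> smooth_family Y S (\<lambda>y p. g y)"
  by (simp add: smooth_family_def Ck_family_param)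

lemma smooth_family_linear:
  "open S \<Longrightarrow> bounded_linear L \<Longrightarrow> smooth_family Y S (\<lambda>y p. L p)"
  by (simp add: smooth_family_def Ck_family_linear)

lemma smooth_family_add:
  "open S \<Longrightarrow> smooth_family Y S V \<Longrightarrow> smooth_family Y S W \<Longrightarrow>
    smooth_family Y S (\<lambda>y p. V y p + W y p)"
  by (simp add: smooth_family_def Ck_family_add)

lemma smooth_family_sum:
  "open S \<Longrightarrow> (\<And>i. i \<in> I \<Longrightarrow> smooth_family Y S (W i)) \<Longrightarrow>
    smooth_family Y S (\<lambda>y p. \<Sum>i\<in>I. W i y p)"
  by (simp add: smooth_family_def Ck_family_sum)

lemma smooth_family_bilinear:
  "open S \<Longrightarrow> bounded_bilinear B \<Longrightarrow> smooth_family Y S V \<Longrightarrow> smooth_family Y S W \<Longrightarrow>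
    smooth_family Y S (\<lambda>y p. B (V y p) (W y p))"
  by (simp add: smooth_family_def Ck_family_bilinear)

lemma smooth_family_mult:
  fixes V W :: "'y \<Rightarrow> 'a::real_normed_vector \<Rightarrow> 'b::real_normed_algebra"
  shows "open S \<Longrightarrow> smooth_family Y S V \<Longrightarrow> smooth_family Y S W \<Longrightarrow>
    smooth_family Y S (\<lambda>y p. V y p * W y p)"
  by (rule smooth_family_bilinear[OF _ bounded_bilinear_mult])

lemma smooth_family_prod:
  fixes W :: "'i \<Rightarrow> 'y \<Rightarrow> 'a::real_normed_vector \<Rightarrow> 'b::{real_normed_algebra, comm_monoid_mult}"
  assumes "open S" "\<And>i. i \<in> I \<Longrightarrow> smooth_family Y S (W i)"
  shows "smooth_family Y S (\<lambda>y p. \<Prod>i\<in>I. W i y p)"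
  using assms(2)
  by (induction I rule: infinite_finite_induct)
     (auto simp: smooth_family_const smooth_family_mult assms(1))

text \<open>The parameter may be changed by any continuous map and the variable by any smooth family. Nearly
  all smoothness statements below are instances of this.\<close>

lemma smooth_family_compose:
  fixes W :: "'y \<Rightarrow> 'b::euclidean_space \<Rightarrow> 'c::real_normed_vector"
  assumes "open S" "open T" "smooth_family Y S W" "smooth_family Y' T \<Phi>" "continuous_map Y' Y \<sigma>"
    and "\<And>y p. y \<in> topspace Y' \<Longrightarrow> p \<in> T \<Longrightarrow> \<Phi> y p \<in> S"
  shows "smooth_family Y' T (\<lambda>y p. W (\<sigma> y) (\<Phi> y p))"
  unfolding smooth_family_def
proof
  fix k
  show "Ck_family k Y' T (\<lambda>y p. W (\<sigma> y) (\<Phi> y p))"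
    by (rule Ck_family_compose[OF assms(1,2) _ _ assms(5)])
       (use assms(3,4,6) in \<open>simp_all add: smooth_family_def\<close>)
qed

lemma smooth_family_post_linear:
  fixes W :: "'y \<Rightarrow> 'a::real_normed_vector \<Rightarrow> 'b::euclidean_space"
  assumes "open S" "bounded_linear L" "smooth_family Y S W"
  shows "smooth_family Y S (\<lambda>y p. L (W y p))"
  by (rule smooth_family_compose[where W = "\<lambda>_. L" and \<sigma> = "\<lambda>y. y" and S = UNIV and Y = Y])
     (use assms in \<open>auto intro: smooth_family_linear\<close>)

lemma smooth_family_holomorphic:
  fixes W :: "'y \<Rightarrow> 'a::real_normed_vector \<Rightarrow> complex"
  assumes "open T" "F holomorphic_on T" "open S" "smooth_family Y S W"
    and "\<And>y p. y \<in> topspace Y \<Longrightarrow> p \<in> S \<Longrightarrow> W y p \<in> T"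
  shows "smooth_family Y S (\<lambda>y p. F (W y p))"
  by (rule smooth_family_compose[where W = "\<lambda>_. F" and \<sigma> = "\<lambda>y. y" and S = T and Y = Y])
     (use assms in \<open>auto simp: smooth_family_def[of _ T] Ck_family_holomorphic\<close>)

lemma smooth_family_Union:
  "(\<And>i. i \<in> I \<Longrightarrow> smooth_family Y (S i) W) \<Longrightarrow> smooth_family Y (\<Union>i\<in>I. S i) W"
  by (simp add: smooth_family_def Ck_family_Union)

lemma smooth_family_imp_jointly_continuous:
  assumes "smooth_family Y S W" shows "jointly_continuous Y S W"
proof -
  have "Ck_family 0 Y S W" using assms unfolding smooth_family_def by blast
  then show ?thesis by simp
qed

lemma smooth_family_has_derivative:
  assumes "smooth_family Y S W" "y \<in> topspace Y" "p \<in> S"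
  shows "(W y has_derivative frechet_derivative (W y) (at p)) (at p)"
proof -
  have "Ck_family (Suc 0) Y S W" using assms(1) unfolding smooth_family_def by blast
  then show ?thesis by (rule Ck_family_has_derivative[OF _ assms(2,3)])
qed

lemma smooth_family_frechet_derivative:
  assumes "smooth_family Y S W"
  shows "smooth_family Y S (\<lambda>y p. frechet_derivative (W y) (at p) v)"
  unfolding smooth_family_def
proof
  fix k
  have "Ck_family (Suc k) Y S W" using assms unfolding smooth_family_def by blast
  then show "Ck_family k Y S (\<lambda>y p. frechet_derivative (W y) (at p) v)" by simp
qed

lemma smooth_family_Pair:
  fixes V :: "'y \<Rightarrow> 'a::real_normed_vector \<Rightarrow> 'b::euclidean_space"
    and W :: "'y \<Rightarrow> 'a \<Rightarrow> 'c::euclidean_space"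
  assumes "open S" "smooth_family Y S V" "smooth_family Y S W"
  shows "smooth_family Y S (\<lambda>y p. (V y p, W y p))"
proof -
  have 1: "smooth_family Y S (\<lambda>y p. (V y p, 0::'c))"
    by (rule smooth_family_post_linear[where L = "\<lambda>x. (x, 0)", OF assms(1) _ assms(2)])
       (intro bounded_linear_Pair bounded_linear_ident bounded_linear_zero)
  have 2: "smooth_family Y S (\<lambda>y p. (0::'b, W y p))"
    by (rule smooth_family_post_linear[where L = "\<lambda>x. (0, x)", OF assms(1) _ assms(3)])
       (intro bounded_linear_Pair bounded_linear_ident bounded_linear_zero)
  show ?thesis using smooth_family_add[OF assms(1) 1 2] by simp
qed

lemma smooth_family_subset:
  fixes W :: "'y \<Rightarrow> 'a::euclidean_space \<Rightarrow> 'b::real_normed_vector"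
  assumes "open S" "open T" "T \<subseteq> S" "smooth_family Y S W"
  shows "smooth_family Y T W"
  by (rule smooth_family_compose[where \<Phi> = "\<lambda>_ p. p" and \<sigma> = "\<lambda>y. y", OF assms(1,2,4)])
     (use assms in \<open>auto intro: smooth_family_linear\<close>)

section \<open>Integrals of smooth families over a parameter\<close>

text \<open>The tube lemma for filters.\<close>

lemma eventually_ball_compact:
  assumes "compact K" and "\<And>t. t \<in> K \<Longrightarrow> eventually (\<lambda>(a, t'). t' \<in> K \<longrightarrow> Q a t') (F \<times>\<^sub>F nhds t)"
  shows "eventually (\<lambda>a. \<forall>t\<in>K. Q a t) F"
proof -
  have "\<forall>t\<in>K. \<exists>P V. eventually P F \<and> open V \<and> t \<in> V \<and> (\<forall>a t'. P a \<longrightarrow> t' \<in> V \<inter> K \<longrightarrow> Q a t')"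
  proof
    fix t assume "t \<in> K"
    from assms(2)[OF this] obtain P P' where PP: "eventually P F" "eventually P' (nhds t)"
      "\<And>a t'. P a \<Longrightarrow> P' t' \<Longrightarrow> t' \<in> K \<Longrightarrow> Q a t'"
      by (auto simp: eventually_prod_filter)
    from PP(2) obtain V where "open V" "t \<in> V" "\<And>t'. t' \<in> V \<Longrightarrow> P' t'"
      by (auto simp: eventually_nhds)
    with PP(1,3) show "\<exists>P V. eventually P F \<and> open V \<and> t \<in> V \<and> (\<forall>a t'. P a \<longrightarrow> t' \<in> V \<inter> K \<longrightarrow> Q a t')"
      by (intro exI[of _ P] exI[of _ V]) auto
  qed
  then obtain P V where PV: "\<And>t. t \<in> K \<Longrightarrow> eventually (P t) F" "\<And>t. t \<in> K \<Longrightarrow> open (V t)"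
    "\<And>t. t \<in> K \<Longrightarrow> t \<in> V t" "\<And>t a t'. t \<in> K \<Longrightarrow> P t a \<Longrightarrow> t' \<in> V t \<inter> K \<Longrightarrow> Q a t'"
    by metis
  obtain D where D: "D \<subseteq> K" "finite D" "K \<subseteq> (\<Union>t\<in>D. V t)"
    using compactE_image[OF assms(1), of K V] PV by (metis UN_I subsetI)
  have "eventually (\<lambda>a. \<forall>t\<in>D. P t a) F"
    using D PV(1) by (intro eventually_ball_finite) auto
  then show ?thesis
    by eventually_elim (use D PV(4) in blast)
qed

lemma eventually_nhdsin_prod_interval:
  assumes "eventually P (nhdsin (prod_topology Y (top_of_set I)) (y, t))" "y \<in> topspace Y" "t \<in> I"
  shows "eventually (\<lambda>(y', t'). t' \<in> I \<longrightarrow> P (y', t')) (nhdsin Y y \<times>\<^sub>F nhds t)"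
proof -
  have yt: "(y, t) \<in> topspace (prod_topology Y (top_of_set I))" using assms(2,3) by simp
  obtain U where U: "openin (prod_topology Y (top_of_set I)) U" "(y, t) \<in> U" "\<And>x. x \<in> U \<Longrightarrow> P x"
    using assms(1) yt unfolding eventually_nhdsin by meson
  then obtain A B where AB: "openin Y A" "openin (top_of_set I) B" "y \<in> A" "t \<in> B" "A \<times> B \<subseteq> U"
    unfolding openin_prod_topology_alt by meson
  then obtain T where T: "open T" "B = I \<inter> T"
    by (auto simp: openin_open)
  have "eventually (\<lambda>y'. y' \<in> A) (nhdsin Y y)"
    using AB by (auto simp: eventually_nhdsin)
  moreover have "eventually (\<lambda>t'. t' \<in> T) (nhds t)"
    using T AB by (auto intro: eventually_nhds_in_open)
  ultimately have "eventually (\<lambda>x. fst x \<in> A \<and> snd x \<in> T) (nhdsin Y y \<times>\<^sub>F nhds t)"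
    by (rule eventually_prodI)
  then show ?thesis
  proof (rule eventually_mono)
    fix x assume x: "fst x \<in> A \<and> snd x \<in> T"
    show "case x of (y', t') \<Rightarrow> t' \<in> I \<longrightarrow> P (y', t')"
    proof (cases x)
      case (Pair y' t')
      have "(y', t') \<in> U" if "t' \<in> I"
        using AB(5) x T(2) Pair that by (simp add: subset_iff)
      then show ?thesis using U(3) Pair by simp
    qed
  qed
qed

lemma jointly_continuous_interval:
  assumes "jointly_continuous (prod_topology Y (top_of_set I)) S W" "y \<in> topspace Y"
  shows "continuous_on (S \<times> I) (\<lambda>(p, t). W (y, t) p)"
  unfolding continuous_on_def
proof (rule ballI)
  fix x assume "x \<in> S \<times> I"
  then obtain p t where x: "x = (p, t)" "p \<in> S" "t \<in> I" by auto
  have "((\<lambda>(y', p'). W y' p') \<longlongrightarrow> W (y, t) p) (nhdsin (prod_topology Y (top_of_set I)) (y, t) \<times>\<^sub>F nhds p)"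
    using jointly_continuousD[OF assms(1)] x assms(2) by auto
  moreover have "filterlim (\<lambda>x'. ((y, snd x'), fst x'))
      (nhdsin (prod_topology Y (top_of_set I)) (y, t) \<times>\<^sub>F nhds p) (at x within S \<times> I)"
  proof (rule filterlim_Pair)
    show "filterlim (\<lambda>x'. (y, snd x')) (nhdsin (prod_topology Y (top_of_set I)) (y, t)) (at x within S \<times> I)"
      unfolding filterlim_iff
    proof (intro allI impI)
      fix P assume "eventually P (nhdsin (prod_topology Y (top_of_set I)) (y, t))"
      from eventually_nhdsin_prod_interval[OF this assms(2) x(3)]
      obtain Q R where QR: "eventually Q (nhdsin Y y)" "eventually R (nhds t)"
        "\<And>y' t'. Q y' \<Longrightarrow> R t' \<Longrightarrow> t' \<in> I \<Longrightarrow> P (y', t')"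
        by (auto simp: eventually_prod_filter)
      have "Q y" using QR(1) assms(2) by (auto simp: eventually_nhdsin)
      obtain T where T: "open T" "t \<in> T" "\<And>t'. t' \<in> T \<Longrightarrow> R t'" using QR(2) by (auto simp: eventually_nhds)
      have "eventually (\<lambda>x'. x' \<in> UNIV \<times> T) (nhds x)"
        using T x by (intro eventually_nhds_in_open) (auto intro: open_Times)
      then show "eventually (\<lambda>x'. P (y, snd x')) (at x within S \<times> I)"
        unfolding eventually_at_filter
        by eventually_elim (use QR(3)[OF \<open>Q y\<close>] T in auto)
    qed
    show "filterlim fst (nhds p) (at x within S \<times> I)"
      using tendsto_fst[OF tendsto_ident_at, of x "S \<times> I"] x by simp
  qed
  ultimately show "((\<lambda>(p, t). W (y, t) p) \<longlongrightarrow> (case x of (p, t) \<Rightarrow> W (y, t) p)) (at x within S \<times> I)"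
    using filterlim_compose x by (fastforce simp: case_prod_unfold)
qed

text \<open>By compactness of the interval, the integrand is uniformly close to its value at the given point.\<close>

lemma jointly_continuous_integral:
  fixes W :: "'y \<times> real \<Rightarrow> 'a::t2_space \<Rightarrow> 'b::banach"
  assumes S: "open S" and W: "jointly_continuous (prod_topology Y (top_of_set {0..1})) S W"
  shows "jointly_continuous Y S (\<lambda>y p. integral {0..1} (\<lambda>t. W (y, t) p))"
  unfolding jointly_continuous_def
proof (intro ballI tendstoI)
  fix y0 p0 and e :: real
  assume y0: "y0 \<in> topspace Y" and p0: "p0 \<in> S" and e: "0 < e"
  let ?F = "nhdsin Y y0 \<times>\<^sub>F nhds p0"
  have "eventually (\<lambda>a. \<forall>t\<in>{0..1}. dist (W (fst a, t) (snd a)) (W (y0, t) p0) < e/2) ?F"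
  proof (rule eventually_ball_compact)
    fix t :: real assume t: "t \<in> {0..1}"
    have "eventually (\<lambda>(q, p). dist (W q p) (W (y0, t) p0) < e/4)
        (nhdsin (prod_topology Y (top_of_set {0..1})) (y0, t) \<times>\<^sub>F nhds p0)"
      using tendstoD[OF jointly_continuousD[OF W], of "(y0, t)" p0 "e/4"] y0 t p0 e
      by (auto simp: case_prod_unfold)
    then obtain P R where PR: "eventually P (nhdsin (prod_topology Y (top_of_set {0..1})) (y0, t))"
      "eventually R (nhds p0)" "\<And>q p. P q \<Longrightarrow> R p \<Longrightarrow> dist (W q p) (W (y0, t) p0) < e/4"
      by (auto simp: eventually_prod_filter)
    obtain Q T where QT: "eventually Q (nhdsin Y y0)" "eventually T (nhds t)"
        "\<And>y' t'. Q y' \<Longrightarrow> T t' \<Longrightarrow> t' \<in> {0..1} \<Longrightarrow> P (y', t')"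
      using eventually_nhdsin_prod_interval[OF PR(1) y0 t] by (auto simp: eventually_prod_filter)
    have Q0: "Q y0" and R0: "R p0"
      using QT(1) PR(2) y0 by (auto simp: eventually_nhdsin dest: eventually_nhds_x_imp_x)
    have "t' \<in> {0..1} \<longrightarrow> dist (W (y, t') p) (W (y0, t') p0) < e/2"
      if "Q y" "R p" "T t'" for y p t'
    proof
      assume "t' \<in> {0..1}"
      then have "dist (W (y, t') p) (W (y0, t) p0) < e/4" "dist (W (y0, t') p0) (W (y0, t) p0) < e/4"
        using QT(3) PR(3) that Q0 R0 by auto
      then show "dist (W (y, t') p) (W (y0, t') p0) < e/2"
        using dist_triangle2[of "W (y, t') p" "W (y0, t') p0" "W (y0, t) p0"] by simp
    qed
    moreover have "eventually (\<lambda>(a, t'). (Q (fst a) \<and> R (snd a)) \<and> T t') (?F \<times>\<^sub>F nhds t)"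
      using eventually_prodI[OF eventually_prodI[OF QT(1) PR(2)] QT(2)]
      by (simp add: case_prod_unfold)
    ultimately show "eventually (\<lambda>(a, t'). t' \<in> {0..1} \<longrightarrow>
        dist (W (fst a, t') (snd a)) (W (y0, t') p0) < e/2) (?F \<times>\<^sub>F nhds t)"
      by (auto elim!: eventually_mono)
  qed simp
  then show "eventually (\<lambda>x. dist (case x of (y', p') \<Rightarrow> integral {0..1} (\<lambda>t. W (y', t) p'))
      (integral {0..1} (\<lambda>t. W (y0, t) p0)) < e) ?F"
    using eventually_in_family_domain[OF y0 S p0]
  proof eventually_elim
    case (elim x)
    obtain y p where x: "x = (y, p)" by force
    have c: "continuous_on {0..1} (\<lambda>t. W (y, t) p)" if "y \<in> topspace Y" "p \<in> S" for y p
      using that continuous_on_compose2[OF jointly_continuous_interval[OF W that(1)],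
          of "{0..1}" "\<lambda>t. (p, t)"]
      by (simp add: continuous_on_Pair image_subset_iff continuous_on_const continuous_on_id)
    have c1: "continuous_on {0..1} (\<lambda>t. W (y, t) p)" and c0: "continuous_on {0..1} (\<lambda>t. W (y0, t) p0)"
      using c elim x y0 p0 by auto
    have "norm (integral {0..1} (\<lambda>t. W (y, t) p - W (y0, t) p0)) \<le> e/2 * (1 - 0)"
      using elim x by (intro integral_bound continuous_on_diff c1 c0) (auto simp: dist_norm intro: less_imp_le)
    then show ?case
      using e by (simp add: x dist_norm integral_diff integrable_continuous_interval c1 c0)
  qed
qed

text \<open>The variable of integration counts as part of the parameter. Differentiation under the integral
  sign needs the total derivative of the integrand to be continuous as an operator; this holds
  because it is continuous in every direction and the space is finite-dimensional.\<close>

lemma Ck_family_integral: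
  fixes W :: "'y \<times> real \<Rightarrow> 'a::euclidean_space \<Rightarrow> 'b::banach"
  assumes S: "open S" and W: "Ck_family k (prod_topology Y (top_of_set {0..1})) S W"
  shows "Ck_family k Y S (\<lambda>y p. integral {0..1} (\<lambda>t. W (y, t) p))"
  using W
proof (induction k arbitrary: W)
  case 0 then show ?case using jointly_continuous_integral[OF S] by simp
next
  case (Suc k)
  let ?Y = "prod_topology Y (top_of_set {0..1::real})"
  let ?D = "\<lambda>y t p v. frechet_derivative (W (y, t)) (at p) v"
  have D: "Ck_family k ?Y S (\<lambda>q p. frechet_derivative (W q) (at p) v)" for v
    using Suc.prems by simp
  show ?case
  proof (rule Ck_family_SucI[OF S, where W' = "\<lambda>y p v. integral {0..1} (\<lambda>t. ?D y t p v)"])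
    show "jointly_continuous Y S (\<lambda>y p. integral {0..1} (\<lambda>t. W (y, t) p))"
      by (rule jointly_continuous_integral[OF S]) (use Suc.prems in simp)
    show "Ck_family k Y S (\<lambda>y p. integral {0..1} (\<lambda>t. ?D y t p v))" for v
      using Suc.IH[OF D] .
    show "((\<lambda>p. integral {0..1} (\<lambda>t. W (y, t) p)) has_derivative (\<lambda>v. integral {0..1} (\<lambda>t. ?D y t p v))) (at p)"
      if y: "y \<in> topspace Y" and p: "p \<in> S" for y p
    proof -
      obtain r where r: "0 < r" "ball p r \<subseteq> S"
        using S p by (auto simp: open_contains_ball)
      have dW: "(W (y, t) has_derivative ?D y t q) (at q)" if "t \<in> {0..1}" "q \<in> S" for t q
        using Ck_family_has_derivative[OF Suc.prems] that y by simp
      let ?fx = "\<lambda>q t. Blinfun (?D y t q)"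
      have bl: "blinfun_apply (?fx q t) = ?D y t q" if "t \<in> {0..1}" "q \<in> S" for t q
        using has_derivative_bounded_linear[OF dW[OF that]] by (simp add: bounded_linear_Blinfun_apply)
      \<comment> \<open>The total derivative as an operator is continuous because each directional derivative is.\<close>
      have cfx: "continuous_on (ball p r \<times> {0..1}) (\<lambda>x. ?fx (fst x) (snd x))"
      proof (rule continuous_on_blinfun_componentwise)
        fix i :: 'a
        have "continuous_on (S \<times> {0..1}) (\<lambda>(q, t). ?D y t q i)"
          by (rule jointly_continuous_interval[OF Ck_family_imp_jointly_continuous[OF D] y])
        then have "continuous_on (ball p r \<times> {0..1}) (\<lambda>(q, t). ?D y t q i)"
          by (rule continuous_on_subset) (use r in auto)
        then show "continuous_on (ball p r \<times> {0..1}) (\<lambda>x. blinfun_apply (?fx (fst x) (snd x)) i)"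
          by (rule continuous_on_eq) (use bl r in auto)
      qed
      have cW: "continuous_on {0..1} (\<lambda>t. W (y, t) q)" if "q \<in> S" for q
        using that continuous_on_compose2[OF jointly_continuous_interval[OF
            Ck_family_imp_jointly_continuous[OF Suc.prems] y], of "{0..1}" "\<lambda>t. (q, t)"]
        by (simp add: continuous_on_Pair image_subset_iff continuous_on_const continuous_on_id)
      have "((\<lambda>q. integral (cbox 0 1) (\<lambda>t. W (y, t) q)) has_derivative integral (cbox 0 1) (?fx p))
          (at p within ball p r)"
      proof (rule leibniz_rule)
        show "((\<lambda>q. W (y, t) q) has_derivative blinfun_apply (?fx q t)) (at q within ball p r)"
          if "q \<in> ball p r" "t \<in> cbox 0 1" for q t
        proof -
          have tq: "t \<in> {0..1}" "q \<in> S" using that r by auto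
          show ?thesis unfolding bl[OF tq] using has_derivative_at_withinI[OF dW[OF tq]] .
        qed
        show "(\<lambda>t. W (y, t) q) integrable_on cbox 0 1" if "q \<in> ball p r" for q
          using cW r that by (intro integrable_continuous) auto
        show "continuous_on (ball p r \<times> cbox 0 1) (\<lambda>(q, t). ?fx q t)"
          using cfx by (simp add: case_prod_unfold)
      qed (use r in auto)
      then have *: "((\<lambda>q. integral {0..1} (\<lambda>t. W (y, t) q)) has_derivative integral {0..1} (?fx p)) (at p)"
        using r by (simp add: at_within_open[of p "ball p r"])
      have int: "?fx p integrable_on {0..1}"
      proof (rule integrable_continuous_interval)
        show "continuous_on {0..1} (?fx p)"
          using continuous_on_compose2[OF cfx, of "{0..1}" "\<lambda>t. (p, t)"] r
          by (simp add: continuous_on_Pair image_subset_iff continuous_on_const continuous_on_id)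
      qed
      have "blinfun_apply (integral {0..1} (?fx p)) v = integral {0..1} (\<lambda>t. ?D y t p v)" for v
      proof -
        have "integral {0..1} (\<lambda>t. blinfun_apply (?fx p t) v) = integral {0..1} (\<lambda>t. ?D y t p v)"
          by (rule integral_cong) (simp add: bl p)
        then show ?thesis using blinfun_apply_integral[OF int] by simp
      qed
      then have "blinfun_apply (integral {0..1} (?fx p)) = (\<lambda>v. integral {0..1} (\<lambda>t. ?D y t p v))"
        by auto
      with * show ?thesis by simp
    qed
  qed
qed

lemma smooth_family_integral:
  fixes W :: "'y \<times> real \<Rightarrow> 'a::euclidean_space \<Rightarrow> 'b::banach"
  assumes "open S" "smooth_family (prod_topology Y (top_of_set {0..1})) S W"
  shows "smooth_family Y S (\<lambda>y p. integral {0..1} (\<lambda>t. W (y, t) p))"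
  using assms by (simp add: smooth_family_def Ck_family_integral)

section \<open>Hadamard quotients\<close>

text \<open>The value at \<open>0\<close> removes the singularity of the difference quotient, as in Hadamard's lemma.\<close>

definition hadamard_quotient :: "(real \<Rightarrow> complex) \<Rightarrow> real \<Rightarrow> complex" where
  "hadamard_quotient \<phi> t =
     (if t = 0 then vector_derivative \<phi> (at 0) else (\<phi> t - \<phi> 0) / of_real t)"

text \<open>The quotient equals \<open>\<integral> \<phi>'(r t) dr\<close> over \<open>[0, 1]\<close>, which exhibits it as an integral of a smooth
  family, also at \<open>t = 0\<close>.\<close>

lemma smooth_family_hadamard_quotient:
  fixes \<phi> :: "'y \<Rightarrow> 'a::euclidean_space \<times> real \<Rightarrow> complex"
  assumes S: "open S" and \<phi>: "smooth_family Y (S \<times> UNIV) \<phi>"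
  shows "smooth_family Y (S \<times> UNIV) (\<lambda>y x. hadamard_quotient (\<lambda>s. \<phi> y (fst x, s)) (snd x))"
proof -
  let ?Y = "prod_topology Y (top_of_set {0..1::real})"
  let ?D = "\<lambda>y x. frechet_derivative (\<phi> y) (at x) (0, 1)"
  have SU: "open (S \<times> (UNIV :: real set))" using S by (intro open_Times) auto
  have D: "smooth_family Y (S \<times> (UNIV :: real set)) ?D"
    by (rule smooth_family_frechet_derivative[OF \<phi>])
  have "smooth_family ?Y (S \<times> (UNIV :: real set)) (\<lambda>q x. (fst x, snd q *\<^sub>R snd x))"
  proof (rule smooth_family_Pair[OF SU])
    show "smooth_family ?Y (S \<times> (UNIV :: real set)) (\<lambda>q x. fst x)"
      by (rule smooth_family_linear[OF SU bounded_linear_fst])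
    have "continuous_map ?Y (top_of_set {0..1::real}) snd"
      by (rule continuous_map_snd)
    then have "continuous_map ?Y euclidean (snd :: 'y \<times> real \<Rightarrow> real)"
      by (simp add: continuous_map_in_subtopology)
    then show "smooth_family ?Y (S \<times> (UNIV :: real set)) (\<lambda>q x. snd q *\<^sub>R snd x)"
      by (rule smooth_family_bilinear[OF SU bounded_bilinear_scaleR smooth_family_param[OF SU]
            smooth_family_linear[OF SU bounded_linear_snd]])
  qed
  then have "smooth_family ?Y (S \<times> (UNIV :: real set)) (\<lambda>q x. ?D (fst q) (fst x, snd q *\<^sub>R snd x))"
    by (rule smooth_family_compose[OF SU SU D _ continuous_map_fst,
          where \<Phi> = "\<lambda>q x. (fst x, snd q *\<^sub>R snd x)"]) (simp add: mem_Times_iff)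
  note smooth_family_integral[OF SU this]
  then show ?thesis
  proof (rule smooth_family_cong[OF SU])
    fix y and x :: "'a \<times> real" assume y: "y \<in> topspace Y" and x: "x \<in> S \<times> (UNIV :: real set)"
    obtain p t where pt: "x = (p, t)" "p \<in> S" using x by auto
    have d: "((\<lambda>s. \<phi> y (p, s)) has_vector_derivative ?D y (p, s)) (at s)" for s
    proof -
      have d1: "(\<phi> y has_derivative frechet_derivative (\<phi> y) (at (p, s))) (at (p, s))"
        using smooth_family_has_derivative[OF \<phi> y, of "(p, s)"] pt by simp
      have d2: "((\<lambda>s. (p, s)) has_derivative (\<lambda>h. (0, h))) (at s)"
        by (auto intro!: derivative_eq_intros)
      have "frechet_derivative (\<phi> y) (at (p, s)) (0, h) = h *\<^sub>R ?D y (p, s)" for h :: real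
        using linear_scale[OF has_derivative_linear[OF d1], of h "(0, 1)"] by simp
      then have "(\<lambda>h. frechet_derivative (\<phi> y) (at (p, s)) (0, h)) = (\<lambda>h. h *\<^sub>R ?D y (p, s))"
        by (rule ext)
      then show ?thesis
        using has_derivative_compose[OF d2 d1] by (simp only: has_vector_derivative_def)
    qed
    have "integral {0..1} (\<lambda>r. ?D y (p, r * t)) = hadamard_quotient (\<lambda>s. \<phi> y (p, s)) t"
    proof (cases "t = 0")
      case True
      then show ?thesis by (simp add: hadamard_quotient_def vector_derivative_at[OF d])
    next
      case False
      have "((\<lambda>r. \<phi> y (p, r * t)) has_vector_derivative (t *\<^sub>R ?D y (p, r * t))) (at r within {0..1})" for r
      proof -
        have "((\<lambda>r. r * t) has_vector_derivative t) (at r)"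
          by (auto intro!: derivative_eq_intros simp flip: has_real_derivative_iff_has_vector_derivative)
        from vector_diff_chain_at[where g = "\<lambda>s. \<phi> y (p, s)", OF this d]
        show ?thesis by (simp add: o_def has_vector_derivative_at_within)
      qed
      then have "((\<lambda>r. t *\<^sub>R ?D y (p, r * t)) has_integral (\<phi> y (p, 1 * t) - \<phi> y (p, 0 * t))) {0..1}"
        by (intro fundamental_theorem_of_calculus) auto
      from has_integral_cmul[OF this, of "1 / t"] False
      have "((\<lambda>r. ?D y (p, r * t)) has_integral (1 / t) *\<^sub>R (\<phi> y (p, t) - \<phi> y (p, 0))) {0..1}"
        by simp
      then show ?thesis
        using False by (simp add: hadamard_quotient_def integral_unique scaleR_conv_of_real)
    qed
    then show "integral {0..1} (\<lambda>r. ?D (fst (y, r)) (fst x, snd (y, r) *\<^sub>R snd x)) =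
        hadamard_quotient (\<lambda>s. \<phi> y (fst x, s)) (snd x)"
      by (simp add: pt)
  qed
qed

section \<open>The Mellin kernel\<close>

lemma abs_ln_power_mult_powr_tendsto_0:
  assumes "c > 0"
  shows "((\<lambda>t. \<bar>ln t\<bar> ^ k * t powr c) \<longlongrightarrow> 0) (at_right (0::real))"
proof (rule Lim_null_comparison)
  \<comment> \<open>Each factor \<open>\<bar>ln t\<bar>\<close> costs the exponent \<open>d\<close>, and all \<open>k\<close> of them cost at most \<open>c / 2\<close>.\<close>
  define d where "d = c / (2 * (real k + 1))"
  have d: "d > 0" using assms by (simp add: d_def)
  have le: "c / 2 \<le> c - d * real k"
    using assms by (simp add: d_def field_simps)
  show "eventually (\<lambda>t. norm (\<bar>ln t\<bar> ^ k * t powr c) \<le> (1 / d) ^ k * t powr (c / 2)) (at_right (0::real))"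
    using eventually_at_right_less[of 0] eventually_at_right_real[OF zero_less_one]
  proof eventually_elim
    case (elim t)
    have "\<bar>ln t\<bar> = ln (1 / t)" using elim by (simp add: ln_div)
    also have "\<dots> \<le> (1 / t) powr d / d" using elim d by (intro ln_powr_bound) auto
    also have "\<dots> = 1 / d * t powr (- d)" using elim by (simp add: powr_divide powr_minus_divide)
    finally have "\<bar>ln t\<bar> ^ k \<le> (1 / d * t powr (- d)) ^ k"
      by (intro power_mono) auto
    also have "\<dots> = (1 / d) ^ k * t powr (- (d * real k))"
      using elim by (simp only: power_mult_distrib powr_power) (simp add: mult.commute)
    finally have "\<bar>ln t\<bar> ^ k * t powr c \<le> (1 / d) ^ k * t powr (- (d * real k)) * t powr c"
      by (intro mult_right_mono) auto
    also have "\<dots> = (1 / d) ^ k * t powr (c - d * real k)"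
      by (simp add: algebra_simps flip: powr_add)
    also have "\<dots> \<le> (1 / d) ^ k * t powr (c / 2)"
      using elim le d by (intro mult_left_mono powr_mono') auto
    finally have "\<bar>ln t\<bar> ^ k * t powr c \<le> (1 / d) ^ k * t powr (c / 2)" .
    moreover have "norm (\<bar>ln t\<bar> ^ k * t powr c) = \<bar>ln t\<bar> ^ k * t powr c"
      by (simp add: abs_mult power_abs)
    ultimately show ?case by (simp only:)
  qed
  have "((\<lambda>t::real. t powr (c / 2)) \<longlongrightarrow> 0) (at_right 0)"
    using assms by (intro tendsto_zero_powrI[where b = "c / 2"] tendsto_intros)
      (auto simp: eventually_at_right_less eventually_at_filter)
  then show "((\<lambda>t. (1 / d) ^ k * t powr (c / 2)) \<longlongrightarrow> 0) (at_right (0::real))"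
    by (intro tendsto_mult_right_zero)
qed

text \<open>The powers of the logarithm arise from differentiating \<open>t powr (2 z - 1)\<close> in \<open>z\<close>.\<close>

definition mellin_kernel :: "nat \<Rightarrow> real \<Rightarrow> complex \<Rightarrow> complex" where
  "mellin_kernel k t z = of_real (ln t) ^ k * of_real t powr (2 * z - 1)"

text \<open>For \<open>Re z > 1/2\<close> the exponent has positive real part. Close to \<open>z0\<close> that real part is at least
  \<open>Re z0 - 1/2\<close>, and the corresponding power of \<open>t\<close> beats the logarithms as \<open>t\<close> tends to \<open>0\<close>. The
  value at \<open>t = 0\<close> is \<open>0\<close>, since \<open>0 powr w = 0\<close>.\<close>

lemma jointly_continuous_mellin_kernel:
  "jointly_continuous (top_of_set {0..1}) {z. Re z > 1/2} (mellin_kernel k)"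
  unfolding jointly_continuous_def
proof (intro ballI)
  fix t0 z0 assume t0: "t0 \<in> topspace (top_of_set {0..1::real})" and z0: "z0 \<in> {z. Re z > 1/2}"
  have fl: "filterlim (\<lambda>t::real. t) (nhds t0) (nhdsin (top_of_set {0..1}) t0)"
    unfolding filterlim_iff eventually_nhdsin eventually_nhds
    by (metis IntD2 Int_iff openin_open t0 topspace_euclidean_subtopology)
  show "((\<lambda>(t, z). mellin_kernel k t z) \<longlongrightarrow> mellin_kernel k t0 z0)
      (nhdsin (top_of_set {0..1}) t0 \<times>\<^sub>F nhds z0)"
  proof (cases "t0 = 0")
    case False
    then have pos: "t0 > 0" using t0 by auto
    have 1: "((\<lambda>x. fst x) \<longlongrightarrow> t0) (nhdsin (top_of_set {0..1}) t0 \<times>\<^sub>F nhds z0)"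
      by (rule filterlim_compose[OF fl filterlim_fst])
    have 2: "((\<lambda>x. snd x) \<longlongrightarrow> z0) (nhdsin (top_of_set {0..1}) t0 \<times>\<^sub>F nhds z0)"
      by (rule filterlim_snd)
    have 3: "((\<lambda>x. complex_of_real (fst x)) \<longlongrightarrow> of_real t0) (nhdsin (top_of_set {0..1}) t0 \<times>\<^sub>F nhds z0)"
      by (intro tendsto_of_real 1)
    have np: "complex_of_real t0 \<notin> \<real>\<^sub>\<le>\<^sub>0" using pos by (simp add: complex_nonpos_Reals_iff)
    have "((\<lambda>x. of_real (ln (fst x)) ^ k * of_real (fst x) powr (2 * snd x - 1)) \<longlongrightarrow>
        of_real (ln t0) ^ k * of_real t0 powr (2 * z0 - 1)) (nhdsin (top_of_set {0..1}) t0 \<times>\<^sub>F nhds z0)"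
      using pos by (intro tendsto_intros 1 2 3 np) auto
    then show ?thesis by (simp add: case_prod_unfold mellin_kernel_def)
  next
    case True
    define c where "c = Re z0 - 1/2"
    have c: "c > 0" using z0 by (simp add: c_def)
    have "((\<lambda>t. \<bar>ln t\<bar> ^ k * t powr c) \<longlongrightarrow> 0) (at 0 within {0..1::real})"
    proof -
      have "at (0::real) within {0..1} = at_right 0"
        by (metis at_within_Icc_at_right zero_less_one)
      then show ?thesis using abs_ln_power_mult_powr_tendsto_0[OF c] by simp
    qed
    then have "((\<lambda>t. \<bar>ln t\<bar> ^ k * t powr c) \<longlongrightarrow> 0) (nhdsin (top_of_set {0..1}) 0)"
    proof (intro tendstoI)
      fix e :: real assume e: "0 < e"
      from tendstoD[OF \<open>(_ \<longlongrightarrow> 0) (at 0 within {0..1})\<close> e] obtain d where d: "0 < d"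
        "\<And>t. t \<in> {0..1} \<Longrightarrow> t \<noteq> 0 \<Longrightarrow> dist t 0 < d \<Longrightarrow> dist (\<bar>ln t\<bar> ^ k * t powr c) 0 < e"
        unfolding eventually_at by blast
      have "openin (top_of_set {0..1}) ({0..1} \<inter> ball (0::real) d)"
        by (intro openin_open_Int open_ball)
      moreover have "dist (\<bar>ln t\<bar> ^ k * t powr c) 0 < e" if "t \<in> {0..1} \<inter> ball 0 d" for t
        using d(2)[of t] that e by (cases "t = 0") (auto simp: dist_commute)
      ultimately show "eventually (\<lambda>t. dist (\<bar>ln t\<bar> ^ k * t powr c) 0 < e) (nhdsin (top_of_set {0..1}) 0)"
        unfolding eventually_nhdsin using d(1)
        by (intro disjI2 exI[of _ "{0..1} \<inter> ball 0 d"]) auto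
    qed
    then have "((\<lambda>x. \<bar>ln (fst x)\<bar> ^ k * fst x powr c) \<longlongrightarrow> 0) (nhdsin (top_of_set {0..1}) t0 \<times>\<^sub>F nhds z0)"
      unfolding True by (rule filterlim_compose) (rule filterlim_fst)
    then have "((\<lambda>x. mellin_kernel k (fst x) (snd x)) \<longlongrightarrow> 0) (nhdsin (top_of_set {0..1}) t0 \<times>\<^sub>F nhds z0)"
    proof (rule Lim_null_comparison[rotated])
      have ev: "eventually (\<lambda>z. Re z > 1/2 + c/2) (nhds z0)"
        using c by (intro eventually_nhds_in_open[of "{z. Re z > 1/2 + c/2}", simplified]
            open_halfspace_Re_gt) (use z0 in \<open>simp add: c_def field_simps\<close>)
      show "eventually (\<lambda>x. norm (mellin_kernel k (fst x) (snd x)) \<le> \<bar>ln (fst x)\<bar> ^ k * fst x powr c)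
        (nhdsin (top_of_set {0..1}) t0 \<times>\<^sub>F nhds z0)"
        using eventually_prodI[OF eventually_in_topspace[OF t0] ev]
      proof eventually_elim
        case (elim x)
        then have x: "0 \<le> fst x" "fst x \<le> 1" "c \<le> Re (2 * snd x - 1)" by auto
        have "norm (of_real (fst x) powr (2 * snd x - 1)) = fst x powr Re (2 * snd x - 1)"
          using x by (cases "fst x = 0") (simp_all add: norm_powr_real_powr)
        also have "\<dots> \<le> fst x powr c" using x by (intro powr_mono') auto
        finally show ?case
          by (auto simp: mellin_kernel_def norm_mult norm_power intro!: mult_left_mono)
      qed
    qed
    then show ?thesis by (simp add: case_prod_unfold mellin_kernel_def True)
  qed
qed

lemma smooth_family_mellin_kernel:
  "smooth_family (top_of_set {0..1}) {z. Re z > 1/2} (mellin_kernel k)"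
  unfolding smooth_family_def
proof
  fix n
  have S: "open {z. Re z > 1/2}" by (rule open_halfspace_Re_gt)
  show "Ck_family n (top_of_set {0..1}) {z. Re z > 1/2} (mellin_kernel k)"
  proof (induction n arbitrary: k)
    case 0 then show ?case unfolding Ck_family.simps by (rule jointly_continuous_mellin_kernel)
  next
    case (Suc n)
    show ?case
    proof (rule Ck_family_SucI[OF S jointly_continuous_mellin_kernel,
          where W' = "\<lambda>t z v. (2 * mellin_kernel (Suc k) t z) * v"])
      fix t :: real and z assume t: "t \<in> topspace (top_of_set {0..1})" and z: "z \<in> {z. Re z > 1/2}"
      have "(mellin_kernel k t has_field_derivative 2 * mellin_kernel (Suc k) t z) (at z)"
      proof (cases "t = 0")
        case True then show ?thesis by (simp add: mellin_kernel_def[abs_def])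
      next
        case False
        then have "t > 0" using t by auto
        then show ?thesis unfolding mellin_kernel_def[abs_def]
          by (auto intro!: derivative_eq_intros simp: Ln_of_real powr_def exp_minus field_simps)
      qed
      then show "(mellin_kernel k t has_derivative (*) (2 * mellin_kernel (Suc k) t z)) (at z)"
        by (simp add: has_field_derivative_def)
    next
      show "Ck_family n (top_of_set {0..1}) {z. Re z > 1/2} (\<lambda>t z. (2 * mellin_kernel (Suc k) t z) * v)" for v
        by (intro Ck_family_bilinear[OF S bounded_bilinear_mult] Ck_family_const[OF S] Suc)
    qed
  qed
qed

section \<open>The normalized local zeta integral\<close>

abbreviation smooth_map :: "'a::real_normed_vector set \<Rightarrow> ('a \<Rightarrow> 'b::real_normed_vector) \<Rightarrow> bool" where
  "smooth_map S f \<equiv> smooth_family (discrete_topology {()}) S (\<lambda>_. f)"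

text \<open>The dummy first variable presents a curve as a family of curves on \<open>S \<times> UNIV\<close>, the form in which
  Hadamard quotients are treated.\<close>

definition smooth_curve :: "(real \<Rightarrow> complex) \<Rightarrow> bool" where
  "smooth_curve \<psi> \<longleftrightarrow> smooth_map (UNIV :: (real \<times> real) set) (\<lambda>x. \<psi> (snd x))"

lemma smooth_curve_slice:
  fixes \<phi> :: "'y \<Rightarrow> 'a::euclidean_space \<times> real \<Rightarrow> complex"
  assumes S: "open S" and \<phi>: "smooth_family Y (S \<times> UNIV) \<phi>" and y: "y \<in> topspace Y" and p: "p \<in> S"
  shows "smooth_curve (\<lambda>t. \<phi> y (p, t))"
  unfolding smooth_curve_def
proof (rule smooth_family_compose[OF _ _ \<phi>, where \<sigma> = "\<lambda>_. y" and \<Phi> = "\<lambda>_ x. (p, snd x)"])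
  show "smooth_map UNIV (\<lambda>x :: real \<times> real. (p, snd x))"
    by (intro smooth_family_Pair smooth_family_const smooth_family_linear bounded_linear_snd open_UNIV)
  show "continuous_map (discrete_topology {()}) Y (\<lambda>_. y)" using y by (rule continuous_map_const[THEN iffD2, OF disjI2])
qed (use S p in \<open>auto intro: open_Times\<close>)

lemma smooth_curve_hadamard_quotient:
  assumes "smooth_curve \<psi>" shows "smooth_curve (hadamard_quotient \<psi>)"
  using smooth_family_hadamard_quotient[where S = "UNIV :: real set" and Y = "discrete_topology {()}"
      and \<phi> = "\<lambda>_ x. \<psi> (snd x)"] assms
  by (simp add: smooth_curve_def)

lemma smooth_curve_has_vector_derivative:
  assumes "smooth_curve \<psi>"
  shows "(\<psi> has_vector_derivative vector_derivative \<psi> (at t)) (at t)"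
proof -
  let ?D = "frechet_derivative (\<lambda>x :: real \<times> real. \<psi> (snd x)) (at (0, t))"
  have 1: "((\<lambda>x :: real \<times> real. \<psi> (snd x)) has_derivative ?D) (at (0, t))"
    by (rule smooth_family_has_derivative[OF assms[unfolded smooth_curve_def]]) simp_all
  have 2: "((\<lambda>s::real. (0::real, s)) has_derivative (\<lambda>h. (0, h))) (at t)"
    by (auto intro!: derivative_eq_intros)
  have "\<psi> differentiable (at t)"
    using has_derivative_compose[OF 2 1] by (auto simp: differentiable_def)
  then show ?thesis by (simp add: vector_derivative_works)
qed

lemma smooth_curve_continuous_on: "smooth_curve \<psi> \<Longrightarrow> continuous_on A \<psi>"
  by (intro continuous_at_imp_continuous_on ballI has_vector_derivative_continuous[OF
        smooth_curve_has_vector_derivative])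

lemma smooth_curve_continuous_on_reflect:
  assumes "smooth_curve \<psi>" shows "continuous_on A (\<lambda>t. \<psi> (- t))"
  by (rule continuous_on_compose2[OF smooth_curve_continuous_on[OF assms, of UNIV]])
     (auto intro!: continuous_intros)

lemma hadamard_quotient_eq:
  "\<psi> t = \<psi> 0 + of_real t * hadamard_quotient \<psi> t"
  by (simp add: hadamard_quotient_def)

text \<open>Two Hadamard quotients give a Taylor expansion of order two; the linear terms cancel in the even
  part.\<close>

lemma even_part_expansion:
  fixes \<psi> defines "\<omega> \<equiv> hadamard_quotient (hadamard_quotient \<psi>)"
  shows "\<psi> t + \<psi> (- t) = 2 * \<psi> 0 + of_real t ^ 2 * (\<omega> t + \<omega> (- t))"
proof -
  have "\<psi> t = \<psi> 0 + of_real t * (hadamard_quotient \<psi> 0 + of_real t * \<omega> t)"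
    unfolding \<omega>_def by (metis hadamard_quotient_eq)
  moreover have "\<psi> (- t) = \<psi> 0 + of_real (- t) * (hadamard_quotient \<psi> 0 + of_real (- t) * \<omega> (- t))"
    unfolding \<omega>_def by (metis hadamard_quotient_eq)
  ultimately show ?thesis by (simp add: power2_eq_square algebra_simps)
qed

lemma absolutely_integrable_mellin:
  fixes g :: "real \<Rightarrow> complex"
  assumes z: "Re z > 0" and g: "continuous_on {0..1} g"
  shows "(\<lambda>t. of_real t powr (2 * z - 1) * g t) absolutely_integrable_on {0..1}"
proof -
  obtain C where C: "\<And>t. t \<in> {0..1} \<Longrightarrow> norm (g t) \<le> C"
    using compact_imp_bounded[OF compact_continuous_image[OF g]] unfolding bounded_iff by force
  have "(\<lambda>t. of_real t powr (2 * z - 1) * g t) absolutely_integrable_on {0<..1}"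
  proof (rule measurable_bounded_by_integrable_imp_absolutely_integrable)
    show "(\<lambda>t. of_real t powr (2 * z - 1) * g t) \<in> borel_measurable (lebesgue_on {0<..1})"
      by (intro continuous_imp_measurable_on_sets_lebesgue continuous_intros continuous_on_subset[OF g])
         (auto simp: complex_eq_iff)
    show "(\<lambda>t. t powr (2 * Re z - 1) * C) integrable_on {0<..1::real}"
      using z by (intro integrable_on_mult_left integrable_on_powr_from_0') auto
    show "norm (of_real t powr (2 * z - 1) * g t) \<le> t powr (2 * Re z - 1) * C" if "t \<in> {0<..1}" for t
      using that C[of t] by (auto simp: norm_mult norm_powr_real_powr intro!: mult_left_mono)
  qed auto
  then show ?thesis
    by (subst absolutely_integrable_spike_set_eq[where T = "{0<..1}"])
       (auto intro: negligible_subset[of "{0}"])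
qed

lemma has_integral_mellin_const:
  assumes z: "Re z > 0"
  shows "((\<lambda>t. complex_of_real t powr (2 * z - 1)) has_integral 1 / (2 * z)) {0..1}"
proof -
  have z0: "z \<noteq> 0" using z by auto
  have "((\<lambda>t. complex_of_real t powr (2 * z - 1)) has_integral
      (complex_of_real 1 powr (2 * z) / (2 * z) - complex_of_real 0 powr (2 * z) / (2 * z))) {0..1}"
  proof (rule fundamental_theorem_of_calculus_interior)
    show "continuous_on {0..1} (\<lambda>t. complex_of_real t powr (2 * z) / (2 * z))"
      using z z0 by (intro continuous_intros) auto
    fix t :: real assume t: "t \<in> {0<..<1}"
    have "((\<lambda>w. w powr (2 * z) / (2 * z)) has_field_derivative complex_of_real t powr (2 * z - 1))
        (at (of_real t))"
      using t z0 by (auto intro!: derivative_eq_intros simp: complex_nonpos_Reals_iff)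
    from has_vector_derivative_real_field[OF this]
    show "((\<lambda>t. complex_of_real t powr (2 * z) / (2 * z)) has_vector_derivative
        complex_of_real t powr (2 * z - 1)) (at t)" .
  qed simp
  then show ?thesis by simp
qed

text \<open>The zeta integral \<open>\<integral> \<bar>t\<bar>\<^sup>2\<^sup>z\<^sup>-\<^sup>1 \<psi>(t) dt\<close> over \<open>[-1, 1]\<close> divided by \<open>\<Gamma>(z)\<close>, after \<open>M\<close> steps of
  continuation: \<open>local_zeta M\<close> is meaningful for \<open>Re z > - M\<close>.\<close>

primrec local_zeta :: "nat \<Rightarrow> complex \<Rightarrow> (real \<Rightarrow> complex) \<Rightarrow> complex" where
  "local_zeta 0 z \<psi> =
     rGamma z * integral {0..1} (\<lambda>t. of_real t powr (2 * z - 1) * (\<psi> t + \<psi> (- t)))"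
| "local_zeta (Suc M) z \<psi> =
     rGamma (z + 1) * \<psi> 0 + z * local_zeta M (z + 1) (hadamard_quotient (hadamard_quotient \<psi>))"

text \<open>Insert \<open>\<psi>(t) + \<psi>(-t) = 2 \<psi>(0) + t\<^sup>2 (\<omega>(t) + \<omega>(-t))\<close>, where \<open>\<omega>\<close> is the second Hadamard quotient. The
  constant contributes \<open>\<psi>(0) / z\<close>, and the factor \<open>t\<^sup>2\<close> replaces \<open>z\<close> by \<open>z + 1\<close>. The pole at \<open>z = 0\<close>
  is absorbed by \<open>1/\<Gamma>(z) = z/\<Gamma>(z + 1)\<close>.\<close>

lemma local_zeta_Suc:
  assumes "smooth_curve \<psi>" "Re z + real M > 0"
  shows "local_zeta (Suc M) z \<psi> = local_zeta M z \<psi>"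
  using assms
proof (induction M arbitrary: z \<psi>)
  case 0
  define \<omega> where "\<omega> = hadamard_quotient (hadamard_quotient \<psi>)"
  have z: "Re z > 0" using 0 by simp
  then have z0: "z \<noteq> 0" by auto
  have \<omega>: "smooth_curve \<omega>"
    unfolding \<omega>_def by (intro smooth_curve_hadamard_quotient 0(1))
  have "(\<lambda>t. of_real t powr (2 * (z + 1) - 1) * (\<omega> t + \<omega> (- t))) absolutely_integrable_on {0..1}"
    using z by (intro absolutely_integrable_mellin continuous_on_add smooth_curve_continuous_on
        smooth_curve_continuous_on_reflect \<omega>) simp
  then have "(\<lambda>t. of_real t powr (2 * (z + 1) - 1) * (\<omega> t + \<omega> (- t))) integrable_on {0..1}"
    by (rule set_lebesgue_integral_eq_integral(1))
  from has_integral_add[OF has_integral_mult_left[OF has_integral_mellin_const[OF z], of "2 * \<psi> 0"]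
      integrable_integral[OF this]]
  have "((\<lambda>t. of_real t powr (2 * z - 1) * (\<psi> t + \<psi> (- t))) has_integral (\<psi> 0 / z +
      integral {0..1} (\<lambda>t. of_real t powr (2 * (z + 1) - 1) * (\<omega> t + \<omega> (- t))))) {0..1}"
  proof (rule has_integral_eq_rhs[OF has_integral_eq[rotated]])
    fix t :: real assume t: "t \<in> {0..1}"
    have "complex_of_real t powr (2 * (z + 1) - 1) = of_real t powr (2 * z - 1) * of_real t ^ 2"
    proof (cases "t = 0")
      case False
      then show ?thesis
        by (simp add: powr_def exp_add exp_diff power2_eq_square field_simps flip: exp_of_nat_mult)
    qed simp
    then show "of_real t powr (2 * z - 1) * (2 * \<psi> 0) + of_real t powr (2 * (z + 1) - 1) * (\<omega> t + \<omega> (- t)) =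
        of_real t powr (2 * z - 1) * (\<psi> t + \<psi> (- t))"
      unfolding even_part_expansion[of \<psi> t, folded \<omega>_def] by (simp only: algebra_simps)
  qed (use z0 in simp)
  then have "local_zeta 0 z \<psi> = rGamma z * (\<psi> 0 / z +
      integral {0..1} (\<lambda>t. of_real t powr (2 * (z + 1) - 1) * (\<omega> t + \<omega> (- t))))"
    by (simp add: integral_unique)
  then show ?case
    using z0 by (simp add: \<omega>_def rGamma_plus1[of z, symmetric] algebra_simps)
next
  case (Suc M)
  have "local_zeta (Suc M) (z + 1) (hadamard_quotient (hadamard_quotient \<psi>)) =
      local_zeta M (z + 1) (hadamard_quotient (hadamard_quotient \<psi>))"
    using Suc.prems by (intro Suc.IH smooth_curve_hadamard_quotient) simp_all
  then show ?case
    using local_zeta.simps(2)[of M z \<psi>] local_zeta.simps(2)[of "Suc M" z \<psi>] by (simp only:)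
qed

text \<open>Every number \<open>M\<close> of continuation steps with \<open>Re z + M > 0\<close> gives the same value; this choice has
  some room to spare.\<close>

definition zeta_distr :: "complex \<Rightarrow> (real \<Rightarrow> complex) \<Rightarrow> complex" where
  "zeta_distr z \<psi> = local_zeta (nat \<lceil>2 - Re z\<rceil>) z \<psi>"

lemma zeta_distr_eq_local_zeta:
  assumes \<psi>: "smooth_curve \<psi>" and M: "Re z + real M > 0"
  shows "zeta_distr z \<psi> = local_zeta M z \<psi>"
proof -
  have *: "local_zeta (N + k) z \<psi> = local_zeta N z \<psi>" if "Re z + real N > 0" for N k
  proof (induction k)
    case (Suc k)
    have "local_zeta (Suc (N + k)) z \<psi> = local_zeta (N + k) z \<psi>"
      using that by (intro local_zeta_Suc \<psi>) simp
    then show ?case using Suc by simp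
  qed simp
  define N where "N = nat \<lceil>2 - Re z\<rceil>"
  have N: "Re z + real N > 0" unfolding N_def by linarith
  have "local_zeta N z \<psi> = local_zeta (N + M) z \<psi>" using *[OF N] by simp
  also have "\<dots> = local_zeta M z \<psi>" using *[OF M, of N] by (simp add: add.commute)
  finally show ?thesis by (simp add: zeta_distr_def N_def)
qed

lemma smooth_family_mellin_integrand:
  fixes \<phi> :: "'y \<Rightarrow> 'a::euclidean_space \<times> real \<Rightarrow> complex"
  assumes S: "open S" and \<phi>: "smooth_family Y (S \<times> UNIV) \<phi>"
  shows "smooth_family (prod_topology Y (top_of_set {0..1})) ({z. Re z > 1/2} \<times> S)
    (\<lambda>q x. of_real (snd q) powr (2 * fst x - 1) *
      (\<phi> (fst q) (snd x, snd q) + \<phi> (fst q) (snd x, - snd q)))"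
proof -
  let ?Y = "prod_topology Y (top_of_set {0..1::real})"
  let ?T = "{z :: complex. Re z > 1/2} \<times> S"
  have T: "open ?T" by (intro open_Times open_halfspace_Re_gt S)
  have SU: "open (S \<times> (UNIV :: real set))" by (intro open_Times S open_UNIV)
  have snd: "continuous_map ?Y (top_of_set {0..1::real}) snd" by (rule continuous_map_snd)
  have lin: "smooth_family ?Y ?T (\<lambda>q x. (snd x, c * snd q))" for c :: real
  proof (rule smooth_family_Pair[OF T])
    show "smooth_family ?Y ?T (\<lambda>q x. snd x)" by (rule smooth_family_linear[OF T bounded_linear_snd])
    have "continuous_map ?Y euclidean (\<lambda>q. snd q)" using snd by (simp add: continuous_map_in_subtopology)
    then have "continuous_map ?Y euclideanreal (\<lambda>q. c * snd q)"
      by (intro continuous_map_real_mult_left)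
    then show "smooth_family ?Y ?T (\<lambda>q x. c * snd q)" by (rule smooth_family_param[OF T])
  qed
  have \<phi>c: "smooth_family ?Y ?T (\<lambda>q x. \<phi> (fst q) (snd x, c * snd q))" for c
    by (rule smooth_family_compose[OF SU T \<phi> lin continuous_map_fst]) auto
  have "smooth_family ?Y ?T (\<lambda>q x. mellin_kernel 0 (snd q) (fst x))"
    by (rule smooth_family_compose[OF open_halfspace_Re_gt T smooth_family_mellin_kernel
          smooth_family_linear[OF T bounded_linear_fst] snd]) auto
  from smooth_family_mult[OF T this smooth_family_add[OF T \<phi>c[of 1] \<phi>c[of "-1"]]]
  show ?thesis by (simp add: mellin_kernel_def)
qed

text \<open>The half plane is smaller by \<open>1/2\<close> than the one on which \<open>local_zeta M\<close> is meaningful: there the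
  kernel is continuous up to the endpoint of the interval. Nothing is lost, as \<open>M\<close> is
  arbitrary.\<close>

lemma smooth_family_local_zeta:
  fixes \<phi> :: "'y \<Rightarrow> 'a::euclidean_space \<times> real \<Rightarrow> complex"
  assumes S: "open S" and \<phi>: "smooth_family Y (S \<times> UNIV) \<phi>"
  shows "smooth_family Y ({z. Re z > 1/2 - real M} \<times> S) (\<lambda>y x. local_zeta M (fst x) (\<lambda>t. \<phi> y (snd x, t)))"
  using \<phi>
proof (induction M arbitrary: \<phi>)
  case 0
  let ?T = "{z :: complex. Re z > 1/2} \<times> S"
  have T: "open ?T" by (intro open_Times open_halfspace_Re_gt S)
  have "smooth_family Y ?T (\<lambda>y x. rGamma (fst x))"
    by (rule smooth_family_holomorphic[OF open_UNIV holomorphic_rGamma T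
          smooth_family_linear[OF T bounded_linear_fst]]) simp
  from smooth_family_mult[OF T this smooth_family_integral[OF T smooth_family_mellin_integrand[OF S 0]]]
  show ?case by simp
next
  case (Suc M)
  let ?T = "{z :: complex. Re z > 1/2 - real (Suc M)} \<times> S"
  have T: "open ?T" by (intro open_Times open_halfspace_Re_gt S)
  have T': "open ({z :: complex. Re z > 1/2 - real M} \<times> S)" by (intro open_Times open_halfspace_Re_gt S)
  have SU: "open (S \<times> (UNIV :: real set))" by (intro open_Times S open_UNIV)
  let ?\<omega> = "\<lambda>y x. hadamard_quotient (hadamard_quotient (\<lambda>t. \<phi> y (fst x, t))) (snd x)"
  have "smooth_family Y (S \<times> UNIV) ?\<omega>"
    using smooth_family_hadamard_quotient[OF S smooth_family_hadamard_quotient[OF S Suc.prems]] by simp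
  from Suc.IH[OF this]
  have IH: "smooth_family Y ({z. Re z > 1/2 - real M} \<times> S)
      (\<lambda>y x. local_zeta M (fst x) (hadamard_quotient (hadamard_quotient (\<lambda>t. \<phi> y (snd x, t)))))"
    by simp
  have fst: "smooth_family Y ?T (\<lambda>y x. fst x)" by (rule smooth_family_linear[OF T bounded_linear_fst])
  have snd: "smooth_family Y ?T (\<lambda>y x. snd x)" by (rule smooth_family_linear[OF T bounded_linear_snd])
  have fst1: "smooth_family Y ?T (\<lambda>y x. fst x + 1)"
    by (rule smooth_family_add[OF T fst smooth_family_const[OF T]])
  have "smooth_family Y ?T (\<lambda>y x. local_zeta M (fst (fst x + 1, snd x))
      (hadamard_quotient (hadamard_quotient (\<lambda>t. \<phi> y (snd (fst x + 1, snd x), t)))))"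
    by (rule smooth_family_compose[OF T' T IH smooth_family_Pair[OF T fst1 snd] continuous_map_id[unfolded id_def]])
       auto
  then have 1: "smooth_family Y ?T (\<lambda>y x. fst x * local_zeta M (fst x + 1)
      (hadamard_quotient (hadamard_quotient (\<lambda>t. \<phi> y (snd x, t)))))"
    unfolding fst_conv snd_conv by (rule smooth_family_mult[OF T fst])
  have 2: "smooth_family Y ?T (\<lambda>y x. rGamma (fst x + 1))"
    by (rule smooth_family_holomorphic[OF open_UNIV holomorphic_rGamma T fst1]) simp
  have "smooth_family Y ?T (\<lambda>y x. (snd x, 0::real))"
    by (rule smooth_family_Pair[OF T snd smooth_family_const[OF T]])
  then have "smooth_family Y ?T (\<lambda>y x. \<phi> y (snd x, 0))"
    by (rule smooth_family_compose[OF SU T Suc.prems _ continuous_map_id[unfolded id_def]]) auto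
  from smooth_family_add[OF T smooth_family_mult[OF T 2 this] 1]
  show ?case by simp
qed

text \<open>The half planes for all \<open>M\<close> cover the plane, and on each of them finitely many continuation
  steps suffice.\<close>

lemma smooth_family_zeta_distr:
  fixes \<phi> :: "'y \<Rightarrow> 'a::euclidean_space \<times> real \<Rightarrow> complex"
  assumes S: "open S" and \<phi>: "smooth_family Y (S \<times> UNIV) \<phi>"
  shows "smooth_family Y (UNIV \<times> S) (\<lambda>y x. zeta_distr (fst x) (\<lambda>t. \<phi> y (snd x, t)))"
proof -
  have "smooth_family Y (\<Union>M. {z. Re z > 1/2 - real M} \<times> S)
      (\<lambda>y x. zeta_distr (fst x) (\<lambda>t. \<phi> y (snd x, t)))"
  proof (rule smooth_family_Union)
    fix M
    have T: "open ({z. Re z > 1/2 - real M} \<times> S)" by (intro open_Times open_halfspace_Re_gt S)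
    show "smooth_family Y ({z. Re z > 1/2 - real M} \<times> S) (\<lambda>y x. zeta_distr (fst x) (\<lambda>t. \<phi> y (snd x, t)))"
    proof (rule smooth_family_cong[OF T smooth_family_local_zeta[OF S \<phi>, of M]])
      fix y x assume y: "y \<in> topspace Y" and x: "x \<in> {z. Re z > 1/2 - real M} \<times> S"
      show "local_zeta M (fst x) (\<lambda>t. \<phi> y (snd x, t)) = zeta_distr (fst x) (\<lambda>t. \<phi> y (snd x, t))"
        using x by (intro zeta_distr_eq_local_zeta[symmetric] smooth_curve_slice[OF S \<phi> y]) auto
    qed
  qed
  moreover have "(\<Union>M. {z. Re z > 1/2 - real M} \<times> S) = UNIV \<times> S"
  proof -
    have "\<exists>M. Re z > 1/2 - real M" for z
      using reals_Archimedean2[of "1/2 - Re z"] by (auto simp: algebra_simps)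
    then show ?thesis by auto
  qed
  ultimately show ?thesis by simp
qed

section \<open>Linearity of the zeta integral\<close>

lemma hadamard_quotient_add:
  assumes "smooth_curve \<psi>1" "smooth_curve \<psi>2"
  shows "hadamard_quotient (\<lambda>t. \<psi>1 t + \<psi>2 t) = (\<lambda>t. hadamard_quotient \<psi>1 t + hadamard_quotient \<psi>2 t)"
proof
  fix t
  have "vector_derivative (\<lambda>t. \<psi>1 t + \<psi>2 t) (at 0) = vector_derivative \<psi>1 (at 0) + vector_derivative \<psi>2 (at 0)"
    by (intro vector_derivative_at has_vector_derivative_add smooth_curve_has_vector_derivative assms)
  then show "hadamard_quotient (\<lambda>t. \<psi>1 t + \<psi>2 t) t = hadamard_quotient \<psi>1 t + hadamard_quotient \<psi>2 t"
    by (simp add: hadamard_quotient_def add_divide_distrib diff_divide_distrib)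
qed

lemma hadamard_quotient_mult:
  assumes "smooth_curve \<psi>"
  shows "hadamard_quotient (\<lambda>t. c * \<psi> t) = (\<lambda>t. c * hadamard_quotient \<psi> t)"
proof
  fix t
  have "vector_derivative (\<lambda>t. c * \<psi> t) (at 0) = c * vector_derivative \<psi> (at 0)"
    by (intro vector_derivative_at has_vector_derivative_mult_right smooth_curve_has_vector_derivative assms)
  then show "hadamard_quotient (\<lambda>t. c * \<psi> t) t = c * hadamard_quotient \<psi> t"
    by (simp add: hadamard_quotient_def diff_divide_distrib right_diff_distrib)
qed

lemma integrable_mellin_even_part:
  assumes "Re z > 0" "smooth_curve \<psi>"
  shows "(\<lambda>t. of_real t powr (2 * z - 1) * (\<psi> t + \<psi> (- t))) integrable_on {0..1}"
  by (intro set_lebesgue_integral_eq_integral(1) absolutely_integrable_mellin continuous_on_add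
      smooth_curve_continuous_on smooth_curve_continuous_on_reflect assms)

lemma local_zeta_add:
  assumes "smooth_curve \<psi>1" "smooth_curve \<psi>2" "Re z + real M > 0"
  shows "local_zeta M z (\<lambda>t. \<psi>1 t + \<psi>2 t) = local_zeta M z \<psi>1 + local_zeta M z \<psi>2"
  using assms
proof (induction M arbitrary: z \<psi>1 \<psi>2)
  case 0
  then have "integral {0..1} (\<lambda>t. of_real t powr (2 * z - 1) * (\<psi>1 t + \<psi>1 (- t)) +
        of_real t powr (2 * z - 1) * (\<psi>2 t + \<psi>2 (- t))) =
      integral {0..1} (\<lambda>t. of_real t powr (2 * z - 1) * (\<psi>1 t + \<psi>1 (- t))) +
      integral {0..1} (\<lambda>t. of_real t powr (2 * z - 1) * (\<psi>2 t + \<psi>2 (- t)))"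
    by (intro integral_add integrable_mellin_even_part) auto
  moreover have "(\<lambda>t. of_real t powr (2 * z - 1) * (\<psi>1 t + \<psi>1 (- t)) +
        of_real t powr (2 * z - 1) * (\<psi>2 t + \<psi>2 (- t))) =
      (\<lambda>t. of_real t powr (2 * z - 1) * (\<psi>1 t + \<psi>2 t + (\<psi>1 (- t) + \<psi>2 (- t))))"
    by (simp add: algebra_simps)
  ultimately show ?case by (simp add: distrib_left)
next
  case (Suc M)
  note h = smooth_curve_hadamard_quotient
  show ?case
    using Suc.IH[OF h[OF h[OF Suc.prems(1)]] h[OF h[OF Suc.prems(2)]], of "z + 1"] Suc.prems(3)
    by (simp add: hadamard_quotient_add h Suc.prems(1,2) algebra_simps)
qed

lemma local_zeta_mult:
  assumes "smooth_curve \<psi>"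
  shows "local_zeta M z (\<lambda>t. c * \<psi> t) = c * local_zeta M z \<psi>"
  using assms
proof (induction M arbitrary: z \<psi>)
  case 0
  have "(\<lambda>t. of_real t powr (2 * z - 1) * (c * \<psi> t + c * \<psi> (- t))) =
      (\<lambda>t. c * (of_real t powr (2 * z - 1) * (\<psi> t + \<psi> (- t))))"
    by (simp add: algebra_simps)
  then show ?case by (simp add: integral_mult_right)
next
  case (Suc M)
  note h = smooth_curve_hadamard_quotient
  show ?case
    using Suc.IH[OF h[OF h[OF Suc.prems(1)]], of "z + 1"]
    by (simp add: hadamard_quotient_mult h Suc.prems(1) algebra_simps)
qed

lemma zeta_distr_add:
  assumes "smooth_curve \<psi>1" "smooth_curve \<psi>2"
  shows "zeta_distr z (\<lambda>t. \<psi>1 t + \<psi>2 t) = zeta_distr z \<psi>1 + zeta_distr z \<psi>2"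
  unfolding zeta_distr_def by (rule local_zeta_add[OF assms]) linarith

lemma zeta_distr_mult:
  "smooth_curve \<psi> \<Longrightarrow> zeta_distr z (\<lambda>t. c * \<psi> t) = c * zeta_distr z \<psi>"
  unfolding zeta_distr_def by (rule local_zeta_mult)

section \<open>Holomorphic dependence of the zeta integral\<close>

text \<open>The Cauchy-Riemann equations in the form: the real derivative commutes with \<open>\<i>\<close>.\<close>

lemma has_field_derivative_of_complex_linear:
  assumes "(f has_derivative L) (at z)" "L \<i> = \<i> * L 1"
  shows "(f has_field_derivative L 1) (at z)"
proof -
  have lin: "linear L" using assms(1) by (rule has_derivative_linear)
  have "L v = L 1 * v" for v
  proof -
    have v: "Re v *\<^sub>R 1 + Im v *\<^sub>R \<i> = v" by (simp add: complex_eq_iff)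
    have "L v = L (Re v *\<^sub>R 1 + Im v *\<^sub>R \<i>)" by (simp only: v)
    also have "\<dots> = Re v *\<^sub>R L 1 + Im v *\<^sub>R (\<i> * L 1)"
      by (simp only: linear_add[OF lin] linear_scale[OF lin] assms(2))
    also have "\<dots> = L 1 * (Re v *\<^sub>R 1 + Im v *\<^sub>R \<i>)" by (simp add: algebra_simps)
    finally show ?thesis by (simp only: v)
  qed
  then have "L = (*) (L 1)" by (rule ext)
  then show ?thesis using assms(1) by (simp add: has_field_derivative_def)
qed

lemma has_derivative_slice:
  assumes "smooth_family Y S W" "y \<in> topspace Y" "(z, t) \<in> S"
  shows "((\<lambda>z. W y (z, t)) has_derivative (\<lambda>v. frechet_derivative (W y) (at (z, t)) (v, 0))) (at z)"
proof -
  have 2: "((\<lambda>z. (z, t)) has_derivative (\<lambda>h. (h, 0))) (at z)"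
    by (auto intro!: derivative_eq_intros)
  show ?thesis using has_derivative_compose[OF 2 smooth_family_has_derivative[OF assms]] .
qed

lemma holomorphic_imp_complex_linear:
  assumes "open U" "f holomorphic_on U" "z \<in> U" "(f has_derivative L) (at z)"
  shows "L \<i> = \<i> * L 1"
proof -
  have "(f has_derivative (*) (deriv f z)) (at z)"
    using holomorphic_derivI[OF assms(2,1,3)] by (simp add: has_field_derivative_def)
  from has_derivative_unique[OF assms(4) this] show ?thesis by simp
qed

text \<open>For \<open>t \<noteq> 0\<close> the quotient is visibly holomorphic in \<open>z\<close>, so its real derivative in \<open>z\<close> is complex
  linear. By joint continuity of the derivative this persists at \<open>t = 0\<close>.\<close>

lemma holomorphic_hadamard_quotient:
  fixes \<phi> :: "complex \<times> real \<Rightarrow> complex"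
  assumes U: "open U" and \<phi>: "smooth_map (U \<times> UNIV) \<phi>"
    and hol: "\<And>t. (\<lambda>z. \<phi> (z, t)) holomorphic_on U"
  shows "(\<lambda>z. hadamard_quotient (\<lambda>s. \<phi> (z, s)) t) holomorphic_on U"
proof (cases "t = 0")
  case False
  then show ?thesis
    unfolding hadamard_quotient_def by (auto intro!: holomorphic_intros hol)
next
  case True
  let ?g = "\<lambda>x. hadamard_quotient (\<lambda>s. \<phi> (fst x, s)) (snd x)"
  have g: "smooth_map (U \<times> UNIV) ?g"
    by (rule smooth_family_hadamard_quotient[OF U \<phi>])
  have "\<exists>d. ((\<lambda>z. ?g (z, 0)) has_field_derivative d) (at z)" if z: "z \<in> U" for z
  proof -
    let ?D = "\<lambda>t v. frechet_derivative ?g (at (z, t)) (v, 0)"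
    have D: "((\<lambda>z. ?g (z, t)) has_derivative ?D t) (at z)" for t
      by (rule has_derivative_slice[OF g]) (use z in auto)
    have cont: "continuous_on UNIV (\<lambda>t. ?D t v)" for v
    proof (rule continuous_on_compose2[where g = "\<lambda>x. frechet_derivative ?g (at x) (v, 0)"])
      show "continuous_on (U \<times> UNIV) (\<lambda>x. frechet_derivative ?g (at x) (v, 0))"
        using jointly_continuous_imp_continuous_on[OF smooth_family_imp_jointly_continuous[OF
              smooth_family_frechet_derivative[OF g]], of "()" "(v, 0)"] by simp
    qed (use z in \<open>auto intro!: continuous_intros\<close>)
    \<comment> \<open>The Cauchy-Riemann equations away from \<open>t = 0\<close>; both sides are continuous in \<open>t\<close>.\<close>
    have off: "?D t \<i> = \<i> * ?D t 1" if "t \<noteq> 0" for t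
    proof (rule holomorphic_imp_complex_linear[OF U _ z D])
      show "(\<lambda>z. ?g (z, t)) holomorphic_on U"
        using that unfolding hadamard_quotient_def by (auto intro!: holomorphic_intros hol)
    qed
    have "((\<lambda>t. ?D t \<i> - \<i> * ?D t 1) \<longlongrightarrow> ?D 0 \<i> - \<i> * ?D 0 1) (at 0)"
      using cont by (intro tendsto_intros) (auto simp: continuous_on_def)
    moreover have "((\<lambda>t. ?D t \<i> - \<i> * ?D t 1) \<longlongrightarrow> 0) (at 0)"
      by (rule tendsto_eventually) (auto simp: eventually_at_filter off)
    ultimately have "?D 0 \<i> - \<i> * ?D 0 1 = 0"
      by (rule tendsto_unique[rotated]) simp
    then show ?thesis
      using has_field_derivative_of_complex_linear[OF D[of 0]] by auto
  qed
  then show ?thesis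
    unfolding True holomorphic_on_open[OF U] by simp
qed

lemma holomorphic_parameter_integral:
  fixes W :: "unit \<times> real \<Rightarrow> complex \<Rightarrow> complex"
  assumes U: "open U" and W: "smooth_family (prod_topology (discrete_topology {()}) (top_of_set {0..1})) U W"
    and hol: "\<And>t. t \<in> {0..1} \<Longrightarrow> W ((), t) holomorphic_on U"
  shows "(\<lambda>z. integral {0..1} (\<lambda>t. W ((), t) z)) holomorphic_on U"
proof -
  show ?thesis
    unfolding holomorphic_on_open[OF U]
  proof
    fix z assume "z \<in> U"
    then obtain r where r: "0 < r" "ball z r \<subseteq> U" using U by (auto simp: open_contains_ball)
    have d: "((\<lambda>z. W ((), t) z) has_field_derivative frechet_derivative (W ((), t)) (at w) 1) (at w)"
      if "w \<in> U" "t \<in> {0..1}" for w t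
    proof -
      have "(W ((), t) has_derivative frechet_derivative (W ((), t)) (at w)) (at w)"
        by (rule smooth_family_has_derivative[OF W]) (use that in auto)
      from has_field_derivative_of_complex_linear[OF this
          holomorphic_imp_complex_linear[OF U hol[OF that(2)] that(1) this]]
      show ?thesis .
    qed
    have c: "continuous_on (U \<times> {0..1}) (\<lambda>(z, t). W ((), t) z)"
      by (rule jointly_continuous_interval[OF smooth_family_imp_jointly_continuous[OF W]]) simp
    have "continuous_on (U \<times> {0..1}) (\<lambda>(z, t). frechet_derivative (W ((), t)) (at z) 1)"
      by (rule jointly_continuous_interval[OF smooth_family_imp_jointly_continuous[OF
            smooth_family_frechet_derivative[OF W]]]) simp
    then have c': "continuous_on (ball z r \<times> {0..1}) (\<lambda>(z, t). frechet_derivative (W ((), t)) (at z) 1)"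
      by (rule continuous_on_subset) (use r in auto)
    have "((\<lambda>z. integral (cbox 0 1) (\<lambda>t. W ((), t) z)) has_field_derivative
        integral (cbox 0 1) (\<lambda>t. frechet_derivative (W ((), t)) (at z) 1)) (at z within ball z r)"
    proof (rule leibniz_rule_field_derivative)
      show "((\<lambda>z. W ((), t) z) has_field_derivative frechet_derivative (W ((), t)) (at w) 1)
          (at w within ball z r)" if "w \<in> ball z r" "t \<in> cbox 0 1" for w t
        by (rule has_field_derivative_at_within[OF d]) (use that r in auto)
      show "(\<lambda>t. W ((), t) w) integrable_on cbox 0 1" if w: "w \<in> ball z r" for w
      proof (rule integrable_continuous)
        have "w \<in> U" using w r by auto
        then show "continuous_on (cbox 0 1) (\<lambda>t. W ((), t) w)"
          using continuous_on_compose2[OF c, of "cbox 0 1" "\<lambda>t. (w, t)"]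
          by (simp add: continuous_on_Pair image_subset_iff continuous_on_const continuous_on_id)
      qed
    qed (use c' r in auto)
    then show "\<exists>d. ((\<lambda>z. integral {0..1} (\<lambda>t. W ((), t) z)) has_field_derivative d) (at z)"
      using r by (auto simp: at_within_open[of z "ball z r"])
  qed
qed

lemma holomorphic_local_zeta:
  fixes \<phi> :: "complex \<times> real \<Rightarrow> complex"
  assumes U: "open U" and "smooth_map (U \<times> UNIV) \<phi>"
    and "\<And>t. (\<lambda>w. \<phi> (w, t)) holomorphic_on U"
    and "z holomorphic_on U" and "\<And>w. w \<in> U \<Longrightarrow> Re (z w) > 1/2 - real M"
  shows "(\<lambda>w. local_zeta M (z w) (\<lambda>t. \<phi> (w, t))) holomorphic_on U"
  using assms(2-)
proof (induction M arbitrary: \<phi> z)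
  case 0
  let ?Y = "prod_topology (discrete_topology {()}) (top_of_set {0..1::real})"
  have T: "open ({z. Re z > 1/2} \<times> U)" by (intro open_Times open_halfspace_Re_gt U)
  have "smooth_family ?Y U (\<lambda>_. z)"
    unfolding smooth_family_def using Ck_family_holomorphic[OF U 0(3)] by blast
  then have "smooth_family ?Y U (\<lambda>_ w. (z w, w))"
    by (rule smooth_family_Pair[OF U _ smooth_family_linear[OF U bounded_linear_ident]])
  then have "smooth_family ?Y U (\<lambda>q x. of_real (snd q) powr (2 * fst (z x, x) - 1) *
      (\<phi> (snd (z x, x), snd q) + \<phi> (snd (z x, x), - snd q)))"
    by (rule smooth_family_compose[OF T U smooth_family_mellin_integrand[OF U 0(1)] _
          continuous_map_id[unfolded id_def]]) (use 0 in auto)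
  then have "smooth_family ?Y U (\<lambda>q w. of_real (snd q) powr (2 * z w - 1) *
      (\<phi> (w, snd q) + \<phi> (w, - snd q)))"
    unfolding fst_conv snd_conv[of "z _"] .
  note int = holomorphic_parameter_integral[OF U this, unfolded snd_conv]
  have "(\<lambda>w. integral {0..1} (\<lambda>t. of_real t powr (2 * z w - 1) * (\<phi> (w, t) + \<phi> (w, - t)))) holomorphic_on U"
  proof (rule int)
    fix t :: real
    show "(\<lambda>w. complex_of_real t powr (2 * z w - 1) * (\<phi> (w, t) + \<phi> (w, - t))) holomorphic_on U"
    proof (cases "t = 0")
      case False
      then show ?thesis using 0(2,3) by (simp add: powr_def holomorphic_intros)
    qed simp
  qed
  then show ?case using 0(3) by (auto intro!: holomorphic_intros)
next
  case (Suc M)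
  let ?\<omega> = "\<lambda>x. hadamard_quotient (hadamard_quotient (\<lambda>t. \<phi> (fst x, t))) (snd x)"
  have 1: "smooth_map (U \<times> UNIV) ?\<omega>"
    using smooth_family_hadamard_quotient[OF U smooth_family_hadamard_quotient[OF U Suc.prems(1)]] by simp
  have 2: "(\<lambda>w. ?\<omega> (w, t)) holomorphic_on U" for t
    using holomorphic_hadamard_quotient[OF U smooth_family_hadamard_quotient[OF U Suc.prems(1)]]
      holomorphic_hadamard_quotient[OF U Suc.prems(1,2)] by simp
  have 3: "(\<lambda>w. z w + 1) holomorphic_on U" using Suc.prems(3) by (intro holomorphic_intros)
  have 4: "Re (z w + 1) > 1/2 - real M" if "w \<in> U" for w using Suc.prems(4)[OF that] by simp
  have "(\<lambda>w. local_zeta M (z w + 1) (\<lambda>t. ?\<omega> (w, t))) holomorphic_on U"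
    by (rule Suc.IH[OF 1 2 3 4])
  then have "(\<lambda>w. local_zeta M (z w + 1) (hadamard_quotient (hadamard_quotient (\<lambda>t. \<phi> (w, t))))) holomorphic_on U"
    by simp
  then show ?case unfolding local_zeta.simps
    by (intro holomorphic_intros Suc.prems(2,3) 3)
qed

lemma holomorphic_zeta_distr:
  fixes \<phi> :: "complex \<times> real \<Rightarrow> complex"
  assumes U: "open U" and \<phi>: "smooth_map (U \<times> UNIV) \<phi>"
    and hol: "\<And>t. (\<lambda>w. \<phi> (w, t)) holomorphic_on U"
    and z: "z holomorphic_on U"
  shows "(\<lambda>w. zeta_distr (z w) (\<lambda>t. \<phi> (w, t))) holomorphic_on U"
proof -
  define V where "V M = U \<inter> z -` {z. Re z > 1/2 - real M}" for M
  have V: "open (V M)" for M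
    unfolding V_def by (rule continuous_open_preimage[OF holomorphic_on_imp_continuous_on[OF z] U open_halfspace_Re_gt])
  have sub: "V M \<subseteq> U" for M by (auto simp: V_def)
  have UU: "open (U \<times> (UNIV :: real set))" by (intro open_Times U open_UNIV)
  have "(\<lambda>w. zeta_distr (z w) (\<lambda>t. \<phi> (w, t))) holomorphic_on V M" for M
  proof -
    have "(\<lambda>w. local_zeta M (z w) (\<lambda>t. \<phi> (w, t))) holomorphic_on V M"
    proof (rule holomorphic_local_zeta[OF V])
      have "open (V M \<times> (UNIV :: real set))" "V M \<times> (UNIV :: real set) \<subseteq> U \<times> UNIV"
        using sub V by (auto intro!: open_Times)
      then show "smooth_map (V M \<times> UNIV) \<phi>"
        by (rule smooth_family_subset[OF UU _ _ \<phi>])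
      show "Re (z w) > 1/2 - real M" if "w \<in> V M" for w using that by (simp add: V_def)
    qed (rule holomorphic_on_subset[OF hol sub] holomorphic_on_subset[OF z sub])+
    moreover have "local_zeta M (z w) (\<lambda>t. \<phi> (w, t)) = zeta_distr (z w) (\<lambda>t. \<phi> (w, t))" if "w \<in> V M" for w
    proof (rule zeta_distr_eq_local_zeta[symmetric])
      show "smooth_curve (\<lambda>t. \<phi> (w, t))"
        by (rule smooth_curve_slice[OF U \<phi>, of "()"]) (use that sub in auto)
      show "Re (z w) + real M > 0" using that by (simp add: V_def)
    qed
    ultimately show ?thesis by (rule holomorphic_transform)
  qed
  then have "(\<lambda>w. zeta_distr (z w) (\<lambda>t. \<phi> (w, t))) holomorphic_on (\<Union>M. V M)"
    using V by (intro holomorphic_on_UN_open)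
  moreover have "(\<Union>M. V M) = U"
  proof -
    have "\<exists>M. Re w > 1/2 - real M" for w
      using reals_Archimedean2[of "1/2 - Re w"] by (auto simp: algebra_simps)
    then show ?thesis by (auto simp: V_def)
  qed
  ultimately show ?thesis by simp
qed

section \<open>Smooth functions on the general linear group\<close>

text \<open>Continuous partial derivatives imply total differentiability: the increment from \<open>x\<close> to \<open>x + v\<close> is
  split into steps along the coordinate axes, and each step is compared with its linearization by
  the mean value theorem.\<close>

lemma has_derivative_from_partials:
  fixes f :: "'a::euclidean_space \<Rightarrow> 'b::real_normed_vector"
  assumes S: "open S" and x: "x \<in> S"
    and part: "\<And>y b. y \<in> S \<Longrightarrow> b \<in> Basis \<Longrightarrow> ((\<lambda>s. f (y + s *\<^sub>R b)) has_vector_derivative f' y b) (at 0)"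
    and cont: "\<And>b. b \<in> Basis \<Longrightarrow> continuous_on S (\<lambda>y. f' y b)"
  shows "(f has_derivative (\<lambda>v. \<Sum>b\<in>Basis. (v \<bullet> b) *\<^sub>R f' x b)) (at x)"
  unfolding has_derivative_at_alt
proof (intro conjI allI impI)
  show "bounded_linear (\<lambda>v. \<Sum>b\<in>Basis. (v \<bullet> b) *\<^sub>R f' x b)"
    by (intro bounded_linear_sum bounded_linear_scaleR_const bounded_linear_inner_left)
  fix e0 :: real assume e0: "0 < e0"
  let ?n = "real (card (Basis :: 'a set))"
  have n: "?n > 0" by (simp add: card_gt_0_iff)
  \<comment> \<open>Each of the \<open>?n\<close> coordinate steps costs an error of \<open>3 * e * norm v\<close>: \<open>2 * e\<close> from the
     linearization along the step and \<open>e\<close> from moving the partial derivative back to \<open>x\<close>.\<close>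
  define e where "e = e0 / (3 * ?n)"
  have e: "e > 0" using e0 n by (simp add: e_def)
  have "\<exists>d>0. \<forall>y. dist y x < d \<longrightarrow> y \<in> S \<and> (\<forall>b\<in>Basis. norm (f' y b - f' x b) < e)"
  proof -
    have "eventually (\<lambda>y. norm (f' y b - f' x b) < e) (nhds x)" if "b \<in> Basis" for b
    proof -
      have "((\<lambda>y. f' y b) \<longlongrightarrow> f' x b) (nhds x)"
        using cont[OF that] S x tendsto_at_iff_tendsto_nhds[of "\<lambda>y. f' y b" x]
        by (simp add: continuous_on_eq_continuous_at isCont_def)
      from tendstoD[OF this e] show ?thesis by (simp add: dist_norm)
    qed
    then have "eventually (\<lambda>y. y \<in> S \<and> (\<forall>b\<in>Basis. norm (f' y b - f' x b) < e)) (nhds x)"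
      using eventually_nhds_in_open[OF S x] by (intro eventually_conj eventually_ball_finite) auto
    then show ?thesis unfolding eventually_nhds_metric .
  qed
  then obtain d where d: "d > 0" "\<And>y. dist y x < d \<Longrightarrow> y \<in> S"
    "\<And>y b. dist y x < d \<Longrightarrow> b \<in> Basis \<Longrightarrow> norm (f' y b - f' x b) < e" by metis
  \<comment> \<open>Each of the at most \<open>?n\<close> coordinate increments has norm at most \<open>norm v\<close>, so that the radius
     \<open>d / ?n\<close> keeps all intermediate points within distance \<open>d\<close> of \<open>x\<close>.\<close>
  show "\<exists>d>0. \<forall>y. norm (y - x) < d \<longrightarrow>
      norm (f y - f x - (\<Sum>b\<in>Basis. ((y - x) \<bullet> b) *\<^sub>R f' x b)) \<le> e0 * norm (y - x)"
  proof (intro exI[of _ "d / ?n"] conjI allI impI)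
    show "0 < d / ?n" using d n by simp
    fix y assume y: "norm (y - x) < d / ?n"
    define v where "v = y - x"
    let ?v = "\<lambda>B. \<Sum>b\<in>B. (v \<bullet> b) *\<^sub>R b"
    have near: "norm (?v B + s *\<^sub>R b) < d"
      if "insert b B \<subseteq> Basis" "b \<notin> B" "\<bar>s\<bar> \<le> \<bar>v \<bullet> b\<bar>" for B b s
    proof -
      have fin: "finite B" using that finite_subset[OF _ finite_Basis] by auto
      have "norm (?v B + s *\<^sub>R b) \<le> (\<Sum>b\<in>B. norm ((v \<bullet> b) *\<^sub>R b)) + norm (s *\<^sub>R b)"
        by (intro norm_triangle_le add_mono norm_sum order_refl)
      also have "\<dots> \<le> (\<Sum>b\<in>B. norm v) + norm v"
      proof (intro add_mono sum_mono)
        show "norm ((v \<bullet> i) *\<^sub>R i) \<le> norm v" if "i \<in> B" for i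
        proof -
          have "i \<in> Basis" using \<open>insert b B \<subseteq> Basis\<close> that by auto
          then show ?thesis using Basis_le_norm[of i v] by simp
        qed
        have "b \<in> Basis" using that by auto
        then show "norm (s *\<^sub>R b) \<le> norm v" using Basis_le_norm[of b v] that(3) by simp
      qed
      also have "\<dots> = real (card (insert b B)) * norm v" using that fin by (simp add: algebra_simps)
      also have "\<dots> \<le> ?n * norm v"
        using that(1) by (intro mult_right_mono of_nat_mono card_mono) auto
      also have "\<dots> < d" using y n by (simp add: v_def field_simps)
      finally show ?thesis .
    qed
    have "norm (f (x + ?v B) - f x - (\<Sum>b\<in>B. (v \<bullet> b) *\<^sub>R f' x b)) \<le> real (card B) * (3 * e * norm v)"
      if "finite B" "B \<subseteq> Basis" for B
      using that
    proof (induction B rule: finite_induct)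
      case (insert b B)
      let ?w = "x + ?v B" let ?c = "v \<bullet> b"
      have b: "b \<in> Basis" using insert by auto
      have in_d: "dist (?w + s *\<^sub>R b) x < d" if "s \<in> closed_segment 0 ?c" for s
      proof -
        have "\<bar>s\<bar> \<le> \<bar>?c\<bar>" using that by (auto simp: closed_segment_eq_real_ivl split: if_splits)
        then show ?thesis using near[OF insert.prems insert.hyps(2)] by (simp add: dist_norm add.assoc)
      qed
      have der: "((\<lambda>s. f (?w + s *\<^sub>R b)) has_vector_derivative f' (?w + s *\<^sub>R b) b) (at s within closed_segment 0 ?c)"
        if s: "s \<in> closed_segment 0 ?c" for s
      proof -
        have 1: "((\<lambda>r. f ((?w + s *\<^sub>R b) + r *\<^sub>R b)) has_vector_derivative f' (?w + s *\<^sub>R b) b) (at (s - s))"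
          using part[OF d(2)[OF in_d[OF s]] b] by simp
        have 2: "((\<lambda>r. r - s) has_vector_derivative 1) (at s)"
          by (auto intro!: derivative_eq_intros simp flip: has_real_derivative_iff_has_vector_derivative)
        have "(\<lambda>r. f ((?w + s *\<^sub>R b) + r *\<^sub>R b)) \<circ> (\<lambda>r. r - s) = (\<lambda>r. f (?w + r *\<^sub>R b))"
          by (simp add: o_def algebra_simps)
        then show ?thesis
          using vector_diff_chain_at[OF 2 1] has_vector_derivative_at_within by (simp only: scaleR_one)
      qed
      have "norm (f (?w + ?c *\<^sub>R b) - f (?w + 0 *\<^sub>R b) - (?c - 0) *\<^sub>R f' (?w + 0 *\<^sub>R b) b) \<le> norm (?c - 0) * (2 * e)"
      proof (rule vector_differentiable_bound_linearization[where f = "\<lambda>s. f (?w + s *\<^sub>R b)", OF der])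
        fix s assume s: "s \<in> closed_segment 0 ?c"
        have "norm (f' (?w + s *\<^sub>R b) b - f' x b) < e" "norm (f' (?w + 0 *\<^sub>R b) b - f' x b) < e"
          by (rule d(3)[OF in_d b], use s in simp)+
        then show "norm (f' (?w + s *\<^sub>R b) b - f' (?w + 0 *\<^sub>R b) b) \<le> 2 * e"
          using norm_triangle_ineq4[of "f' (?w + s *\<^sub>R b) b - f' x b" "f' (?w + 0 *\<^sub>R b) b - f' x b"] by simp
      qed simp_all
      moreover have c: "\<bar>?c\<bar> \<le> norm v" using Basis_le_norm[OF b, of v] .
      moreover have "\<bar>?c\<bar> * (2 * e) \<le> norm v * (2 * e)" using c e by (intro mult_right_mono) auto
      ultimately have 1: "norm (f (?w + ?c *\<^sub>R b) - f ?w - ?c *\<^sub>R f' ?w b) \<le> norm v * (2 * e)"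
        by simp
      have "norm (f' ?w b - f' x b) \<le> e" using d(3)[OF in_d b, of 0] by simp
      then have 2: "norm (?c *\<^sub>R f' ?w b - ?c *\<^sub>R f' x b) \<le> norm v * e"
        unfolding scaleR_diff_right[symmetric] norm_scaleR using c e by (intro mult_mono) auto
      have "f (x + ?v (insert b B)) - f x - (\<Sum>b\<in>insert b B. (v \<bullet> b) *\<^sub>R f' x b) =
          (f ?w - f x - (\<Sum>b\<in>B. (v \<bullet> b) *\<^sub>R f' x b)) +
          ((f (?w + ?c *\<^sub>R b) - f ?w - ?c *\<^sub>R f' ?w b) + (?c *\<^sub>R f' ?w b - ?c *\<^sub>R f' x b))"
        using insert.hyps by (simp add: algebra_simps)
      also have "norm \<dots> \<le> real (card B) * (3 * e * norm v) + (norm v * (2 * e) + norm v * e)"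
        using insert by (intro norm_triangle_le add_mono 1 2) auto
      finally show ?case using insert.hyps by (simp add: algebra_simps)
    qed simp
    from this[of Basis] show "norm (f y - f x - (\<Sum>b\<in>Basis. ((y - x) \<bullet> b) *\<^sub>R f' x b)) \<le> e0 * norm (y - x)"
      using n by (simp add: euclidean_representation v_def e_def)
  qed
qed

lemma pad_UNIV [simp]: "pad UNIV A = A"
  by (simp add: pad_def vec_eq_iff)

lemma GL_UNIV: "GL UNIV = {A. invertible A}"
  by (simp add: GL_def)

lemma GL_subset_UNIV: "GL J \<subseteq> GL UNIV"
  by (auto simp: GL_def)

lemma open_GL_UNIV: "open (GL UNIV :: 'k::finite sqmat set)"
proof -
  have "GL UNIV = {A :: 'k sqmat. det A \<noteq> 0}" by (simp add: GL_UNIV invertible_det_nz)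
  moreover have "continuous_on UNIV (\<lambda>A :: 'k sqmat. det A)"
    unfolding det_def by (intro continuous_intros)
  ultimately show ?thesis using open_Collect_neq[of det "\<lambda>_. 0"] by simp
qed

lemma elem_mat_axis: "elem_mat i j = axis i (axis j 1)"
  by (auto simp: elem_mat_def axis_def vec_eq_iff)

lemma sqmat_Basis: "(Basis :: 'k::finite sqmat set) = range (\<lambda>(i, j). elem_mat i j)"
  by (auto simp: Basis_vec_def elem_mat_axis)

lemma smooth_GL_partial_derivs:
  assumes "f \<in> smooth_GL J" "set ijs \<subseteq> J \<times> J"
  shows "continuous_on (GL J) (partial_derivs ijs f)"
    and "i \<in> J \<Longrightarrow> j \<in> J \<Longrightarrow> g \<in> GL J \<Longrightarrow>
      ((\<lambda>s. partial_derivs ijs f (g + s *\<^sub>R elem_mat i j)) has_vector_derivative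
        partial_derivs ((i, j) # ijs) f g) (at 0)"
  using assms by (auto simp: smooth_GL_def partial_deriv_def simp flip: vector_derivative_works)

text \<open>The basic open sets of the topology give uniform closeness on a compact ball around the given
  point, where the fixed function varies little.\<close>

lemma jointly_continuous_evaluation:
  fixes ijs :: "('k::finite \<times> 'k) list"
  assumes "set ijs \<subseteq> UNIV \<times> UNIV"
  shows "jointly_continuous (smooth_GL_topology UNIV) (GL UNIV) (\<lambda>f. partial_derivs ijs f)"
  unfolding jointly_continuous_def
proof (intro ballI tendstoI)
  fix f0 :: "'k sqmat \<Rightarrow> complex" and g0 :: "'k sqmat" and e :: real
  assume f0: "f0 \<in> topspace (smooth_GL_topology UNIV)" and g0: "g0 \<in> GL UNIV" and e: "0 < e"
  have f0': "f0 \<in> smooth_GL UNIV" using f0 by (simp add: topspace_smooth_GL_topology)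
  have "(partial_derivs ijs f0 \<longlongrightarrow> partial_derivs ijs f0 g0) (nhds g0)"
    using smooth_GL_partial_derivs(1)[OF f0' assms] g0
    unfolding continuous_on_eq_continuous_at[OF open_GL_UNIV] isCont_def tendsto_at_iff_tendsto_nhds by blast
  from tendstoD[OF this, of "e/2"] e
  have "eventually (\<lambda>g. dist (partial_derivs ijs f0 g) (partial_derivs ijs f0 g0) < e/2 \<and> g \<in> GL UNIV) (nhds g0)"
    using eventually_nhds_in_open[OF open_GL_UNIV g0] by (intro eventually_conj) auto
  then obtain r where r: "r > 0" "\<And>g. dist g g0 < r \<Longrightarrow>
      dist (partial_derivs ijs f0 g) (partial_derivs ijs f0 g0) < e/2 \<and> g \<in> GL UNIV"
    unfolding eventually_nhds_metric by metis
  define K where "K = cball g0 (r/2)"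
  define U where "U = {f \<in> smooth_GL UNIV. \<forall>g\<in>K. cmod (partial_derivs ijs f g - partial_derivs ijs f0 g) < e/2}"
  have K: "K \<subseteq> GL UNIV"
  proof
    fix g assume "g \<in> K" then have "dist g g0 < r" using r(1) by (simp add: K_def dist_commute)
    then show "g \<in> GL UNIV" using r(2) by blast
  qed
  have "openin (smooth_GL_topology UNIV) U"
    unfolding smooth_GL_topology_def
  proof (rule topology_generated_by_Basis, rule CollectI, intro exI conjI)
    show "U = {f \<in> smooth_GL UNIV. \<forall>g\<in>K. cmod (partial_derivs ijs f g - partial_derivs ijs f0 g) < e/2}"
      by (rule U_def)
  qed (use f0' K e assms in \<open>simp_all add: K_def\<close>)
  moreover have "f0 \<in> U" using f0' e by (simp add: U_def)
  ultimately have 1: "eventually (\<lambda>f. f \<in> U) (nhdsin (smooth_GL_topology UNIV) f0)"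
    unfolding eventually_nhdsin by blast
  have 2: "eventually (\<lambda>g. g \<in> ball g0 (r/2)) (nhds g0)"
    using r(1) by (intro eventually_nhds_in_open) auto
  show "eventually (\<lambda>x. dist (case x of (f, g) \<Rightarrow> partial_derivs ijs f g) (partial_derivs ijs f0 g0) < e)
      (nhdsin (smooth_GL_topology UNIV) f0 \<times>\<^sub>F nhds g0)"
    using eventually_prodI[OF 1 2]
  proof (rule eventually_mono)
    fix x assume x: "fst x \<in> U \<and> snd x \<in> ball g0 (r/2)"
    obtain f g where fg: "x = (f, g)" by force
    have g: "g \<in> K" "dist g g0 < r" using x r(1) by (simp_all add: fg K_def dist_commute)
    have "dist (partial_derivs ijs f g) (partial_derivs ijs f0 g) < e/2"
      using x g(1) by (simp add: fg U_def dist_norm)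
    moreover have "dist (partial_derivs ijs f0 g) (partial_derivs ijs f0 g0) < e/2" using r(2)[OF g(2)] by simp
    ultimately show "dist (case x of (f, g) \<Rightarrow> partial_derivs ijs f g) (partial_derivs ijs f0 g0) < e"
      using dist_triangle[of "partial_derivs ijs f g" "partial_derivs ijs f0 g0" "partial_derivs ijs f0 g"]
      by (simp add: fg)
  qed
qed

text \<open>The function itself is the parameter of this family. Smoothness on \<open>GL\<close> is defined by partial
  derivatives, and \<open>has_derivative_from_partials\<close> converts them into the derivatives of a smooth
  family.\<close>

lemma smooth_family_evaluation:
  "smooth_family (smooth_GL_topology UNIV) (GL UNIV :: 'k::finite sqmat set) (\<lambda>f. f)"
proof -
  have "Ck_family k (smooth_GL_topology UNIV) (GL UNIV :: 'k sqmat set) (\<lambda>f. partial_derivs ijs f)" for k ijs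
  proof (induction k arbitrary: ijs)
    case 0
    show ?case unfolding Ck_family.simps by (rule jointly_continuous_evaluation) simp
  next
    case (Suc k)
    let ?P = "\<lambda>f g b. vector_derivative (\<lambda>s. partial_derivs ijs f (g + s *\<^sub>R b)) (at 0)"
    have P: "?P f g (elem_mat i j) = partial_derivs ((i, j) # ijs) f g" for f g i j
      by (simp add: partial_deriv_def)
    show ?case
    proof (rule Ck_family_SucI[OF open_GL_UNIV, where W' = "\<lambda>f g v. \<Sum>b\<in>Basis. (v \<bullet> b) *\<^sub>R ?P f g b"])
      show "jointly_continuous (smooth_GL_topology UNIV) (GL UNIV) (\<lambda>f. partial_derivs ijs f)"
        by (rule jointly_continuous_evaluation) simp
      fix f :: "'k sqmat \<Rightarrow> complex" and g :: "'k sqmat"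
      assume "f \<in> topspace (smooth_GL_topology UNIV)" and g: "g \<in> GL UNIV"
      then have f: "f \<in> smooth_GL UNIV" by (simp add: topspace_smooth_GL_topology)
      show "(partial_derivs ijs f has_derivative (\<lambda>v. \<Sum>b\<in>Basis. (v \<bullet> b) *\<^sub>R ?P f g b)) (at g)"
      proof (rule has_derivative_from_partials[OF open_GL_UNIV g])
        fix g' :: "'k sqmat" and b :: "'k sqmat" assume g': "g' \<in> GL UNIV" and "b \<in> Basis"
        then obtain i j where b: "b = elem_mat i j" by (auto simp: sqmat_Basis)
        show "((\<lambda>s. partial_derivs ijs f (g' + s *\<^sub>R b)) has_vector_derivative ?P f g' b) (at 0)"
          unfolding b P by (rule smooth_GL_partial_derivs(2)[OF f]) (use g' in simp_all)
      next
        fix b :: "'k sqmat" assume "b \<in> Basis"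
        then obtain i j where b: "b = elem_mat i j" by (auto simp: sqmat_Basis)
        show "continuous_on (GL UNIV) (\<lambda>g. ?P f g b)"
          unfolding b P by (rule smooth_GL_partial_derivs(1)[OF f]) simp
      qed
    next
      fix v :: "'k sqmat"
      show "Ck_family k (smooth_GL_topology UNIV) (GL UNIV) (\<lambda>f g. \<Sum>b\<in>Basis. (v \<bullet> b) *\<^sub>R ?P f g b)"
      proof (rule Ck_family_sum[OF open_GL_UNIV])
        fix b :: "'k sqmat" assume "b \<in> Basis"
        then obtain i j where b: "b = elem_mat i j" by (auto simp: sqmat_Basis)
        have "Ck_family k (smooth_GL_topology UNIV) (GL UNIV) (\<lambda>f g. ?P f g b)"
          unfolding b P by (rule Suc.IH)
        then show "Ck_family k (smooth_GL_topology UNIV) (GL UNIV) (\<lambda>f g. (v \<bullet> b) *\<^sub>R ?P f g b)"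
          by (rule Ck_family_bilinear[OF open_GL_UNIV bounded_bilinear_scaleR Ck_family_const[OF open_GL_UNIV]])
      qed
    qed
  qed
  from this[of _ "[]"] show ?thesis by (simp add: smooth_family_def)
qed

definition restrict_GL :: "'k set \<Rightarrow> ('k::finite sqmat \<Rightarrow> complex) \<Rightarrow> 'k sqmat \<Rightarrow> complex" where
  "restrict_GL J f = (\<lambda>g. if g \<in> GL J then f g else 0)"

lemma pad_add_elem_mat:
  assumes "i \<in> J" "j \<in> J" "pad J g = g"
  shows "pad J (g + s *\<^sub>R elem_mat i j) = g + s *\<^sub>R elem_mat i j"
proof -
  have "g $ a $ b = (if a = b then 1 else 0)" if "\<not> (a \<in> J \<and> b \<in> J)" for a b
    by (subst assms(3)[symmetric]) (use that in \<open>auto simp: pad_def\<close>)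
  then show ?thesis using assms(1,2) by (auto simp: pad_def vec_eq_iff elem_mat_def)
qed

text \<open>Partial derivatives in the directions \<open>J \<times> J\<close> at points of \<open>GL J\<close> only see values on \<open>GL J\<close>. So the
  iterated partial derivatives of the restriction to \<open>GL J\<close> are derivatives of the family \<open>W\<close> on the
  full group.\<close>

lemma partial_derivs_restrict_GL:
  fixes W :: "'y \<Rightarrow> 'k::finite sqmat \<Rightarrow> complex"
  assumes W: "smooth_family Y (GL UNIV) W" and "set ijs \<subseteq> J \<times> J"
  obtains V where "smooth_family Y (GL UNIV) V"
    "\<And>y g. y \<in> topspace Y \<Longrightarrow> g \<in> GL J \<Longrightarrow> partial_derivs ijs (restrict_GL J (W y)) g = V y g"
    "\<And>y g i j. y \<in> topspace Y \<Longrightarrow> g \<in> GL J \<Longrightarrow> i \<in> J \<Longrightarrow> j \<in> J \<Longrightarrow>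
      ((\<lambda>s. partial_derivs ijs (restrict_GL J (W y)) (g + s *\<^sub>R elem_mat i j)) has_vector_derivative
        frechet_derivative (V y) (at g) (elem_mat i j)) (at 0)"
proof -
  have der: "((\<lambda>s. F (g + s *\<^sub>R elem_mat i j)) has_vector_derivative
        frechet_derivative (V y) (at g) (elem_mat i j)) (at 0)"
    if V: "smooth_family Y (GL UNIV) V" and eq: "\<And>g. g \<in> GL J \<Longrightarrow> F g = V y g"
      and y: "y \<in> topspace Y" and g: "g \<in> GL J" and ij: "i \<in> J" "j \<in> J"
    for F and V :: "'y \<Rightarrow> 'k sqmat \<Rightarrow> complex" and y g i j
  proof (rule has_vector_derivative_transform_within_open)
    let ?E = "elem_mat i j :: 'k sqmat"
    have gU: "g \<in> GL UNIV" using g GL_subset_UNIV by blast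
    have D: "(V y has_derivative frechet_derivative (V y) (at g)) (at g)"
      by (rule smooth_family_has_derivative[OF V y gU])
    have 1: "((\<lambda>s. g + s *\<^sub>R ?E) has_derivative (\<lambda>s. s *\<^sub>R ?E)) (at 0)"
      by (auto intro!: derivative_eq_intros)
    have "((\<lambda>s. V y (g + s *\<^sub>R ?E)) has_derivative (\<lambda>s. frechet_derivative (V y) (at g) (s *\<^sub>R ?E))) (at 0)"
      by (rule has_derivative_compose[OF 1]) (use D in simp)
    then show "((\<lambda>s. V y (g + s *\<^sub>R ?E)) has_vector_derivative frechet_derivative (V y) (at g) ?E) (at 0)"
      by (simp only: has_vector_derivative_def linear_scale[OF has_derivative_linear[OF D]])
    show "open ((\<lambda>s. g + s *\<^sub>R ?E) -` GL UNIV)"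
      by (intro continuous_open_vimage open_GL_UNIV continuous_intros)
    show "0 \<in> (\<lambda>s. g + s *\<^sub>R ?E) -` GL UNIV" using gU by simp
    show "V y (g + s *\<^sub>R ?E) = F (g + s *\<^sub>R ?E)" if "s \<in> (\<lambda>s. g + s *\<^sub>R ?E) -` GL UNIV" for s
    proof (rule eq[symmetric])
      have "pad J g = g" using g by (simp add: GL_def)
      from pad_add_elem_mat[OF ij this] show "g + s *\<^sub>R ?E \<in> GL J"
        using that by (simp add: GL_def)
    qed
  qed
  have "\<exists>V. smooth_family Y (GL UNIV) V \<and>
    (\<forall>y\<in>topspace Y. \<forall>g\<in>GL J. partial_derivs ijs (restrict_GL J (W y)) g = V y g)"
    using assms(2)
  proof (induction ijs)
    case Nil
    show ?case using W by (intro exI[of _ W]) (simp add: restrict_GL_def)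
  next
    case (Cons ij ijs)
    obtain i j where ij: "ij = (i, j)" by force
    from Cons obtain V where V: "smooth_family Y (GL UNIV) V"
      "\<And>y g. y \<in> topspace Y \<Longrightarrow> g \<in> GL J \<Longrightarrow> partial_derivs ijs (restrict_GL J (W y)) g = V y g" by auto
    have "partial_derivs (ij # ijs) (restrict_GL J (W y)) g = frechet_derivative (V y) (at g) (elem_mat i j)"
      if "y \<in> topspace Y" "g \<in> GL J" for y g
      unfolding partial_derivs.simps partial_deriv_def ij fst_conv snd_conv
      by (rule vector_derivative_at[OF der[OF V(1) V(2)[OF that(1)] that]])
        (use Cons.prems ij in simp_all)
    then show ?case using smooth_family_frechet_derivative[OF V(1), of "elem_mat i j"] by blast
  qed
  then obtain V where V: "smooth_family Y (GL UNIV) V"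
    "\<And>y g. y \<in> topspace Y \<Longrightarrow> g \<in> GL J \<Longrightarrow> partial_derivs ijs (restrict_GL J (W y)) g = V y g" by blast
  show ?thesis
    by (rule that[OF V(1) V(2) der[OF V(1) V(2)]])
qed

lemma restrict_GL_in_smooth_GL:
  fixes W :: "'y \<Rightarrow> 'k::finite sqmat \<Rightarrow> complex"
  assumes W: "smooth_family Y (GL UNIV) W" and y: "y \<in> topspace Y"
  shows "restrict_GL J (W y) \<in> smooth_GL J"
  unfolding smooth_GL_def
proof (intro CollectI conjI allI impI ballI)
  fix ijs assume "set ijs \<subseteq> J \<times> J"
  then obtain V where V: "smooth_family Y (GL UNIV) V"
    "\<And>y g. y \<in> topspace Y \<Longrightarrow> g \<in> GL J \<Longrightarrow> partial_derivs ijs (restrict_GL J (W y)) g = V y g"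
    "\<And>y g i j. y \<in> topspace Y \<Longrightarrow> g \<in> GL J \<Longrightarrow> i \<in> J \<Longrightarrow> j \<in> J \<Longrightarrow>
      ((\<lambda>s. partial_derivs ijs (restrict_GL J (W y)) (g + s *\<^sub>R elem_mat i j)) has_vector_derivative
        frechet_derivative (V y) (at g) (elem_mat i j)) (at 0)"
  proof (rule partial_derivs_restrict_GL[OF W])
    fix V assume "smooth_family Y (GL UNIV) V"
      "\<And>y g. y \<in> topspace Y \<Longrightarrow> g \<in> GL J \<Longrightarrow> partial_derivs ijs (restrict_GL J (W y)) g = V y g"
      "\<And>y g i j. y \<in> topspace Y \<Longrightarrow> g \<in> GL J \<Longrightarrow> i \<in> J \<Longrightarrow> j \<in> J \<Longrightarrow>
        ((\<lambda>s. partial_derivs ijs (restrict_GL J (W y)) (g + s *\<^sub>R elem_mat i j)) has_vector_derivative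
          frechet_derivative (V y) (at g) (elem_mat i j)) (at 0)"
    then show thesis by (rule that)
  qed
  have "continuous_on (GL J) (V y)"
    by (rule continuous_on_subset[OF jointly_continuous_imp_continuous_on[OF
            smooth_family_imp_jointly_continuous[OF V(1)] y] GL_subset_UNIV])
  then show "continuous_on (GL J) (partial_derivs ijs (restrict_GL J (W y)))"
    by (rule continuous_on_eq) (simp add: V(2)[OF y])
  fix i j g assume "i \<in> J" "j \<in> J" "g \<in> GL J"
  from V(3)[OF y this(3,1,2)]
  show "(\<lambda>s. partial_derivs ijs (restrict_GL J (W y)) (g + s *\<^sub>R elem_mat i j)) differentiable (at 0)"
    unfolding has_vector_derivative_def differentiable_def by blast
qed (simp add: restrict_GL_def)

text \<open>The converse of \<open>smooth_family_evaluation\<close>: the tube lemma upgrades joint continuity of the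
  derivatives to uniform convergence on compact sets.\<close>

lemma continuous_map_smooth_GL:
  fixes W :: "'y \<Rightarrow> 'k::finite sqmat \<Rightarrow> complex"
  assumes W: "smooth_family Y (GL UNIV) W"
  shows "continuous_map Y (smooth_GL_topology J) (\<lambda>y. restrict_GL J (W y))"
proof -
  let ?F = "\<lambda>y. restrict_GL J (W y)"
  let ?B = "{{f \<in> smooth_GL J. \<forall>g\<in>K. cmod (partial_derivs ijs f g - partial_derivs ijs f0 g) < e}
       | f0 K ijs e. f0 \<in> smooth_GL J \<and> compact K \<and> K \<subseteq> GL J \<and> set ijs \<subseteq> J \<times> J \<and> (0::real) < e}"
  show ?thesis
    unfolding smooth_GL_topology_def
  proof (rule continuous_on_generated_topo)
    have "\<Union>?B = smooth_GL J"
      using topspace_smooth_GL_topology[of J] unfolding smooth_GL_topology_def topology_generated_by_topspace .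
    then show "?F ` topspace Y \<subseteq> \<Union>?B"
      using restrict_GL_in_smooth_GL[OF W] by (simp only: image_subset_iff) simp
    fix U assume "U \<in> ?B"
    then obtain f0 K ijs e where U: "U = {f \<in> smooth_GL J. \<forall>g\<in>K. cmod (partial_derivs ijs f g - partial_derivs ijs f0 g) < e}"
      and f0: "f0 \<in> smooth_GL J" and K: "compact K" "K \<subseteq> GL J" and ijs: "set ijs \<subseteq> J \<times> J" and e: "0 < e"
      by blast
    obtain V where V: "smooth_family Y (GL UNIV) V"
      "\<And>y g. y \<in> topspace Y \<Longrightarrow> g \<in> GL J \<Longrightarrow> partial_derivs ijs (?F y) g = V y g"
    proof (rule partial_derivs_restrict_GL[OF W ijs])
      fix V assume "smooth_family Y (GL UNIV) V"
        "\<And>y g. y \<in> topspace Y \<Longrightarrow> g \<in> GL J \<Longrightarrow> partial_derivs ijs (?F y) g = V y g"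
      then show thesis by (rule that)
    qed
    define c where "c = partial_derivs ijs f0"
    have c: "continuous_on K c"
      unfolding c_def by (rule continuous_on_subset[OF smooth_GL_partial_derivs(1)[OF f0 ijs] K(2)])
    have mem: "?F y \<in> U \<longleftrightarrow> (\<forall>g\<in>K. cmod (V y g - c g) < e)" if "y \<in> topspace Y" for y
    proof -
      have "partial_derivs ijs (?F y) g = V y g" if "g \<in> K" for g
        by (rule V(2)) (use \<open>y \<in> topspace Y\<close> that K(2) in auto)
      then show ?thesis using restrict_GL_in_smooth_GL[OF W that, of J] by (simp add: U c_def)
    qed
    have "\<exists>T. openin Y T \<and> y0 \<in> T \<and> T \<subseteq> ?F -` U \<inter> topspace Y" if y0: "y0 \<in> ?F -` U \<inter> topspace Y" for y0
    proof -
      have y0': "y0 \<in> topspace Y" using y0 by simp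
      have "eventually (\<lambda>y. \<forall>g\<in>K. cmod (V y g - c g) < e) (nhdsin Y y0)"
      proof (rule eventually_ball_compact[OF K(1)])
        fix g assume g: "g \<in> K"
        define d where "d = e - cmod (V y0 g - c g)"
        have d: "d > 0" using mem[OF y0'] y0 g by (simp add: d_def)
        have gU: "g \<in> GL UNIV" using g K(2) GL_subset_UNIV by blast
        have 1: "eventually (\<lambda>x. dist (V (fst x) (snd x)) (V y0 g) < d/2) (nhdsin Y y0 \<times>\<^sub>F nhds g)"
          using tendstoD[OF jointly_continuousD[OF smooth_family_imp_jointly_continuous[OF V(1)] y0' gU], of "d/2"] d
          by (simp add: case_prod_unfold)
        have "eventually (\<lambda>g'. dist (c g') (c g) < d/2) (at g within K)"
          using c g d unfolding continuous_on_def by (intro tendstoD) auto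
        then have "eventually (\<lambda>g'. g' \<in> K \<longrightarrow> dist (c g') (c g) < d/2) (nhds g)"
          unfolding eventually_at_filter using d by (auto elim!: eventually_mono)
        then have 2: "eventually (\<lambda>x. snd x \<in> K \<longrightarrow> dist (c (snd x)) (c g) < d/2) (nhdsin Y y0 \<times>\<^sub>F nhds g)"
          by (rule eventually_compose_filterlim[OF _ filterlim_snd])
        show "eventually (\<lambda>(y, g'). g' \<in> K \<longrightarrow> cmod (V y g' - c g') < e) (nhdsin Y y0 \<times>\<^sub>F nhds g)"
          using eventually_conj[OF 1 2]
        proof (rule eventually_mono)
          fix x assume x: "dist (V (fst x) (snd x)) (V y0 g) < d/2 \<and> (snd x \<in> K \<longrightarrow> dist (c (snd x)) (c g) < d/2)"
          have "cmod (V (fst x) (snd x) - c (snd x)) < e" if "snd x \<in> K"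
          proof -
            have "V (fst x) (snd x) - c (snd x) = (V (fst x) (snd x) - V y0 g) + ((V y0 g - c g) + (c g - c (snd x)))"
              by simp
            also have "cmod \<dots> \<le> cmod (V (fst x) (snd x) - V y0 g) + (cmod (V y0 g - c g) + cmod (c g - c (snd x)))"
              by (intro norm_triangle_le add_left_mono norm_triangle_ineq)
            also have "\<dots> < e" using x that by (simp add: dist_norm norm_minus_commute d_def)
            finally show ?thesis .
          qed
          then show "case x of (y, g') \<Rightarrow> g' \<in> K \<longrightarrow> cmod (V y g' - c g') < e" by (simp add: case_prod_unfold)
        qed
      qed
      then obtain T where T: "openin Y T" "y0 \<in> T" "\<forall>y\<in>T. \<forall>g\<in>K. cmod (V y g - c g) < e"
        using y0' unfolding eventually_nhdsin by blast
      have "T \<subseteq> topspace Y" using T(1) by (rule openin_subset)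
      then have "T \<subseteq> ?F -` U \<inter> topspace Y" using T(3) mem by (simp add: subset_iff)
      then show ?thesis using T by blast
    qed
    then show "openin Y (?F -` U \<inter> topspace Y)" by (subst openin_subopen) blast
  qed
qed

section \<open>Complex difference quotients in the Frechet space\<close>

lemma atin_euclidean: "atin euclidean a = at a"
proof (rule filter_eqI)
  fix P
  show "eventually P (atin euclidean a) \<longleftrightarrow> eventually P (at a)"
    unfolding eventually_atin eventually_at_topological by auto
qed

lemma smooth_family_param_to_domain:
  fixes W :: "complex \<times> 'a::euclidean_space \<Rightarrow> complex"
  assumes S: "open S" and W: "smooth_map (UNIV \<times> S) W"
  shows "smooth_family euclidean S (\<lambda>\<zeta> x. W (\<zeta>, x))"
proof -
  have US: "open ((UNIV :: complex set) \<times> S)" by (intro open_Times S open_UNIV)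
  have "continuous_map euclidean euclidean (\<lambda>\<zeta> :: complex. \<zeta>)" by simp
  from smooth_family_Pair[OF S smooth_family_param[OF S this] smooth_family_linear[OF S bounded_linear_ident]]
  have 1: "smooth_family (euclidean :: complex topology) S (\<lambda>\<zeta> x. (\<zeta>, x))" .
  have "continuous_map (euclidean :: complex topology) (discrete_topology {()}) (\<lambda>_. ())" by simp
  then show ?thesis
    by (rule smooth_family_compose[OF US S W 1]) auto
qed

text \<open>For \<open>\<zeta> \<noteq> 0\<close> the quotient is the integral over \<open>r \<in> [0, 1]\<close> of the complex derivative at \<open>r \<zeta>\<close>.
  This integral is a smooth family in \<open>\<zeta>\<close>, including \<open>\<zeta> = 0\<close>, hence continuous as a map into the
  Frechet space.\<close>

lemma difference_quotient_limit:
  fixes W :: "complex \<times> 'k::finite sqmat \<Rightarrow> complex"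
  assumes W: "smooth_map (UNIV \<times> GL UNIV) W"
    and hol: "\<And>g. g \<in> GL UNIV \<Longrightarrow> (\<lambda>\<zeta>. W (\<zeta>, g)) holomorphic_on UNIV"
  shows "\<exists>L. limitin (smooth_GL_topology J)
    (\<lambda>\<zeta>. restrict_GL J (\<lambda>g. (W (\<zeta>, g) - W (0, g)) / \<zeta>)) L (at 0)"
proof -
  let ?S = "(UNIV :: complex set) \<times> (GL UNIV :: 'k sqmat set)"
  let ?Y = "prod_topology (discrete_topology {()}) (top_of_set {0..1::real})"
  let ?D = "\<lambda>x. frechet_derivative W (at x) (1, 0)"
  have S: "open ?S" by (intro open_Times open_GL_UNIV open_UNIV)
  have D: "smooth_map ?S ?D" by (rule smooth_family_frechet_derivative[OF W])
  have "continuous_map ?Y (top_of_set {0..1::real}) snd" by (rule continuous_map_snd)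
  then have snd: "continuous_map ?Y euclidean (\<lambda>q. snd q)" by (simp add: continuous_map_in_subtopology)
  have "smooth_family ?Y ?S (\<lambda>q x. (snd q *\<^sub>R fst x, snd x))"
    by (rule smooth_family_Pair[OF S smooth_family_bilinear[OF S bounded_bilinear_scaleR
            smooth_family_param[OF S snd] smooth_family_linear[OF S bounded_linear_fst]]
          smooth_family_linear[OF S bounded_linear_snd]])
  then have "smooth_family ?Y ?S (\<lambda>q x. ?D (snd q *\<^sub>R fst x, snd x))"
    by (rule smooth_family_compose[OF S S D _ continuous_map_fst]) auto
  from smooth_family_integral[OF S this]
  have \<Delta>: "smooth_map ?S (\<lambda>x. integral {0..1} (\<lambda>r. ?D (r *\<^sub>R fst x, snd x)))" by simp
  define \<Delta>q where "\<Delta>q = (\<lambda>\<zeta> g. integral {0..1} (\<lambda>r. ?D (r *\<^sub>R \<zeta>, g)))"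
  have "smooth_family euclidean (GL UNIV) \<Delta>q"
    using smooth_family_param_to_domain[OF open_GL_UNIV \<Delta>] by (simp add: \<Delta>q_def)
  then have "continuous_map euclidean (smooth_GL_topology J) (\<lambda>\<zeta>. restrict_GL J (\<Delta>q \<zeta>))"
    by (rule continuous_map_smooth_GL)
  then have "limitin (smooth_GL_topology J) (\<lambda>\<zeta>. restrict_GL J (\<Delta>q \<zeta>)) (restrict_GL J (\<Delta>q 0)) (atin euclidean 0)"
    by (rule limitin_continuous_map) simp_all
  then have lim: "limitin (smooth_GL_topology J) (\<lambda>\<zeta>. restrict_GL J (\<Delta>q \<zeta>)) (restrict_GL J (\<Delta>q 0)) (at 0)"
    by (simp only: atin_euclidean)
  have "eventually (\<lambda>\<zeta>. restrict_GL J (\<Delta>q \<zeta>) = restrict_GL J (\<lambda>g. (W (\<zeta>, g) - W (0, g)) / \<zeta>)) (at 0)"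
    unfolding eventually_at_filter
  proof (intro always_eventually allI impI)
    fix \<zeta> :: complex assume \<zeta>: "\<zeta> \<noteq> 0"
    have "\<Delta>q \<zeta> g = (W (\<zeta>, g) - W (0, g)) / \<zeta>" if "g \<in> GL J" for g
    proof -
      have g: "g \<in> GL UNIV" using that GL_subset_UNIV by blast
      have d: "((\<lambda>w. W (w, g)) has_field_derivative ?D (w, g)) (at w)" for w
      proof -
        have sl: "((\<lambda>z. W (z, g)) has_derivative (\<lambda>v. frechet_derivative W (at (w, g)) (v, 0))) (at w)"
          by (rule has_derivative_slice[OF W]) (use g in simp_all)
        show ?thesis
          using has_field_derivative_of_complex_linear[OF sl
              holomorphic_imp_complex_linear[OF open_UNIV hol[OF g] UNIV_I sl]] .
      qed
      have "((\<lambda>r. W (r *\<^sub>R \<zeta>, g)) has_vector_derivative (\<zeta> * ?D (r *\<^sub>R \<zeta>, g))) (at r within {0..1})" for r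
      proof -
        have "((\<lambda>r. r *\<^sub>R \<zeta>) has_vector_derivative \<zeta>) (at r)"
          by (auto intro!: derivative_eq_intros simp: has_vector_derivative_def)
        from field_vector_diff_chain_at[OF this d] show ?thesis
          by (simp add: o_def has_vector_derivative_at_within)
      qed
      then have "((\<lambda>r. \<zeta> * ?D (r *\<^sub>R \<zeta>, g)) has_integral (W (1 *\<^sub>R \<zeta>, g) - W (0 *\<^sub>R \<zeta>, g))) {0..1}"
        by (intro fundamental_theorem_of_calculus) auto
      from has_integral_mult_right[OF this, of "1 / \<zeta>"] \<zeta>
      have "((\<lambda>r. ?D (r *\<^sub>R \<zeta>, g)) has_integral (W (\<zeta>, g) - W (0, g)) / \<zeta>) {0..1}" by simp
      then show ?thesis by (simp add: \<Delta>q_def integral_unique)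
    qed
    then show "restrict_GL J (\<Delta>q \<zeta>) = restrict_GL J (\<lambda>g. (W (\<zeta>, g) - W (0, g)) / \<zeta>)"
      by (simp add: restrict_GL_def fun_eq_iff)
  qed
  from limitin_transform_eventually[OF this lim] show ?thesis by blast
qed

lemma continuous_map_restrict_Orth:
  "continuous_map (smooth_GL_topology J) (smooth_Orth_topology J) (restrict_Orth J)"
  unfolding continuous_map_def topspace_smooth_Orth_topology topspace_smooth_GL_topology
  by (auto simp: openin_smooth_Orth_topology smooth_Orth_def)

section \<open>Block triangular matrices\<close>

lemma matrix_mult_row_unit:
  assumes "\<And>k. A $ i $ k = (if i = k then 1 else 0)"
  shows "((A :: 'k::finite sqmat) ** B) $ i $ j = B $ i $ j"
  by (simp add: matrix_matrix_mult_def assms if_distrib[of "\<lambda>x. x * _"] cong: if_cong)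

lemma matrix_mult_column_unit:
  assumes "\<And>k. B $ k $ j = (if k = j then 1 else 0)"
  shows "((A :: 'k::finite sqmat) ** B) $ i $ j = A $ i $ j"
  by (simp add: matrix_matrix_mult_def assms if_distrib[of "\<lambda>x. _ * x"] cong: if_cong)

lemma matrix_add_rdistrib: "((A :: 'k::finite sqmat) + B) ** C = A ** C + B ** C"
  by (simp add: matrix_matrix_mult_def vec_eq_iff algebra_simps sum.distrib)

lemma pad_nth: "pad J A $ i $ j = (if i \<in> J \<and> j \<in> J then A $ i $ j else if i = j then 1 else 0)"
  by (simp add: pad_def)

lemma pad_eq_iff:
  "pad J A = A \<longleftrightarrow> (\<forall>i j. \<not> (i \<in> J \<and> j \<in> J) \<longrightarrow> A $ i $ j = (if i = j then 1 else 0))"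
  by (auto simp: pad_nth vec_eq_iff)

lemma pad_pad: "pad J (pad K A) = pad (J \<inter> K) A"
  by (simp add: pad_nth vec_eq_iff)

lemma pad_transpose: "pad J (transpose A) = transpose (pad J A)"
  by (auto simp: pad_nth vec_eq_iff transpose_def)

lemma pad_mat_1 [simp]: "pad J (mat 1) = mat 1"
  by (simp add: pad_nth vec_eq_iff mat_def)

lemma pad_mult_fixed:
  assumes A: "pad J A = A" and B: "pad J B = B"
  shows "pad J (A ** B) = (A ** B :: 'k::finite sqmat)"
  unfolding pad_eq_iff
proof (intro allI impI)
  fix i j :: 'k assume "\<not> (i \<in> J \<and> j \<in> J)"
  then consider "i \<notin> J" | "j \<notin> J" by auto
  then show "(A ** B) $ i $ j = (if i = j then 1 else 0)"
  proof cases
    case 1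
    then show ?thesis
      using A[unfolded pad_eq_iff] B[unfolded pad_eq_iff] by (subst matrix_mult_row_unit) auto
  next
    case 2
    then show ?thesis
      using A[unfolded pad_eq_iff] B[unfolded pad_eq_iff] by (subst matrix_mult_column_unit) auto
  qed
qed

lemma GL_mult: "A \<in> GL J \<Longrightarrow> B \<in> GL J \<Longrightarrow> A ** B \<in> GL J"
  by (simp add: GL_def pad_mult_fixed invertible_mult)

lemma matrix_inv_cancel:
  assumes "invertible (A :: 'k::finite sqmat)"
  shows "A ** matrix_inv A = mat 1" "matrix_inv A ** A = mat 1"
  using assms unfolding invertible_def matrix_inv_def by (metis (mono_tags, lifting) someI_ex)+

lemma matrix_inv_GL:
  assumes "A \<in> GL J" shows "matrix_inv A \<in> GL J"
proof -
  have inv: "invertible A" and A: "pad J A = A" using assms by (auto simp: GL_def)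
  note c = matrix_inv_cancel[OF inv]
  have "matrix_inv A $ i $ j = (if i = j then 1 else 0)" if "\<not> (i \<in> J \<and> j \<in> J)" for i j
  proof (cases "i \<in> J")
    case False
    then have "(A ** matrix_inv A) $ i $ j = matrix_inv A $ i $ j"
      using A[unfolded pad_eq_iff] by (intro matrix_mult_row_unit) auto
    then show ?thesis by (simp add: c mat_def)
  next
    case True
    then have "(matrix_inv A ** A) $ i $ j = matrix_inv A $ i $ j"
      using A[unfolded pad_eq_iff] that by (intro matrix_mult_column_unit) auto
    then show ?thesis by (simp add: c mat_def)
  qed
  then have "pad J (matrix_inv A) = matrix_inv A" by (simp add: pad_eq_iff)
  moreover have "invertible (matrix_inv A)" using c unfolding invertible_def by blast
  ultimately show ?thesis by (simp add: GL_def)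
qed

lemma GL_mult_cancel_left:
  assumes "h \<in> GL J" shows "matrix_inv h ** x \<in> GL J \<longleftrightarrow> x \<in> GL J"
proof
  assume "matrix_inv h ** x \<in> GL J"
  with assms have "h ** (matrix_inv h ** x) \<in> GL J" by (rule GL_mult)
  then show "x \<in> GL J"
    using assms by (simp add: matrix_mul_assoc matrix_inv_cancel GL_def)
qed (use assms GL_mult matrix_inv_GL in blast)

text \<open>The columns of \<open>M\<close> outside \<open>J\<close> meet only zero entries in the columns of \<open>p\<close> belonging to \<open>J\<close>.\<close>

lemma pad_mult_block_triangular:
  fixes M p :: "'k::finite sqmat"
  assumes p: "\<And>i j. i \<notin> J \<Longrightarrow> j \<in> J \<Longrightarrow> p $ i $ j = 0"
  shows "pad J (M ** p) = pad J M ** pad J p"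
proof -
  have "pad J (M ** p) $ i $ j = (pad J M ** pad J p) $ i $ j" for i j
  proof -
    consider "i \<notin> J" | "j \<notin> J" | "i \<in> J" "j \<in> J" by auto
    then show ?thesis
    proof cases
      case 1
      then show ?thesis by (subst matrix_mult_row_unit) (auto simp: pad_nth)
    next
      case 2
      then show ?thesis by (subst matrix_mult_column_unit) (auto simp: pad_nth)
    next
      case 3
      have "M $ i $ k * p $ k $ j = pad J M $ i $ k * pad J p $ k $ j" for k
        using 3 p by (cases "k \<in> J") (auto simp: pad_nth)
      moreover have "pad J (M ** p) $ i $ j = (M ** p) $ i $ j" using 3 by (simp add: pad_nth)
      ultimately show ?thesis by (simp add: matrix_matrix_mult_def)
    qed
  qed
  then show ?thesis by (simp add: vec_eq_iff)
qed

lemma block_det_mult_block_triangular: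
  assumes "\<And>i j. i \<notin> J \<Longrightarrow> j \<in> J \<Longrightarrow> p $ i $ j = 0"
  shows "block_det J (M ** p) = block_det J M * block_det J p"
  by (simp add: block_det_def pad_mult_block_triangular[OF assms] det_mul)

lemma block_det_transpose: "block_det J (transpose A) = block_det J A"
  by (simp add: block_det_def pad_transpose det_transpose)

lemma block_det_congruence:
  assumes p: "\<And>i j. i \<notin> J \<Longrightarrow> j \<in> J \<Longrightarrow> p $ i $ j = 0"
  shows "block_det J (transpose (g ** p) ** (g ** p)) =
    (block_det J p)^2 * block_det J (transpose g ** g)"
proof -
  have "transpose (g ** p) ** (g ** p) = (transpose p ** (transpose g ** g)) ** p"
    by (simp add: matrix_transpose_mul matrix_mul_assoc)
  then have "block_det J (transpose (g ** p) ** (g ** p)) =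
      block_det J (transpose p ** (transpose g ** g)) * block_det J p"
    using block_det_mult_block_triangular[of J p, OF p] by metis
  also have "block_det J (transpose p ** (transpose g ** g)) =
      block_det J (transpose (transpose p ** (transpose g ** g)))"
    by (simp only: block_det_transpose)
  also have "transpose (transpose p ** (transpose g ** g)) = (transpose g ** g) ** p"
    by (simp add: matrix_transpose_mul)
  also have "block_det J \<dots> = block_det J (transpose g ** g) * block_det J p"
    by (rule block_det_mult_block_triangular[OF p])
  finally show ?thesis by (simp add: power2_eq_square)
qed

text \<open>Conjugation by the diagonal matrix with entries \<open>2\<close> on \<open>J\<close> and \<open>1\<close> elsewhere doubles \<open>N\<close>. As
  \<open>N ** N = 0\<close>, this says that \<open>1 + N\<close> and its square have the same determinant.\<close>

lemma det_block_unipotent: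
  fixes N :: "'k::finite sqmat"
  assumes N: "\<And>i j. \<not> (i \<in> J \<and> j \<notin> J) \<Longrightarrow> N $ i $ j = 0"
  shows "det (mat 1 + N) = 1"
proof -
  have NN: "N ** N = 0"
  proof -
    have "N $ i $ k * N $ k $ j = 0" for i j k using N[of i k] N[of k j] by (cases "k \<in> J") auto
    then have "(\<Sum>k\<in>UNIV. N $ i $ k * N $ k $ j) = 0" for i j by (intro sum.neutral) blast
    then show ?thesis by (simp add: vec_eq_iff matrix_matrix_mult_def)
  qed
  define D :: "'k sqmat" where "D = (\<chi> i j. if i = j then if i \<in> J then 2 else 1 else 0)"
  have DN: "(D ** N) $ i $ j = 2 * N $ i $ j" and ND: "(N ** D) $ i $ j = N $ i $ j" for i j
  proof -
    have "(D ** N) $ i $ j = (if i \<in> J then 2 else 1) * N $ i $ j"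
      by (simp add: D_def matrix_matrix_mult_def if_distrib[of "\<lambda>x. x * _"] cong: if_cong)
    then show "(D ** N) $ i $ j = 2 * N $ i $ j" using N[of i j] by auto
    have "(N ** D) $ i $ j = N $ i $ j * (if j \<in> J then 2 else 1)"
      by (simp add: D_def matrix_matrix_mult_def if_distrib[of "\<lambda>x. _ * x"] cong: if_cong)
    then show "(N ** D) $ i $ j = N $ i $ j" using N[of i j] by auto
  qed
  have "D ** N = N ** D + N ** D" by (simp add: vec_eq_iff DN ND)
  then have conj: "D ** (mat 1 + N) = (mat 1 + N + N) ** D"
    by (simp only: matrix_add_ldistrib matrix_add_rdistrib matrix_mul_lid matrix_mul_rid add.assoc)
  have "det D \<noteq> 0" by (subst det_diagonal) (auto simp: D_def)
  with arg_cong[OF conj, of det] have 1: "det (mat 1 + N) = det (mat 1 + N + N)"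
    by (simp add: det_mul)
  have sq: "(mat 1 + N) ** (mat 1 + N) = mat 1 + N + N"
    by (simp add: matrix_add_ldistrib matrix_add_rdistrib NN)
  have "(mat 1 + N) ** (mat 1 + (- 1) *\<^sub>R N) = mat 1"
  proof -
    have "N ** ((- 1) *\<^sub>R N) = (- 1) *\<^sub>R (N ** N)"
      by (simp add: vec_eq_iff matrix_matrix_mult_def sum_negf)
    then have "(mat 1 + N) ** (mat 1 + (- 1) *\<^sub>R N) = mat 1 + N + ((- 1) *\<^sub>R N + (- 1) *\<^sub>R 0)"
      by (simp only: matrix_add_ldistrib matrix_add_rdistrib matrix_mul_lid matrix_mul_rid NN)
    then show ?thesis by simp
  qed
  from arg_cong[OF this, of det] have "det (mat 1 + N) \<noteq> 0" by (auto simp: det_mul)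
  moreover have "det (mat 1 + N) * det (mat 1 + N) = det (mat 1 + N)"
    using arg_cong[OF sq, of det] 1 by (simp add: det_mul)
  ultimately show ?thesis by simp
qed

text \<open>A block triangular matrix is the product of its lower diagonal block, a unipotent matrix and its
  upper diagonal block.\<close>

lemma det_block_triangular:
  fixes A :: "'k::finite sqmat"
  assumes A: "\<And>i j. i \<notin> J \<Longrightarrow> j \<in> J \<Longrightarrow> A $ i $ j = 0"
  shows "det A = block_det J A * block_det (- J) A"
proof -
  define N :: "'k sqmat" where "N = (\<chi> i j. if i \<in> J \<and> j \<notin> J then A $ i $ j else 0)"
  define X where "X = pad (- J) A ** (mat 1 + N)"
  have X: "X $ i $ j = (if i \<in> J then (if i = j then 1 else N $ i $ j) else if j \<notin> J then A $ i $ j else 0)" for i j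
  proof (cases "i \<in> J")
    case True
    then show ?thesis
      unfolding X_def by (subst matrix_mult_row_unit) (auto simp: pad_nth mat_def N_def)
  next
    case False
    have "pad (- J) A $ i $ k * (mat 1 + N) $ k $ j = (if k = j then pad (- J) A $ i $ k else 0)" for k
      using False by (auto simp: pad_nth N_def mat_def)
    then have "X $ i $ j = pad (- J) A $ i $ j"
      by (simp add: X_def matrix_matrix_mult_def)
    then show ?thesis using False by (auto simp: pad_nth)
  qed
  have "(X ** pad J A) $ i $ j = A $ i $ j" for i j
  proof (cases "j \<in> J")
    case False
    then show ?thesis
      by (subst matrix_mult_column_unit) (auto simp: pad_nth X N_def)
  next
    case True
    have "X $ i $ k * pad J A $ k $ j = (if k = i then (if i \<in> J then A $ i $ j else 0) else 0)" for k
      using True by (auto simp: pad_nth X N_def)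
    then show ?thesis using True A[of i j] by (simp add: matrix_matrix_mult_def)
  qed
  then have "A = X ** pad J A" by (simp add: vec_eq_iff)
  then have "det A = det X * block_det J A" unfolding block_det_def by (metis det_mul)
  moreover have "det X = block_det (- J) A"
    unfolding X_def det_mul block_det_def
    by (subst det_block_unipotent[of J N]) (auto simp: N_def)
  ultimately show ?thesis by simp
qed

lemma block_det_singleton: "block_det {i} A = A $ i $ i"
proof -
  have "block_det {i} A = (\<Prod>j\<in>UNIV. pad {i} A $ j $ j)"
    unfolding block_det_def by (rule det_diagonal) (auto simp: pad_nth)
  also have "\<dots> = (\<Prod>j\<in>UNIV. if j = i then A $ i $ i else 1)"
    by (rule prod.cong) (auto simp: pad_nth)
  finally show ?thesis by simp
qed

section \<open>Gram determinants and adapted orthonormal bases\<close>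

text \<open>A vector \<open>x\<close> annihilated by the padded block is supported on \<open>J\<close> and satisfies
  \<open>\<parallel>g x\<parallel>\<^sup>2 = x \<bullet> g\<^sup>T g x = 0\<close>.\<close>

lemma block_det_gram_nonzero:
  fixes g :: "'k::finite sqmat"
  assumes "invertible g"
  shows "block_det J (transpose g ** g) \<noteq> 0"
proof -
  have "x = 0" if x: "pad J (transpose g ** g) *v x = 0" for x
  proof -
    let ?M = "transpose g ** g"
    have off: "x $ i = 0" if "i \<notin> J" for i
    proof -
      have "(pad J ?M *v x) $ i = (\<Sum>k\<in>UNIV. if i = k then x $ k else 0)"
        unfolding matrix_vector_mult_def vec_lambda_beta
        by (rule sum.cong) (use that in \<open>auto simp: pad_nth\<close>)
      then show ?thesis using x by simp
    qed
    have on: "(?M *v x) $ i = 0" if "i \<in> J" for i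
    proof -
      have "(?M *v x) $ i = (pad J ?M *v x) $ i"
        unfolding matrix_vector_mult_def vec_lambda_beta
        by (rule sum.cong) (use that off in \<open>auto simp: pad_nth\<close>)
      then show ?thesis using x by simp
    qed
    have "x \<bullet> (?M *v x) = 0"
      unfolding inner_vec_def using on off by (intro sum.neutral) (metis inner_zero_left inner_zero_right)
    moreover have "x \<bullet> (?M *v x) = (g *v x) \<bullet> (g *v x)"
      by (simp add: matrix_vector_mul_assoc[symmetric] dot_lmul_matrix inner_commute[of x])
    ultimately have "g *v x = 0" by simp
    then show "x = 0"
      using inj_matrix_vector_mult[OF assms] by (metis injD matrix_vector_mult_0_right)
  qed
  then have "invertible (pad J (transpose g ** g))"
    unfolding invertible_left_inverse matrix_left_invertible_ker by blast
  then show ?thesis by (simp add: block_det_def invertible_det_nz)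
qed

text \<open>The columns of \<open>g p\<close> are an orthonormal basis of the image under \<open>g\<close> of the coordinate subspace of
  \<open>J\<close>, followed by an orthonormal basis of its orthogonal complement.\<close>

lemma exists_orthogonal_basis_adapted:
  fixes g :: "'k::finite sqmat"
  assumes g: "invertible g"
  obtains p where "invertible p" "\<And>i j. i \<notin> J \<Longrightarrow> j \<in> J \<Longrightarrow> p $ i $ j = 0" "orthogonal_matrix (g ** p)"
proof -
  define E where "E = {x :: real^'k. \<forall>i. i \<notin> J \<longrightarrow> x $ i = 0}"
  define S where "S = (*v) g ` E"
  define T where "T = {y. \<forall>x\<in>S. orthogonal x y}"
  have subE: "subspace E" by (auto simp: E_def subspace_def)
  have subS: "subspace S" unfolding S_def by (rule linear_subspace_image[OF matrix_vector_mul_linear subE])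
  have subT: "subspace T" unfolding T_def by (rule subspace_orthogonal_to_vectors)
  have "dim S = dim E"
    unfolding S_def by (rule dim_image_eq[OF matrix_vector_mul_linear])
      (use inj_matrix_vector_mult[OF g] in \<open>auto intro: inj_on_subset\<close>)
  also have "dim E = card J"
    using dim_substandard_cart[of J, where ?'a = real] unfolding E_def dim_vec_eq .
  finally have dS: "dim S = card J" .
  have "dim T + dim S = DIM(real^'k)"
    using dim_subspace_orthogonal_to_vectors[OF subS subspace_UNIV] by (simp add: T_def)
  then have dT: "dim T = card (- J)"
    using dS by (simp add: Compl_eq_Diff_UNIV card_Diff_subset)
  obtain B where B: "B \<subseteq> S" "pairwise orthogonal B" "\<And>x. x \<in> B \<Longrightarrow> norm x = 1" "independent B" "card B = dim S"
    using orthonormal_basis_subspace[OF subS] by metis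
  obtain C where C: "C \<subseteq> T" "pairwise orthogonal C" "\<And>x. x \<in> C \<Longrightarrow> norm x = 1" "independent C" "card C = dim T"
    using orthonormal_basis_subspace[OF subT] by metis
  have finB: "finite B" and finC: "finite C"
    using B(4) C(4) independent_imp_finite by auto
  obtain b where b: "bij_betw b J B"
    using finite_same_card_bij[of J B] finB B(5) dS by auto
  obtain c where c: "bij_betw c (- J) C"
    using finite_same_card_bij[of "- J" C] finC C(5) dT by auto
  define f where "f i = (if i \<in> J then b i else c i)" for i
  define k :: "'k sqmat" where "k = (\<chi> i j. f j $ i)"
  have col: "column j k = f j" for j by (simp add: column_def k_def vec_eq_iff)
  have fJ: "f i \<in> B" if "i \<in> J" for i using b that by (auto simp: f_def bij_betw_def)
  have fC: "f i \<in> C" if "i \<notin> J" for i using c that by (auto simp: f_def bij_betw_def)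
  have BC: "orthogonal x y" if "x \<in> B" "y \<in> C" for x y using that B(1) C(1) by (auto simp: T_def)
  have k: "orthogonal_matrix k"
    unfolding orthogonal_matrix_orthonormal_columns col
  proof (intro conjI allI impI)
    fix i show "norm (f i) = 1" using fJ[of i] fC[of i] B(3) C(3) by (cases "i \<in> J") auto
  next
    fix i j :: 'k assume ij: "i \<noteq> j"
    consider "i \<in> J" "j \<in> J" | "i \<in> J" "j \<notin> J" | "i \<notin> J" "j \<in> J" | "i \<notin> J" "j \<notin> J" by blast
    then show "orthogonal (f i) (f j)"
    proof cases
      case 1
      then have "f i \<noteq> f j" using b ij by (auto simp: f_def bij_betw_def inj_on_def)
      then show ?thesis using B(2) fJ 1 by (auto simp: pairwise_def)
    next
      case 2 then show ?thesis using BC fJ fC by blast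
    next
      case 3 then show ?thesis using BC fJ fC orthogonal_commute by blast
    next
      case 4
      then have "f i \<noteq> f j" using c ij by (auto simp: f_def bij_betw_def inj_on_def)
      then show ?thesis using C(2) fC 4 by (auto simp: pairwise_def)
    qed
  qed
  define p where "p = matrix_inv g ** k"
  have gp: "g ** p = k"
    by (simp add: p_def matrix_mul_assoc matrix_inv_cancel[OF g])
  have "invertible k" using k unfolding orthogonal_matrix_def invertible_def by blast
  moreover have "invertible (matrix_inv g)" using matrix_inv_cancel[OF g] unfolding invertible_def by blast
  ultimately have "invertible p" unfolding p_def by (intro invertible_mult)
  moreover have "p $ i $ j = 0" if i: "i \<notin> J" and j: "j \<in> J" for i j
  proof -
    have "f j \<in> S" using fJ[OF j] B(1) by auto
    then obtain x where x: "x \<in> E" "f j = g *v x" by (auto simp: S_def)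
    have "column j p = matrix_inv g *v f j"
      by (simp add: p_def column_def k_def vec_eq_iff matrix_matrix_mult_def matrix_vector_mult_def)
    also have "\<dots> = x" by (simp add: x matrix_vector_mul_assoc matrix_inv_cancel[OF g])
    finally have "p $ i $ j = x $ i" by (simp add: column_def vec_eq_iff)
    then show ?thesis using x(1) i by (simp add: E_def)
  qed
  moreover have "orthogonal_matrix (g ** p)" by (simp add: gp k)
  ultimately show ?thesis using that by blast
qed

section \<open>The parabolic subgroup of G\<close>

lemma elem_mat_mult_left: "(elem_mat a b ** X) $ i $ j = (if i = a then X $ b $ j else 0)"
  by (simp add: matrix_matrix_mult_def elem_mat_def if_distrib[of "\<lambda>x. x * _"] cong: if_cong)

lemma elem_mat_mult_right: "(X ** elem_mat a b) $ i $ j = (if j = b then X $ i $ a else 0)"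
  by (simp add: matrix_matrix_mult_def elem_mat_def if_distrib[of "\<lambda>x. _ * x"] cong: if_cong)

lemma ix_neq [simp]: "ix_n \<noteq> ix_2n" "ix_2n \<noteq> ix_n"
  by (simp_all add: ix_n_def ix_2n_def)

lemma ix_n_range: "ix_n \<in> range Inl" "ix_2n \<notin> range Inl" "ix_n \<notin> range Inr" "ix_2n \<in> range Inr"
  by (auto simp: ix_n_def ix_2n_def)

lemma Compl_range_Inl: "- range Inl = range Inr"
proof (rule set_eqI)
  fix x :: "'a + 'b" show "x \<in> - range Inl \<longleftrightarrow> x \<in> range Inr" by (cases x) auto
qed

lemma parab_G_block_triangular:
  assumes "p \<in> parab_G" "i \<notin> range Inl" "j \<in> range Inl" shows "p $ i $ j = 0"
proof -
  have "i \<in> range Inr" using assms(2) Compl_range_Inl by blast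
  then show ?thesis using assms(1,3) by (auto simp: parab_G_def)
qed

lemma parab_G_det:
  assumes "p \<in> parab_G"
  shows "det p = block_det (range Inl) p * block_det (range Inr) p"
    and "block_det (range Inl) p \<noteq> 0" "block_det (range Inr) p \<noteq> 0"
proof -
  show 1: "det p = block_det (range Inl) p * block_det (range Inr) p"
    using det_block_triangular[of "range Inl" p] parab_G_block_triangular[OF assms]
    by (simp add: Compl_range_Inl)
  have "det p \<noteq> 0" using assms by (simp add: parab_G_def GL_UNIV invertible_det_nz)
  then show "block_det (range Inl) p \<noteq> 0" "block_det (range Inr) p \<noteq> 0" using 1 by auto
qed

lemma sgn_powr_add:
  assumes "x \<noteq> 0"
  shows "sgn_powr \<epsilon> (\<mu> + c) x = sgn_powr \<epsilon> \<mu> x * exp (c * of_real (ln \<bar>x\<bar>))"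
proof -
  have "of_real \<bar>x\<bar> powr (\<mu> + c) = of_real \<bar>x\<bar> powr \<mu> * exp (c * complex_of_real (ln \<bar>x\<bar>))"
    using assms by (simp add: powr_def exp_add distrib_right Ln_of_real)
  then show ?thesis by (simp add: sgn_powr_def)
qed

section \<open>Flat sections\<close>

text \<open>The logarithm of the \<open>n\<close>-dimensional volume spanned by the first \<open>n\<close> columns, that is, half of the
  logarithm of their Gram determinant. The square under the logarithm makes the argument positive
  as soon as the Gram determinant is nonzero.\<close>

definition log_vol1 :: "('n::{finite,linorder} + 'n) sqmat \<Rightarrow> real" where
  "log_vol1 g = ln ((block_det (range Inl) (transpose g ** g))\<^sup>2) / 4"

text \<open>The logarithm of the volume spanned by the last \<open>n\<close> columns modulo the first \<open>n\<close> columns.\<close>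

definition log_vol2 :: "('n::{finite,linorder} + 'n) sqmat \<Rightarrow> real" where
  "log_vol2 g = ln ((det g)\<^sup>2) / 2 - log_vol1 g"

text \<open>The flat section through the constant function \<open>1\<close> on the orthogonal group, with the shift by
  \<open>n/2\<close> and the sign characters removed.\<close>

definition twist :: "complex \<Rightarrow> complex \<Rightarrow> ('n::{finite,linorder} + 'n) sqmat \<Rightarrow> complex" where
  "twist a b g = exp (- (a * of_real (log_vol1 g) + b * of_real (log_vol2 g)))"

lemma twist_0 [simp]: "twist 0 0 g = 1"
  by (simp add: twist_def)

text \<open>Right multiplication by \<open>p\<close> multiplies the Gram determinant by the square of the determinant of the
  first diagonal block.\<close>

lemma log_vol_mult:
  assumes g: "g \<in> grp_G" and p: "p \<in> parab_G"
  shows "log_vol1 (g ** p) = log_vol1 g + ln \<bar>block_det (range Inl) p\<bar>"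
    and "log_vol2 (g ** p) = log_vol2 g + ln \<bar>block_det (range Inr) p\<bar>"
proof -
  let ?d1 = "block_det (range Inl) p" and ?d2 = "block_det (range Inr) p"
  let ?Q = "block_det (range Inl) (transpose g ** g)"
  have inv: "invertible g" using g by (simp add: GL_UNIV)
  have Q: "?Q \<noteq> 0" by (rule block_det_gram_nonzero[OF inv])
  have dg: "det g \<noteq> 0" using inv by (simp add: invertible_det_nz)
  note d = parab_G_det[OF p]
  have sq: "ln (x\<^sup>2) = 2 * ln \<bar>x\<bar>" if "x \<noteq> 0" for x :: real
    using ln_realpow[of "\<bar>x\<bar>" 2] that by simp
  have C: "block_det (range Inl) (transpose (g ** p) ** (g ** p)) = ?d1\<^sup>2 * ?Q"
    by (rule block_det_congruence[OF parab_G_block_triangular[OF p]])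
  have "ln ((?d1\<^sup>2 * ?Q)\<^sup>2) = 2 * ln \<bar>?d1\<^sup>2 * ?Q\<bar>" by (rule sq) (use d Q in simp)
  also have "\<dots> = 2 * (2 * ln \<bar>?d1\<bar> + ln \<bar>?Q\<bar>)"
    using d Q ln_mult[of "?d1\<^sup>2" "\<bar>?Q\<bar>"] sq[OF d(2)] by (simp add: abs_mult)
  finally show 1: "log_vol1 (g ** p) = log_vol1 g + ln \<bar>?d1\<bar>"
    unfolding log_vol1_def C using sq[OF Q] by simp
  have "ln ((det (g ** p))\<^sup>2) = 2 * ln \<bar>det g * (?d1 * ?d2)\<bar>"
    unfolding det_mul d(1) by (rule sq) (use d dg in simp)
  also have "\<dots> = 2 * (ln \<bar>det g\<bar> + (ln \<bar>?d1\<bar> + ln \<bar>?d2\<bar>))"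
    using d dg by (simp add: abs_mult ln_mult)
  finally show "log_vol2 (g ** p) = log_vol2 g + ln \<bar>?d2\<bar>"
    unfolding log_vol2_def 1 using sq[OF dg] by (simp add: field_simps)
qed

lemma log_vol_Orth:
  assumes "g \<in> Orth UNIV" shows "log_vol1 g = 0" "log_vol2 g = 0"
proof -
  have o: "orthogonal_matrix g" using assms by (simp add: Orth_def)
  then have "transpose g ** g = mat 1" by (simp add: orthogonal_matrix_def)
  then show 1: "log_vol1 g = 0" by (simp add: log_vol1_def block_det_def)
  have "(det g)\<^sup>2 = 1" using det_orthogonal_matrix[OF o] by auto
  then show "log_vol2 g = 0" by (simp add: log_vol2_def 1)
qed

lemma twist_mult:
  assumes "g \<in> grp_G" "p \<in> parab_G"
  shows "twist a b (g ** p) = twist a b g *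
    (exp ((- a) * of_real (ln \<bar>block_det (range Inl) p\<bar>)) * exp ((- b) * of_real (ln \<bar>block_det (range Inr) p\<bar>)))"
  unfolding twist_def log_vol_mult[OF assms] of_real_add exp_add[symmetric]
  by (rule arg_cong[of _ _ exp]) (simp add: algebra_simps)

text \<open>The Iwasawa decomposition, with the parabolic subgroup in place of a minimal one.\<close>

lemma iwasawa:
  assumes "g \<in> (grp_G :: ('n::{finite,linorder} + 'n) sqmat set)"
  obtains p where "p \<in> parab_G" "g ** p \<in> Orth UNIV"
proof -
  have "invertible g" using assms by (simp add: GL_UNIV)
  from exists_orthogonal_basis_adapted[OF this, of "range Inl"] obtain p where
    p: "invertible p" "\<And>i j. i \<notin> range Inl \<Longrightarrow> j \<in> range Inl \<Longrightarrow> p $ i $ j = 0" "orthogonal_matrix (g ** p)"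
    by blast
  have "p \<in> parab_G" using p(1,2) by (auto simp: parab_G_def GL_UNIV)
  moreover have "g ** p \<in> Orth UNIV"
    using p(3) invertible_mult[OF \<open>invertible g\<close> p(1)] by (simp add: Orth_def GL_UNIV)
  ultimately show ?thesis by (rule that)
qed

lemma rep_pi_mult:
  assumes "f \<in> rep_pi (\<xi>1, \<xi>2) (l1, l2)" "g \<in> grp_G" "p \<in> parab_G"
  shows "f ((g :: ('n::{finite,linorder} + 'n) sqmat) ** p) =
       sgn_powr \<xi>1 (- l1 - of_nat CARD('n) / 2) (block_det (range Inl) p) *
       sgn_powr \<xi>2 (- l2 + of_nat CARD('n) / 2) (block_det (range Inr) p) * f g"
  using assms by (simp add: rep_pi_def)

lemma rep_pi_smooth: "f \<in> rep_pi \<xi> l \<Longrightarrow> f \<in> smooth_GL UNIV"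
  by (cases \<xi>; cases l) (simp add: rep_pi_def)

lemma rep_pi_zero: "f \<in> rep_pi \<xi> l \<Longrightarrow> g \<notin> grp_G \<Longrightarrow> f g = 0"
  using rep_pi_smooth by (fastforce simp: smooth_GL_def)

text \<open>Both sides transform in the same way under the parabolic subgroup and agree on the orthogonal group.\<close>

lemma flat_section_eq:
  fixes F :: "complex \<times> complex \<Rightarrow> ('n::{finite,linorder} + 'n) sqmat \<Rightarrow> complex"
  assumes F: "flat_section \<xi> F"
  shows "F (l1, l2) = (\<lambda>g. F (0, 0) g * twist l1 l2 g)"
proof
  fix g :: "('n + 'n) sqmat"
  obtain \<xi>1 \<xi>2 where \<xi>: "\<xi> = (\<xi>1, \<xi>2)" by force
  have "\<forall>l. F l \<in> rep_pi \<xi> l" using F unfolding flat_section_def by (rule conjunct1)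
  then have Fl: "F l \<in> rep_pi (\<xi>1, \<xi>2) l" for l unfolding \<xi> by blast
  show "F (l1, l2) g = F (0, 0) g * twist l1 l2 g"
  proof (cases "g \<in> grp_G")
    case False then show ?thesis using rep_pi_zero[OF Fl False] by simp
  next
    case True
    obtain p where p: "p \<in> parab_G" "g ** p \<in> Orth UNIV" by (rule iwasawa[OF True])
    let ?d1 = "block_det (range Inl) p" and ?d2 = "block_det (range Inr) p"
    note d = parab_G_det(2,3)[OF p(1)]
    have "\<forall>l l'. restrict_Orth UNIV (F l) = restrict_Orth UNIV (F l')"
      using F unfolding flat_section_def by (rule conjunct2)
    then have "restrict_Orth UNIV (F (l1, l2)) = restrict_Orth UNIV (F (0, 0))" by blast
    from fun_cong[OF this, of "g ** p"] have eq: "F (l1, l2) (g ** p) = F (0, 0) (g ** p)" using p(2) by (simp add: restrict_Orth_def)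
    let ?n = "of_nat CARD('n) / 2 :: complex"
    let ?c = "sgn_powr \<xi>1 (- 0 - ?n) ?d1 * sgn_powr \<xi>2 (- 0 + ?n) ?d2"
    let ?e = "exp ((- l1) * of_real (ln \<bar>?d1\<bar>)) * exp ((- l2) * of_real (ln \<bar>?d2\<bar>))"
    have 1: "sgn_powr \<xi>1 (- l1 - ?n) ?d1 * sgn_powr \<xi>2 (- l2 + ?n) ?d2 = ?c * ?e"
      using sgn_powr_add[OF d(1), of \<xi>1 "- 0 - ?n" "- l1"] sgn_powr_add[OF d(2), of \<xi>2 "- 0 + ?n" "- l2"]
      by (simp add: algebra_simps)
    \<comment> \<open>The common factor of the two transformation laws; it can be cancelled.\<close>
    have c0: "?c \<noteq> 0" using d by (simp add: sgn_powr_def sgn_zero_iff sgn_eq_0_iff)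
    have "?c * ?e * F (l1, l2) g = ?c * F (0, 0) g"
      using eq unfolding rep_pi_mult[OF Fl True p(1)] 1 .
    then have 2: "F (0, 0) g = ?e * F (l1, l2) g" using c0 by (simp add: mult.assoc)
    have "twist l1 l2 (g ** p) = 1"
      using log_vol_Orth[OF p(2)] by (simp add: twist_def)
    then have 3: "twist l1 l2 g * ?e = 1" unfolding twist_mult[OF True p(1)] .
    have "F (0, 0) g * twist l1 l2 g = F (l1, l2) g * (twist l1 l2 g * ?e)"
      unfolding 2 by (simp only: mult_ac)
    then show ?thesis unfolding 3 by simp
  qed
qed

section \<open>Smoothness of the twist\<close>

lemma smooth_family_det:
  fixes F :: "'a::euclidean_space \<Rightarrow> 'k::finite sqmat"
  assumes S: "open S" and F: "\<And>i j. smooth_family Y S (\<lambda>y p. complex_of_real (F p $ i $ j))"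
  shows "smooth_family Y S (\<lambda>y p. complex_of_real (det (F p)))"
proof -
  have "smooth_family Y S (\<lambda>y p. \<Sum>q\<in>{q. q permutes (UNIV :: 'k set)}.
      complex_of_real (of_int (sign q)) * (\<Prod>i\<in>UNIV. complex_of_real (F p $ i $ q i)))"
    by (intro smooth_family_sum[OF S] smooth_family_mult[OF S] smooth_family_const[OF S]
        smooth_family_prod[OF S] F)
  then show ?thesis by (simp add: det_def)
qed

text \<open>As \<open>q p\<close> is real and nonzero, its square lies in the right half plane, where the complex logarithm is
  holomorphic.\<close>

lemma smooth_family_ln_square:
  fixes q :: "'a::euclidean_space \<Rightarrow> real"
  assumes S: "open S" and q: "smooth_family Y S (\<lambda>y p. complex_of_real (q p))" and nz: "\<And>p. p \<in> S \<Longrightarrow> q p \<noteq> 0"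
  shows "smooth_family Y S (\<lambda>y p. complex_of_real (ln ((q p)\<^sup>2)))"
proof -
  have Ln: "Ln holomorphic_on {z. Re z > 0}"
    by (intro holomorphic_on_Ln) (auto simp: complex_nonpos_Reals_iff)
  have "smooth_family Y S (\<lambda>y p. complex_of_real (q p) * complex_of_real (q p))"
    by (rule smooth_family_mult[OF S q q])
  then have "smooth_family Y S (\<lambda>y p. Ln (complex_of_real (q p) * complex_of_real (q p)))"
  proof (rule smooth_family_holomorphic[OF open_halfspace_Re_gt Ln S])
    fix y p assume "p \<in> S"
    then have "q p * q p > 0" using nz[of p] by (metis not_real_square_gt_zero)
    then show "complex_of_real (q p) * complex_of_real (q p) \<in> {z. 0 < Re z}" by simp
  qed
  then show ?thesis
  proof (rule smooth_family_cong[OF S])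
    fix y p assume "p \<in> S"
    then have "q p * q p > 0" using nz[of p] by (metis not_real_square_gt_zero)
    then show "Ln (complex_of_real (q p) * complex_of_real (q p)) = complex_of_real (ln ((q p)\<^sup>2))"
      by (simp add: power2_eq_square Ln_of_real flip: of_real_mult)
  qed
qed

lemma smooth_family_entry:
  assumes "open S"
  shows "smooth_family Y S (\<lambda>y (g :: 'k::finite sqmat). complex_of_real (g $ i $ j))"
  by (rule smooth_family_linear[OF assms bounded_linear_compose[OF bounded_linear_of_real
        bounded_linear_compose[OF bounded_linear_vec_nth bounded_linear_vec_nth]]])

lemma smooth_family_log_vol1:
  "smooth_family Y grp_G (\<lambda>y (g :: ('n::{finite,linorder} + 'n) sqmat). complex_of_real (log_vol1 g))"
proof -
  note S = open_GL_UNIV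
  let ?M = "\<lambda>g :: ('n + 'n) sqmat. pad (range Inl) (transpose g ** g)"
  have "smooth_family Y grp_G (\<lambda>y (g :: ('n + 'n) sqmat). complex_of_real (?M g $ i $ j))" for i j
  proof (cases "i \<in> range Inl \<and> j \<in> range Inl")
    case True
    have "smooth_family Y grp_G (\<lambda>y (g :: ('n + 'n) sqmat).
        \<Sum>k\<in>UNIV. complex_of_real (g $ k $ i) * complex_of_real (g $ k $ j))"
      by (intro smooth_family_sum[OF S] smooth_family_mult[OF S] smooth_family_entry[OF S])
    then show ?thesis using True by (simp add: pad_nth matrix_matrix_mult_def transpose_def)
  next
    case False
    then have "(\<lambda>g :: ('n + 'n) sqmat. ?M g $ i $ j) = (\<lambda>g. if i = j then 1 else 0)"
      by (auto simp: pad_nth)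
    then show ?thesis by (simp add: smooth_family_const[OF S] fun_eq_iff)
  qed
  from smooth_family_det[OF S this]
  have "smooth_family Y grp_G (\<lambda>y (g :: ('n + 'n) sqmat). complex_of_real (block_det (range Inl) (transpose g ** g)))"
    unfolding block_det_def .
  from smooth_family_ln_square[OF S this]
  have "smooth_family Y grp_G (\<lambda>y (g :: ('n + 'n) sqmat). complex_of_real (ln ((block_det (range Inl) (transpose g ** g))\<^sup>2)))"
    by (simp add: block_det_gram_nonzero GL_UNIV)
  from smooth_family_mult[OF S this smooth_family_const[OF S, of _ "1/4"]]
  show ?thesis by (simp add: log_vol1_def)
qed

lemma smooth_family_log_vol2:
  "smooth_family Y grp_G (\<lambda>y (g :: ('n::{finite,linorder} + 'n) sqmat). complex_of_real (log_vol2 g))"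
proof -
  note S = open_GL_UNIV
  have "smooth_family Y grp_G (\<lambda>y (g :: ('n + 'n) sqmat). complex_of_real (ln ((det g)\<^sup>2)))"
    by (rule smooth_family_ln_square[OF S smooth_family_det[OF S smooth_family_entry[OF S]]])
       (simp add: GL_UNIV invertible_det_nz)
  from smooth_family_add[OF S smooth_family_mult[OF S this smooth_family_const[OF S, of _ "1/2"]]
      smooth_family_mult[OF S smooth_family_log_vol1 smooth_family_const[OF S, of _ "-1"]]]
  show ?thesis by (simp add: log_vol2_def)
qed

lemma smooth_family_twisted:
  "smooth_family (smooth_GL_topology UNIV) (UNIV \<times> grp_G)
    (\<lambda>f (x :: (complex \<times> complex) \<times> ('n::{finite,linorder} + 'n) sqmat).
      f (snd x) * twist (fst (fst x)) (snd (fst x)) (snd x))"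
proof -
  let ?S = "(UNIV :: (complex \<times> complex) set) \<times> (grp_G :: ('n + 'n) sqmat set)"
  let ?Y = "smooth_GL_topology UNIV :: (('n + 'n) sqmat \<Rightarrow> complex) topology"
  have S: "open ?S" by (intro open_Times open_GL_UNIV open_UNIV)
  note id = continuous_map_id[unfolded id_def]
  have snd: "smooth_family ?Y ?S (\<lambda>f x. snd x)" by (rule smooth_family_linear[OF S bounded_linear_snd])
  have sub: "snd x \<in> grp_G" if "x \<in> ?S" for x using that by auto
  have ev: "smooth_family ?Y ?S (\<lambda>f x. f (snd x))"
    by (rule smooth_family_compose[OF open_GL_UNIV S smooth_family_evaluation snd id sub])
  have lv1: "smooth_family ?Y ?S (\<lambda>f x. complex_of_real (log_vol1 (snd x)))"
    by (rule smooth_family_compose[OF open_GL_UNIV S smooth_family_log_vol1 snd id sub])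
  have lv2: "smooth_family ?Y ?S (\<lambda>f x. complex_of_real (log_vol2 (snd x)))"
    by (rule smooth_family_compose[OF open_GL_UNIV S smooth_family_log_vol2 snd id sub])
  have a: "smooth_family ?Y ?S (\<lambda>f x. fst (fst x))"
    by (rule smooth_family_linear[OF S bounded_linear_compose[OF bounded_linear_fst bounded_linear_fst]])
  have b: "smooth_family ?Y ?S (\<lambda>f x. snd (fst x))"
    by (rule smooth_family_linear[OF S bounded_linear_compose[OF bounded_linear_snd bounded_linear_fst]])
  have "smooth_family ?Y ?S (\<lambda>f x. (-1) * (fst (fst x) * complex_of_real (log_vol1 (snd x)) +
      snd (fst x) * complex_of_real (log_vol2 (snd x))))"
    by (intro smooth_family_add[OF S] smooth_family_mult[OF S] smooth_family_const[OF S] a b lv1 lv2)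
  then have "smooth_family ?Y ?S (\<lambda>f x. exp ((-1) * (fst (fst x) * complex_of_real (log_vol1 (snd x)) +
      snd (fst x) * complex_of_real (log_vol2 (snd x)))))"
    by (rule smooth_family_holomorphic[OF open_UNIV holomorphic_on_exp S]) simp
  from smooth_family_mult[OF S ev this] show ?thesis by (simp add: twist_def)
qed

text \<open>Multiplication by the twist is the identification of the representation spaces for different
  parameters in the compact picture.\<close>

lemma twist_rep_pi:
  fixes f :: "('n::{finite,linorder} + 'n) sqmat \<Rightarrow> complex"
  assumes f: "f \<in> rep_pi (\<xi>1, \<xi>2) (l1, l2)"
  shows "(\<lambda>g. f g * twist a b g) \<in> rep_pi (\<xi>1, \<xi>2) (l1 + a, l2 + b)"
proof -
  have S: "open ((UNIV :: (complex \<times> complex) set) \<times> (grp_G :: ('n + 'n) sqmat set))"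
    by (intro open_Times open_GL_UNIV open_UNIV)
  note id = continuous_map_id[unfolded id_def]
  have "smooth_family (smooth_GL_topology UNIV) (grp_G :: ('n + 'n) sqmat set) (\<lambda>y g. ((a, b), g))"
    by (intro smooth_family_Pair[OF open_GL_UNIV smooth_family_const smooth_family_linear]
        open_GL_UNIV bounded_linear_ident)
  from smooth_family_compose[OF S open_GL_UNIV smooth_family_twisted this id]
  have "smooth_family (smooth_GL_topology UNIV) (grp_G :: ('n + 'n) sqmat set) (\<lambda>f g. f g * twist a b g)"
    by simp
  from restrict_GL_in_smooth_GL[OF this, of f UNIV]
  have "restrict_GL UNIV (\<lambda>g. f g * twist a b g) \<in> smooth_GL UNIV"
    using rep_pi_smooth[OF f] by (simp add: topspace_smooth_GL_topology)
  moreover have "restrict_GL UNIV (\<lambda>g. f g * twist a b g) = (\<lambda>g. f g * twist a b g)"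
    using rep_pi_zero[OF f] by (auto simp: restrict_GL_def)
  ultimately have sm: "(\<lambda>g. f g * twist a b g) \<in> smooth_GL UNIV" by simp
  have "f (g ** p) * twist a b (g ** p) =
      sgn_powr \<xi>1 (- (l1 + a) - of_nat CARD('n) / 2) (block_det (range Inl) p) *
      sgn_powr \<xi>2 (- (l2 + b) + of_nat CARD('n) / 2) (block_det (range Inr) p) * (f g * twist a b g)"
    if g: "g \<in> grp_G" and p: "p \<in> parab_G" for g p
  proof -
    note d = parab_G_det(2,3)[OF p]
    have e1: "- (l1 + a) - of_nat CARD('n) / 2 = (- l1 - of_nat CARD('n) / 2) + (- a)" by simp
    have e2: "- (l2 + b) + of_nat CARD('n) / 2 = (- l2 + of_nat CARD('n) / 2) + (- b)" by simp
    show ?thesis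
      unfolding rep_pi_mult[OF f g p] twist_mult[OF g p] e1 e2 sgn_powr_add[OF d(1)] sgn_powr_add[OF d(2)]
      by (simp only: mult_ac)
  qed
  with sm show ?thesis unfolding rep_pi_def prod.case mem_Collect_eq by blast
qed

section \<open>Two charts of a projective line\<close>

text \<open>The images of the curves \<open>chart0\<close> and \<open>chart1\<close> modulo the parabolic subgroup are the two standard
  affine charts of one projective line. All three matrices below differ from the identity only in
  the rows and columns \<open>n\<close> and \<open>2n\<close>, where they are \<open>(1, 0; t, 1)\<close>, \<open>(u, -1; 1, 0)\<close> and
  \<open>(t, 1; 0, 1/t)\<close>.\<close>

definition chart0 :: "real \<Rightarrow> ('n::{finite,linorder} + 'n) sqmat" where
  "chart0 t = mat 1 + t *\<^sub>R elem_mat ix_2n ix_n"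

definition chart1 :: "real \<Rightarrow> ('n::{finite,linorder} + 'n) sqmat" where
  "chart1 u = (mat 1 - elem_mat ix_n ix_n - elem_mat ix_2n ix_2n + elem_mat ix_2n ix_n - elem_mat ix_n ix_2n)
     + u *\<^sub>R elem_mat ix_n ix_n"

definition transition :: "real \<Rightarrow> ('n::{finite,linorder} + 'n) sqmat" where
  "transition t = mat 1 + (t - 1) *\<^sub>R elem_mat ix_n ix_n + elem_mat ix_n ix_2n +
     (1 / t - 1) *\<^sub>R elem_mat ix_2n ix_2n"

lemma matrix_diff_distrib:
  "(A :: 'k::finite sqmat) ** (B - C) = A ** B - A ** C" "(B - C) ** A = B ** A - C ** A"
  by (simp_all add: matrix_matrix_mult_def vec_eq_iff algebra_simps sum_subtractf)

lemma matrix_scaleR_mult: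
  "(A :: 'k::finite sqmat) ** (r *\<^sub>R B) = r *\<^sub>R (A ** B)" "(r *\<^sub>R A) ** B = r *\<^sub>R (A ** B)"
  by (simp_all add: matrix_matrix_mult_def vec_eq_iff sum_distrib_left algebra_simps)

lemmas matrix_expand = matrix_add_ldistrib matrix_add_rdistrib matrix_diff_distrib matrix_scaleR_mult

lemma chart0_mult: "chart0 s ** chart0 t = chart0 (s + t)"
  by (simp add: chart0_def matrix_expand vec_eq_iff elem_mat_mult_left)
     (auto simp: elem_mat_def algebra_simps)

lemma chart0_0: "chart0 0 = mat 1"
  by (simp add: chart0_def)

lemma chart0_invertible: "invertible (chart0 t)"
  unfolding invertible_left_inverse
  by (rule exI[of _ "chart0 (- t)"]) (simp add: chart0_mult chart0_0)

lemma chart_affine_invertible: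
  "invertible (mat 1 + t *\<^sub>R elem_mat ix_2n ix_n :: ('n::{finite,linorder} + 'n) sqmat)"
  using chart0_invertible[of t] by (simp add: chart0_def)

lemma chart1_invertible: "invertible (chart1 u :: ('n::{finite,linorder} + 'n) sqmat)"
proof -
  \<comment> \<open>In rows and columns \<open>n\<close> and \<open>2n\<close> the inverse of \<open>(u, -1; 1, 0)\<close> is \<open>(0, 1; -1, u)\<close>.\<close>
  let ?B = "mat 1 - elem_mat ix_n ix_n + (u - 1) *\<^sub>R elem_mat ix_2n ix_2n + elem_mat ix_n ix_2n
      - elem_mat ix_2n ix_n :: ('n + 'n) sqmat"
  have "?B ** chart1 u = mat 1"
    by (simp add: chart1_def matrix_expand vec_eq_iff elem_mat_mult_left)
       (auto simp: elem_mat_def mat_def algebra_simps)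
  then show ?thesis unfolding invertible_left_inverse by blast
qed

lemma chart_transition:
  assumes "t \<noteq> 0" shows "chart0 t = chart1 (1 / t) ** transition t"
  using assms
  by (simp add: chart0_def chart1_def transition_def matrix_expand vec_eq_iff elem_mat_mult_left)
     (auto simp: elem_mat_def mat_def field_simps)

lemma transition_parab_G:
  fixes t :: real
  assumes t: "t \<noteq> 0"
  defines "q \<equiv> transition t :: ('n::{finite,linorder} + 'n) sqmat"
  shows "q \<in> parab_G" "block_det (range Inl) q = t" "block_det (range Inr) q = 1 / t"
proof -
  have nth: "q $ i $ j = (if i = j then (if i = ix_n then t else if i = ix_2n then 1 / t else 1)
      else if i = ix_n \<and> j = ix_2n then 1 else 0)" for i j
    by (auto simp: q_def transition_def elem_mat_def mat_def)
  have "det (chart0 t :: ('n + 'n) sqmat) \<noteq> 0" using chart0_invertible invertible_det_nz by blast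
  then have "det q \<noteq> 0" unfolding chart_transition[OF t] det_mul q_def by simp
  then show "q \<in> parab_G"
    by (auto simp: parab_G_def GL_UNIV invertible_det_nz nth ix_n_def ix_2n_def)
  have "block_det (range Inl) q = (\<Prod>i\<in>UNIV. pad (range Inl) q $ i $ i)"
    unfolding block_det_def by (rule det_diagonal) (use ix_n_range in \<open>auto simp: pad_nth nth\<close>)
  also have "\<dots> = (\<Prod>i\<in>(UNIV :: ('n + 'n) set). if i = ix_n then t else 1)"
    by (rule prod.cong[OF refl]) (use ix_n_range in \<open>auto simp: pad_nth nth\<close>)
  finally show "block_det (range Inl) q = t" by simp
  have "block_det (range Inr) q = (\<Prod>i\<in>UNIV. pad (range Inr) q $ i $ i)"
    unfolding block_det_def by (rule det_diagonal) (use ix_n_range in \<open>auto simp: pad_nth nth\<close>)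
  also have "\<dots> = (\<Prod>i\<in>(UNIV :: ('n + 'n) set). if i = ix_2n then 1 / t else 1)"
    by (rule prod.cong[OF refl]) (use ix_n_range in \<open>auto simp: pad_nth nth\<close>)
  finally show "block_det (range Inr) q = 1 / t" by simp
qed

section \<open>The parabolic subgroup of H\<close>

lemma parab_H_entries:
  assumes "p \<in> parab_H"
  shows "p $ i $ ix_2n = (if i = ix_2n then 1 else 0)" "p $ ix_2n $ i = (if i = ix_2n then 1 else 0)"
  using assms by (auto simp: parab_H_def GL_def pad_eq_iff)

lemma parab_H_subset: "p \<in> parab_H \<Longrightarrow> p \<in> parab_G"
proof -
  assume p: "p \<in> parab_H"
  have "p $ Inr i $ Inl j = 0" for i j
  proof (cases "Inr i = (ix_2n :: 'a + 'a)")
    case True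
    then show ?thesis using parab_H_entries(2)[OF p, of "Inl j"] by (auto simp: ix_2n_def)
  next
    case False
    then have "Inr i \<in> blk3" "Inl j \<in> blk1 \<union> blk2" by (auto simp: blk1_def blk2_def blk3_def)
    then show ?thesis using p by (auto simp: parab_H_def)
  qed
  moreover have "p \<in> grp_G" using p GL_subset_UNIV by (auto simp: parab_H_def)
  ultimately show "p \<in> parab_G" by (simp add: parab_G_def)
qed

lemma parab_H_block_dets:
  fixes p :: "('n::{finite,linorder} + 'n) sqmat"
  assumes p: "p \<in> parab_H"
  shows "block_det (range Inl) p = block_det blk1 p * p $ ix_n $ ix_n"
    and "block_det blk2 p = p $ ix_n $ ix_n" and "p $ ix_n $ ix_n \<noteq> 0" and "block_det blk1 p \<noteq> 0"
proof -
  let ?P = "pad (range Inl) p"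
  have "?P $ i $ j = 0" if "i \<notin> blk1" "j \<in> blk1" for i j
  proof (cases "i = ix_n")
    case True
    then show ?thesis using p that by (auto simp: parab_H_def blk1_def blk2_def pad_nth)
  next
    case False
    then have "i \<notin> range Inl" using that by (auto simp: blk1_def)
    then show ?thesis using that by (auto simp: pad_nth)
  qed
  then have "det ?P = block_det blk1 ?P * block_det (- blk1) ?P" by (rule det_block_triangular)
  moreover have "blk1 \<inter> range Inl = (blk1 :: ('n + 'n) set)" by (auto simp: blk1_def)
  moreover have "- blk1 \<inter> range Inl = {ix_n :: 'n + 'n}" by (auto simp: blk1_def ix_n_def)
  ultimately show 1: "block_det (range Inl) p = block_det blk1 p * p $ ix_n $ ix_n"
    unfolding block_det_def pad_pad by (simp flip: block_det_def add: block_det_singleton)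
  show "block_det blk2 p = p $ ix_n $ ix_n" by (simp add: blk2_def block_det_singleton)
  have "block_det (range Inl) p \<noteq> 0" by (rule parab_G_det(2)[OF parab_H_subset[OF p]])
  then show "p $ ix_n $ ix_n \<noteq> 0" "block_det blk1 p \<noteq> 0" using 1 by auto
qed

text \<open>Modulo the parabolic subgroup of \<open>G\<close>, multiplication by \<open>p\<close> maps the curve \<open>chart0\<close> to itself and
  rescales its variable by the entry of \<open>p\<close> in the middle block. The reason is that \<open>q t\<close> differs from
  \<open>p\<close> only in row \<open>2n\<close>, where its entries in the columns \<open>1, \<dots>, n\<close> still vanish.\<close>

lemma parab_H_conjugate:
  fixes p :: "('n::{finite,linorder} + 'n) sqmat"
  assumes p: "p \<in> parab_H"
  defines "q \<equiv> \<lambda>t. chart0 (- t) ** p ** chart0 (p $ ix_n $ ix_n * t)"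
  shows "p ** chart0 (p $ ix_n $ ix_n * t) = chart0 t ** q t"
    and "q t \<in> parab_G"
    and "block_det (range Inl) (q t) = block_det (range Inl) p"
    and "block_det (range Inr) (q t) = block_det blk3 p"
proof -
  let ?c = "p $ ix_n $ ix_n"
  note ent = parab_H_entries[OF p]
  have pG: "p \<in> parab_G" by (rule parab_H_subset[OF p])
  show "p ** chart0 (?c * t) = chart0 t ** q t"
    by (simp add: q_def matrix_mul_assoc chart0_mult chart0_0)
  have nth: "q t $ i $ j = p $ i $ j +
      (if i = ix_2n then (if j = ix_n then ?c * t else 0) - t * p $ ix_n $ j else 0)" for i j
    by (simp add: q_def chart0_def matrix_expand elem_mat_mult_left elem_mat_mult_right ent)
  have "invertible p" using pG by (simp add: parab_G_def GL_UNIV)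
  then have "invertible (q t)"
    unfolding q_def by (intro invertible_mult chart0_invertible)
  moreover have "q t $ Inr i $ Inl j = 0" for i j
  proof (cases "Inr i = (ix_2n :: 'n + 'n)")
    case False
    then show ?thesis using pG by (simp add: nth parab_G_def)
  next
    case True
    have "p $ ix_n $ Inl j = 0" if "Inl j \<noteq> ix_n"
      using p that by (auto simp: parab_H_def blk1_def blk2_def)
    moreover have "p $ ix_2n $ Inl j = 0" using ent(2)[of "Inl j"] by (auto simp: ix_2n_def)
    ultimately show ?thesis unfolding nth True by (cases "Inl j = (ix_n :: 'n + 'n)") (auto simp: mult.commute)
  qed
  ultimately show "q t \<in> parab_G" by (simp add: parab_G_def GL_UNIV)
  have "pad (range Inl) (q t) = pad (range Inl) p"
    using ix_n_range by (auto simp: vec_eq_iff pad_nth nth)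
  then show "block_det (range Inl) (q t) = block_det (range Inl) p" by (simp add: block_det_def)
  let ?Q = "pad (range Inr) (q t)"
  have "?Q $ i $ j = 0" if "i \<notin> {ix_2n}" "j \<in> {ix_2n}" for i j
    using that by (auto simp: pad_nth nth ent)
  then have "det ?Q = block_det {ix_2n} ?Q * block_det (- {ix_2n}) ?Q" by (rule det_block_triangular)
  moreover have "block_det {ix_2n} ?Q = 1"
    using ix_n_range by (simp add: block_det_singleton pad_nth nth ent)
  moreover have "pad (- {ix_2n}) ?Q = pad blk3 p"
    unfolding pad_pad by (auto simp: vec_eq_iff pad_nth nth blk3_def)
  ultimately show "block_det (range Inr) (q t) = block_det blk3 p" by (simp add: block_det_def)
qed

section \<open>Mellin integrals over the real line\<close>

lemma sgn_powr_mult: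
  assumes "x \<noteq> 0" "y \<noteq> 0"
  shows "sgn_powr \<epsilon> \<mu> (x * y) = sgn_powr \<epsilon> \<mu> x * sgn_powr \<epsilon> \<mu> y"
proof -
  have "of_real \<bar>x * y\<bar> powr \<mu> = of_real \<bar>x\<bar> powr \<mu> * complex_of_real \<bar>y\<bar> powr \<mu>"
    unfolding abs_mult of_real_mult by (rule powr_times_real) auto
  then show ?thesis by (simp add: sgn_powr_def sgn_mult power_mult_distrib)
qed

lemma sgn_powr_inverse:
  assumes "x \<noteq> 0" shows "sgn_powr \<epsilon> \<mu> (1 / x) = sgn_powr \<epsilon> (- \<mu>) x"
proof -
  have "Ln (1 / complex_of_real \<bar>x\<bar>) = - of_real (ln \<bar>x\<bar>)"
    using assms Ln_of_real[of "1 / \<bar>x\<bar>"] by (simp add: ln_div)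
  then have "of_real \<bar>1 / x\<bar> powr \<mu> = complex_of_real \<bar>x\<bar> powr (- \<mu>)"
    using assms by (simp add: powr_def Ln_of_real)
  moreover have "sgn (1 / x) = sgn x" using assms by (simp add: sgn_if)
  ultimately show ?thesis by (simp add: sgn_powr_def)
qed

lemma sgn_powr_combine:
  assumes "x \<noteq> 0"
  shows "sgn_powr \<epsilon> \<mu> x * sgn_powr \<epsilon>' \<mu>' x = sgn_powr (\<epsilon> + \<epsilon>') (\<mu> + \<mu>') x"
proof -
  have "complex_of_real (sgn x) ^ of_bit \<epsilon> * of_real (sgn x) ^ of_bit \<epsilon>' = of_real (sgn x) ^ of_bit (\<epsilon> + \<epsilon>')"
    using assms by (cases "\<epsilon> = 0"; cases "\<epsilon>' = 0") (auto simp: sgn_if)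
  moreover have "of_real \<bar>x\<bar> powr \<mu> * of_real \<bar>x\<bar> powr \<mu>' = complex_of_real \<bar>x\<bar> powr (\<mu> + \<mu>')"
    by (simp add: powr_add)
  ultimately show ?thesis by (simp add: sgn_powr_def mult_ac)
qed

text \<open>The integrand of a Mellin transform on the real line with respect to \<open>dt/\<bar>t\<bar>\<close>.\<close>

definition mellin_density :: "bit \<Rightarrow> complex \<Rightarrow> (real \<Rightarrow> complex) \<Rightarrow> real \<Rightarrow> complex" where
  "mellin_density \<epsilon> s \<phi> t = sgn_powr \<epsilon> s t * \<phi> t / of_real \<bar>t\<bar>"

lemma mellin_density_pos:
  assumes "t \<ge> 0" shows "mellin_density \<epsilon> s \<phi> t = of_real t powr (s - 1) * \<phi> t"
  using assms by (cases "t = 0") (simp_all add: mellin_density_def sgn_powr_def powr_diff)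

lemma mellin_density_neg:
  assumes "t \<ge> 0"
  shows "mellin_density \<epsilon> s \<phi> (- t) = (- 1) ^ of_bit \<epsilon> * (of_real t powr (s - 1) * \<phi> (- t))"
  using assms by (cases "t = 0") (simp_all add: mellin_density_def sgn_powr_def powr_diff)

text \<open>For the trivial sign character this is the definition of the zeta integral. For the nontrivial one
  the odd part of \<open>\<phi>\<close> is integrated; it is \<open>t\<close> times the even part of the Hadamard quotient of \<open>\<phi>\<close>,
  which shifts the exponent by one.\<close>

lemma mellin_density_zeta_distr:
  fixes \<epsilon> :: bit
  assumes \<phi>: "smooth_curve \<phi>" and s: "Re s > 0"
  defines "z \<equiv> (s + of_bit \<epsilon>) / 2"
  shows "mellin_density \<epsilon> s \<phi> absolutely_integrable_on {-1..1}"
    and "rGamma z * integral {-1..1} (mellin_density \<epsilon> s \<phi>) = zeta_distr z ((hadamard_quotient ^^ of_bit \<epsilon>) \<phi>)"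
proof -
  let ?g = "mellin_density \<epsilon> s \<phi>" and ?c = "(- 1) ^ of_bit \<epsilon> :: complex"
  let ?P = "\<lambda>t. of_real t powr (s - 1) * \<phi> t" and ?N = "\<lambda>t. of_real t powr (s - 1) * \<phi> (- t)"
  have s2: "Re (s / 2) > 0" "2 * (s / 2) - 1 = s - 1" using s by simp_all
  have P: "?P absolutely_integrable_on {0..1}"
    using absolutely_integrable_mellin[OF s2(1) smooth_curve_continuous_on[OF \<phi>]] unfolding s2(2) .
  have N: "?N absolutely_integrable_on {0..1}"
    using absolutely_integrable_mellin[OF s2(1) smooth_curve_continuous_on_reflect[OF \<phi>]] unfolding s2(2) .
  have gP: "?g absolutely_integrable_on {0..1}"
    by (rule absolutely_integrable_spike[OF P, of "{}"]) (simp_all add: mellin_density_pos)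
  have "(\<lambda>t. ?c * ?N t) absolutely_integrable_on {0..1}"
    by (rule set_integrable_mult_right) (rule N)
  then have "(\<lambda>t. ?g (- t)) absolutely_integrable_on {0..1}"
    by (rule absolutely_integrable_spike[of _ _ "{}"]) (simp_all add: mellin_density_neg)
  then have gN: "?g absolutely_integrable_on {-1..0}"
    using absolutely_integrable_reflect_real[where f = ?g and a = "-1" and b = 0] by simp
  show "?g absolutely_integrable_on {-1..1}"
    by (rule absolutely_integrable_on_combine[OF gN gP]) simp_all
  then have "?g integrable_on {-1..1}" by (rule set_lebesgue_integral_eq_integral(1))
  then have "integral {-1..1} ?g = integral {-1..0} ?g + integral {0..1} ?g"
    by (intro Henstock_Kurzweil_Integration.integral_combine[symmetric]) simp_all
  also have "integral {-1..0} ?g = integral {0..1} (\<lambda>t. ?g (- t))"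
    using Henstock_Kurzweil_Integration.integral_reflect_real[of 0 "-1" ?g] by simp
  also have "\<dots> = integral {0..1} (\<lambda>t. ?c * ?N t)"
    by (rule integral_cong) (simp add: mellin_density_neg)
  also have "integral {0..1} ?g = integral {0..1} ?P"
    by (rule integral_cong) (simp add: mellin_density_pos)
  also have "integral {0..1} (\<lambda>t. ?c * ?N t) + integral {0..1} ?P = integral {0..1} (\<lambda>t. ?c * ?N t + ?P t)"
    by (rule integral_add[symmetric])
      (use P N in \<open>auto intro!: integrable_on_mult_right dest: set_lebesgue_integral_eq_integral(1)\<close>)
  finally have I: "integral {-1..1} ?g = integral {0..1} (\<lambda>t. ?c * ?N t + ?P t)" .
  show "rGamma z * integral {-1..1} ?g = zeta_distr z ((hadamard_quotient ^^ of_bit \<epsilon>) \<phi>)"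
  proof (cases "\<epsilon> = 0")
    case True
    then have i: "of_bit \<epsilon> = (0 :: nat)" by simp
    have z: "Re z > 0" "2 * z - 1 = s - 1" using s by (simp_all add: z_def True)
    have "zeta_distr z \<phi> = local_zeta 0 z \<phi>"
      by (rule zeta_distr_eq_local_zeta[OF \<phi>]) (use z in simp)
    also have "\<dots> = rGamma z * integral {0..1} (\<lambda>t. of_real t powr (s - 1) * (\<phi> t + \<phi> (- t)))"
      by (simp only: local_zeta.simps z(2))
    also have "(\<lambda>t. of_real t powr (s - 1) * (\<phi> t + \<phi> (- t))) = (\<lambda>t. (- 1) ^ 0 * ?N t + ?P t)"
      by (simp add: fun_eq_iff algebra_simps)
    finally show ?thesis unfolding I i by simp
  next
    case False
    then have e: "\<epsilon> = 1" by simp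
    then have i: "of_bit \<epsilon> = (1 :: nat)" by simp
    let ?\<psi> = "hadamard_quotient \<phi>"
    have "Re z > 0" "2 * z = s + 1" using s by (simp_all add: z_def e)
    then have z: "Re z > 0" "2 * z - 1 = s" by simp_all
    have "zeta_distr z ?\<psi> = local_zeta 0 z ?\<psi>"
      by (rule zeta_distr_eq_local_zeta[OF smooth_curve_hadamard_quotient[OF \<phi>]]) (use z in simp)
    also have "\<dots> = rGamma z * integral {0..1} (\<lambda>t. of_real t powr s * (?\<psi> t + ?\<psi> (- t)))"
      by (simp only: local_zeta.simps z(2))
    also have "(\<lambda>t. of_real t powr s * (?\<psi> t + ?\<psi> (- t))) = (\<lambda>t. (- 1) ^ 1 * ?N t + ?P t)"
    proof
      fix t :: real
      have pw: "of_real t powr s = complex_of_real t powr (s - 1) * of_real t"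
        by (cases "t = 0") (simp_all add: powr_diff)
      have "\<phi> t = \<phi> 0 + of_real t * ?\<psi> t" "\<phi> (- t) = \<phi> 0 + of_real (- t) * ?\<psi> (- t)"
        by (rule hadamard_quotient_eq)+
      then have "of_real t * (?\<psi> t + ?\<psi> (- t)) = \<phi> t - \<phi> (- t)" by (simp add: algebra_simps)
      then have "of_real t powr s * (?\<psi> t + ?\<psi> (- t)) = of_real t powr (s - 1) * (\<phi> t - \<phi> (- t))"
        unfolding pw mult.assoc by (simp only:)
      then show "of_real t powr s * (?\<psi> t + ?\<psi> (- t)) = (- 1) ^ 1 * ?N t + ?P t"
        by (simp add: algebra_simps)
    qed
    finally show ?thesis unfolding I i by simp
  qed
qed

text \<open>The map \<open>u \<mapsto> 1 / u\<close> takes the punctured interval onto the complement of the open interval, with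
  Jacobian \<open>1 / u\<^sup>2\<close>.\<close>

lemma integral_inversion:
  fixes g :: "real \<Rightarrow> complex"
  assumes near: "g absolutely_integrable_on {-1..1}"
    and far: "(\<lambda>u. g (1 / u) / of_real (u\<^sup>2)) absolutely_integrable_on {-1..1}"
  shows "g absolutely_integrable_on UNIV"
    and "integral UNIV g = integral {-1..1} g + integral {-1..1} (\<lambda>u. g (1 / u) / of_real (u\<^sup>2))"
proof -
  let ?S = "{-1..1} - {0::real}" and ?T = "{t :: real. \<bar>t\<bar> \<ge> 1}"
  let ?G = "\<lambda>u. g (1 / u) / of_real (u\<^sup>2)"
  have neg: "negligible {x \<in> ?S - {-1..1}. ?G x \<noteq> 0}" "negligible {x \<in> {-1..1} - ?S. ?G x \<noteq> 0}"
    by (rule negligible_subset[of "{0}"]; auto)+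
  have GS: "?G absolutely_integrable_on ?S" and Gi: "integral ?S ?G = integral {-1..1} ?G"
    using far absolutely_integrable_spike_set_eq[OF neg] integral_spike_set[OF neg] by simp_all
  have im: "(\<lambda>u. 1 / u) ` ?S = ?T"
  proof
    show "(\<lambda>u. 1 / u) ` ?S \<subseteq> ?T" by (auto simp: abs_le_iff field_simps)
    show "?T \<subseteq> (\<lambda>u. 1 / u) ` ?S"
    proof
      fix t :: real assume t: "t \<in> ?T"
      then have "\<bar>1 / t\<bar> \<le> 1" "1 / t \<noteq> 0" by auto
      then have "1 / t \<in> ?S" unfolding abs_le_iff by simp
      then show "t \<in> (\<lambda>u. 1 / u) ` ?S" by (rule rev_image_eqI) simp
    qed
  qed
  have "(\<lambda>u. \<bar>- 1 / u\<^sup>2\<bar> *\<^sub>R g (1 / u)) = ?G"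
    by (simp add: fun_eq_iff scaleR_conv_of_real)
  moreover have "(\<lambda>u. \<bar>- 1 / u\<^sup>2\<bar> *\<^sub>R g (1 / u)) absolutely_integrable_on ?S \<and>
      integral ?S (\<lambda>u. \<bar>- 1 / u\<^sup>2\<bar> *\<^sub>R g (1 / u)) = integral {-1..1} ?G \<longleftrightarrow>
      g absolutely_integrable_on (\<lambda>u. 1 / u) ` ?S \<and> integral ((\<lambda>u. 1 / u) ` ?S) g = integral {-1..1} ?G"
  proof (rule has_absolute_integral_change_of_variables_real)
    show "((\<lambda>u. 1 / u) has_field_derivative - 1 / u\<^sup>2) (at u within ?S)" if "u \<in> ?S" for u
      using that by (auto intro!: derivative_eq_intros simp: power2_eq_square)
  qed (auto simp: inj_on_def)
  ultimately have T: "g absolutely_integrable_on ?T" "integral ?T g = integral {-1..1} ?G"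
    using GS Gi im by simp_all
  have U: "{-1..1} \<union> ?T = UNIV" by auto
  show "g absolutely_integrable_on UNIV"
    using absolutely_integrable_Un[OF near T(1)] unfolding U .
  have "integral ({-1..1} \<union> ?T) g = integral {-1..1} g + integral ?T g"
  proof (rule Henstock_Kurzweil_Integration.integral_Un)
    have "{-1..1} \<inter> ?T = {-1, 1}" by auto
    then show "negligible ({-1..1} \<inter> ?T)" by simp
  qed (use near T(1) set_lebesgue_integral_eq_integral(1) in blast)+
  then show "integral UNIV g = integral {-1..1} g + integral {-1..1} ?G"
    unfolding U T(2) .
qed

lemma mellin_density_measurable:
  assumes "continuous_on UNIV \<phi>" shows "mellin_density \<epsilon> s \<phi> \<in> borel_measurable borel"
proof (rule borel_measurable_continuous_countable_exceptions[of "{0}"])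
  have "continuous_on (- {0::real}) (\<lambda>t. complex_of_real \<bar>t\<bar> powr s)"
    by (intro continuous_on_powr_complex continuous_intros) auto
  moreover have "continuous_on (- {0::real}) sgn"
    by (intro continuous_on_sgn continuous_on_id) simp
  ultimately show "continuous_on (- {0}) (mellin_density \<epsilon> s \<phi>)"
    unfolding mellin_density_def sgn_powr_def
    by (intro continuous_intros continuous_on_subset[OF assms]) auto
qed simp

lemma mellin_density_inversion:
  assumes \<phi>: "smooth_curve \<phi>" and \<omega>: "smooth_curve \<omega>" and s: "Re s > 0" and s': "Re s' > 0"
    and inv: "\<And>u. u \<noteq> 0 \<Longrightarrow> mellin_density \<epsilon> s \<phi> (1 / u) / of_real (u\<^sup>2) = mellin_density \<epsilon>' s' \<omega> u"
  shows "integrable lborel (mellin_density \<epsilon> s \<phi>)"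
    and "(LINT t|lborel. mellin_density \<epsilon> s \<phi> t) =
      integral {-1..1} (mellin_density \<epsilon> s \<phi>) + integral {-1..1} (mellin_density \<epsilon>' s' \<omega>)"
proof -
  have eq: "(\<lambda>u. mellin_density \<epsilon> s \<phi> (1 / u) / of_real (u\<^sup>2)) = mellin_density \<epsilon>' s' \<omega>"
  proof
    fix u show "mellin_density \<epsilon> s \<phi> (1 / u) / of_real (u\<^sup>2) = mellin_density \<epsilon>' s' \<omega> u"
      using inv[of u] by (cases "u = 0") (simp_all add: mellin_density_def)
  qed
  note I = integral_inversion[OF mellin_density_zeta_distr(1)[OF \<phi> s, of \<epsilon>], unfolded eq,
      OF mellin_density_zeta_distr(1)[OF \<omega> s', of \<epsilon>']]
  have "integrable lebesgue (mellin_density \<epsilon> s \<phi>)"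
    using I(1) by (simp add: set_integrable_def)
  then show int: "integrable lborel (mellin_density \<epsilon> s \<phi>)"
    by (subst (asm) integrable_completion)
      (use mellin_density_measurable[OF smooth_curve_continuous_on[OF \<phi>]] in simp_all)
  show "(LINT t|lborel. mellin_density \<epsilon> s \<phi> t) =
      integral {-1..1} (mellin_density \<epsilon> s \<phi>) + integral {-1..1} (mellin_density \<epsilon>' s' \<omega>)"
    using integral_lborel[OF int] I(2) by simp
qed

section \<open>The continued operator\<close>

text \<open>The line \<open>M0 + t M1\<close> of invertible matrices will be one of the two charts. The parameters of the twist
  are included among the smooth variables, as they are later needed as holomorphic ones.\<close>

lemma smooth_family_curve:
  fixes M0 M1 :: "('n::{finite,linorder} + 'n) sqmat"
  assumes inv: "\<And>t. invertible (M0 + t *\<^sub>R M1)"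
  shows "smooth_family (smooth_GL_topology UNIV) ((UNIV \<times> grp_G) \<times> UNIV)
    (\<lambda>f (x :: ((complex \<times> complex) \<times> ('n + 'n) sqmat) \<times> real).
      f (snd (fst x) ** (M0 + snd x *\<^sub>R M1)) *
      twist (fst (fst (fst x))) (snd (fst (fst x))) (snd (fst x) ** (M0 + snd x *\<^sub>R M1)))"
proof -
  let ?S = "(UNIV :: (complex \<times> complex) set) \<times> (grp_G :: ('n + 'n) sqmat set)"
  let ?T = "?S \<times> (UNIV :: real set)"
  let ?Y = "smooth_GL_topology UNIV :: (('n + 'n) sqmat \<Rightarrow> complex) topology"
  have S: "open ?S" by (intro open_Times open_GL_UNIV open_UNIV)
  have T: "open ?T" by (intro open_Times S open_UNIV)
  have mult: "bounded_linear (\<lambda>h :: ('n + 'n) sqmat. h ** M)" for M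
  proof -
    have "linear (\<lambda>h :: ('n + 'n) sqmat. h ** M)"
      by (rule linearI) (simp_all only: matrix_add_rdistrib matrix_scaleR_mult)
    then show ?thesis by (simp add: linear_conv_bounded_linear)
  qed
  have h: "smooth_family ?Y ?T (\<lambda>f x. snd (fst x))"
    by (rule smooth_family_linear[OF T bounded_linear_compose[OF bounded_linear_snd bounded_linear_fst]])
  have hM: "smooth_family ?Y ?T (\<lambda>f x. snd (fst x) ** M)" for M
    by (rule smooth_family_post_linear[OF T mult h])
  have t: "smooth_family ?Y ?T (\<lambda>f x. snd x)" by (rule smooth_family_linear[OF T bounded_linear_snd])
  have ab: "smooth_family ?Y ?T (\<lambda>f x. fst (fst x))"
    by (rule smooth_family_linear[OF T bounded_linear_compose[OF bounded_linear_fst bounded_linear_fst]])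
  have "smooth_family ?Y ?T (\<lambda>f x. snd (fst x) ** M0 + snd x *\<^sub>R (snd (fst x) ** M1))"
    by (intro smooth_family_add[OF T] smooth_family_bilinear[OF T bounded_bilinear_scaleR] t hM)
  then have \<Phi>: "smooth_family ?Y ?T (\<lambda>f x. snd (fst x) ** (M0 + snd x *\<^sub>R M1))"
    by (simp add: matrix_add_ldistrib matrix_scaleR_mult)
  have "smooth_family ?Y ?T (\<lambda>f x. f (snd (fst (fst x), snd (fst x) ** (M0 + snd x *\<^sub>R M1))) *
      twist (fst (fst (fst (fst x), snd (fst x) ** (M0 + snd x *\<^sub>R M1))))
        (snd (fst (fst (fst x), snd (fst x) ** (M0 + snd x *\<^sub>R M1))))
        (snd (fst (fst x), snd (fst x) ** (M0 + snd x *\<^sub>R M1))))"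
  proof (rule smooth_family_compose[OF S T smooth_family_twisted smooth_family_Pair[OF T ab \<Phi>]
        continuous_map_id[unfolded id_def]])
    fix f x assume "x \<in> ?T"
    then have "invertible (snd (fst x))" by (auto simp: GL_UNIV)
    then show "(fst (fst x), snd (fst x) ** (M0 + snd x *\<^sub>R M1)) \<in> ?S"
      using invertible_mult[OF _ inv] by (simp add: GL_UNIV)
  qed
  then show ?thesis unfolding fst_conv[of "fst (fst _)"] snd_conv[of "fst (fst _)"] .
qed

lemma smooth_family_hadamard_iterate:
  fixes \<phi> :: "'y \<Rightarrow> 'a::euclidean_space \<times> real \<Rightarrow> complex"
  assumes S: "open S" and \<phi>: "smooth_family Y (S \<times> UNIV) \<phi>"
  shows "smooth_family Y (S \<times> UNIV) (\<lambda>y x. (hadamard_quotient ^^ e) (\<lambda>s. \<phi> y (fst x, s)) (snd x))"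
proof (induction e)
  case 0 then show ?case using \<phi> by simp
next
  case (Suc e)
  from smooth_family_hadamard_quotient[OF S Suc] show ?case by simp
qed

lemma smooth_curve_hadamard_iterate:
  "smooth_curve \<psi> \<Longrightarrow> smooth_curve ((hadamard_quotient ^^ e) \<psi>)"
  by (induction e) (simp_all add: smooth_curve_hadamard_quotient)

lemma holomorphic_hadamard_iterate:
  fixes \<phi> :: "complex \<times> real \<Rightarrow> complex"
  assumes U: "open U" and \<phi>: "smooth_map (U \<times> UNIV) \<phi>"
    and hol: "\<And>t. (\<lambda>z. \<phi> (z, t)) holomorphic_on U"
  shows "(\<lambda>z. (hadamard_quotient ^^ e) (\<lambda>s. \<phi> (z, s)) t) holomorphic_on U"
proof (induction e arbitrary: t)
  case 0 then show ?case using hol by simp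
next
  case (Suc e)
  have "smooth_map (U \<times> UNIV) (\<lambda>x. (hadamard_quotient ^^ e) (\<lambda>s. \<phi> (fst x, s)) (snd x))"
    by (rule smooth_family_hadamard_iterate[OF U \<phi>])
  from holomorphic_hadamard_quotient[OF U this] Suc show ?case by simp
qed

text \<open>The arguments \<open>z1, z2\<close> are those of the two Gamma factors, and \<open>e1, e2\<close> encode the sign characters. Each
  \<open>zeta_distr\<close> contains the reciprocal of its own Gamma factor and is multiplied by the other one.\<close>

definition B_regularized :: "nat \<Rightarrow> nat \<Rightarrow> complex \<Rightarrow> complex \<Rightarrow>
    (('n::{finite,linorder} + 'n) sqmat \<Rightarrow> complex) \<Rightarrow> ('n + 'n) sqmat \<Rightarrow> complex" where
  "B_regularized e1 e2 z1 z2 f h =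
     rGamma z2 * zeta_distr z1 ((hadamard_quotient ^^ e1) (\<lambda>t. f (h ** chart0 t))) +
     rGamma z1 * zeta_distr z2 ((hadamard_quotient ^^ e2) (\<lambda>u. f (h ** chart1 u)))"

lemma smooth_family_zeta_curve:
  fixes M0 M1 :: "('n::{finite,linorder} + 'n) sqmat"
  assumes inv: "\<And>t. invertible (M0 + t *\<^sub>R M1)"
  shows "smooth_family (smooth_GL_topology UNIV) (UNIV \<times> (UNIV \<times> grp_G))
    (\<lambda>f (x :: complex \<times> ((complex \<times> complex) \<times> ('n + 'n) sqmat)).
      zeta_distr (fst x) ((hadamard_quotient ^^ e) (\<lambda>t. f (snd (snd x) ** (M0 + t *\<^sub>R M1)) *
        twist (fst (fst (snd x))) (snd (fst (snd x))) (snd (snd x) ** (M0 + t *\<^sub>R M1)))))"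
proof -
  have S: "open ((UNIV :: (complex \<times> complex) set) \<times> (grp_G :: ('n + 'n) sqmat set))"
    by (intro open_Times open_GL_UNIV open_UNIV)
  from smooth_family_zeta_distr[OF S smooth_family_hadamard_iterate[OF S smooth_family_curve[OF inv], of e]]
  show ?thesis by simp
qed

lemma smooth_family_B_regularized:
  "smooth_family (smooth_GL_topology UNIV) (UNIV \<times> (UNIV \<times> grp_G))
    (\<lambda>f (x :: (complex \<times> complex) \<times> ((complex \<times> complex) \<times> ('n::{finite,linorder} + 'n) sqmat)).
      B_regularized e1 e2 (fst (fst x)) (snd (fst x))
        (\<lambda>g. f g * twist (fst (fst (snd x))) (snd (fst (snd x))) g) (snd (snd x)))"
proof -
  let ?S = "(UNIV :: (complex \<times> complex) set) \<times> (grp_G :: ('n + 'n) sqmat set)"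
  let ?T = "(UNIV :: (complex \<times> complex) set) \<times> ?S" and ?R = "(UNIV :: complex set) \<times> ?S"
  let ?Y = "smooth_GL_topology UNIV :: (('n + 'n) sqmat \<Rightarrow> complex) topology"
  have S: "open ?S" by (intro open_Times open_GL_UNIV open_UNIV)
  have T: "open ?T" and R: "open ?R" by (intro open_Times S open_UNIV)+
  have z1: "smooth_family ?Y ?T (\<lambda>f x. fst (fst x))"
    by (rule smooth_family_linear[OF T bounded_linear_compose[OF bounded_linear_fst bounded_linear_fst]])
  have z2: "smooth_family ?Y ?T (\<lambda>f x. snd (fst x))"
    by (rule smooth_family_linear[OF T bounded_linear_compose[OF bounded_linear_snd bounded_linear_fst]])
  have sx: "smooth_family ?Y ?T (\<lambda>f x. snd x)" by (rule smooth_family_linear[OF T bounded_linear_snd])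
  have G1: "smooth_family ?Y ?T (\<lambda>f x. rGamma (fst (fst x)))"
    by (rule smooth_family_holomorphic[OF open_UNIV holomorphic_rGamma T z1]) simp
  have G2: "smooth_family ?Y ?T (\<lambda>f x. rGamma (snd (fst x)))"
    by (rule smooth_family_holomorphic[OF open_UNIV holomorphic_rGamma T z2]) simp
  note id = continuous_map_id[unfolded id_def]
  have Z1: "smooth_family ?Y ?T (\<lambda>f x. zeta_distr (fst (fst x)) ((hadamard_quotient ^^ e1) (\<lambda>t.
      f (snd (snd x) ** chart0 t) * twist (fst (fst (snd x))) (snd (fst (snd x))) (snd (snd x) ** chart0 t))))"
    using smooth_family_compose[OF R T smooth_family_zeta_curve[OF chart_affine_invertible, of e1] smooth_family_Pair[OF T z1 sx] id]
    by (simp add: chart0_def mem_Times_iff)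
  have Z2: "smooth_family ?Y ?T (\<lambda>f x. zeta_distr (snd (fst x)) ((hadamard_quotient ^^ e2) (\<lambda>t.
      f (snd (snd x) ** chart1 t) * twist (fst (fst (snd x))) (snd (fst (snd x))) (snd (snd x) ** chart1 t))))"
    using smooth_family_compose[OF R T smooth_family_zeta_curve[OF chart1_invertible[unfolded chart1_def], of e2]
        smooth_family_Pair[OF T z2 sx] id]
    by (simp add: chart1_def mem_Times_iff)
  from smooth_family_add[OF T smooth_family_mult[OF T G2 Z1] smooth_family_mult[OF T G1 Z2]]
  show ?thesis by (simp add: B_regularized_def)
qed

lemma holomorphic_zeta_curve:
  fixes M0 M1 :: "('n::{finite,linorder} + 'n) sqmat"
  assumes inv: "\<And>t. invertible (M0 + t *\<^sub>R M1)"
    and f: "f \<in> smooth_GL UNIV" and h: "h \<in> grp_G"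
    and z: "z holomorphic_on UNIV" and a: "a holomorphic_on UNIV" and b: "b holomorphic_on UNIV"
  shows "(\<lambda>\<zeta>. zeta_distr (z \<zeta>) ((hadamard_quotient ^^ e) (\<lambda>t. f (h ** (M0 + t *\<^sub>R M1)) *
        twist (a \<zeta>) (b \<zeta>) (h ** (M0 + t *\<^sub>R M1))))) holomorphic_on UNIV"
proof -
  let ?S = "((UNIV :: (complex \<times> complex) set) \<times> (grp_G :: ('n + 'n) sqmat set)) \<times> (UNIV :: real set)"
  let ?T = "(UNIV :: complex set) \<times> (UNIV :: real set)"
  let ?\<phi> = "\<lambda>x. f (h ** (M0 + snd x *\<^sub>R M1)) * twist (a (fst x)) (b (fst x)) (h ** (M0 + snd x *\<^sub>R M1))"
  have S: "open ?S" and T: "open ?T" by (intro open_Times open_GL_UNIV open_UNIV)+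
  have lin: "smooth_map ?T (\<lambda>x. fst x)" by (rule smooth_family_linear[OF T bounded_linear_fst])
  have ha: "smooth_map ?T (\<lambda>x. a (fst x))" by (rule smooth_family_holomorphic[OF open_UNIV a T lin]) simp
  have hb: "smooth_map ?T (\<lambda>x. b (fst x))" by (rule smooth_family_holomorphic[OF open_UNIV b T lin]) simp
  have \<Phi>: "smooth_map ?T (\<lambda>x. (((a (fst x), b (fst x)), h), snd x))"
    by (rule smooth_family_Pair[OF T smooth_family_Pair[OF T smooth_family_Pair[OF T ha hb]
          smooth_family_const[OF T]] smooth_family_linear[OF T bounded_linear_snd]])
  have \<sigma>: "continuous_map (discrete_topology {()}) (smooth_GL_topology UNIV) (\<lambda>_. f)"
    using f by (simp add: topspace_smooth_GL_topology)
  have "smooth_map ?T ?\<phi>"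
    using smooth_family_compose[OF S T smooth_family_curve[OF inv] \<Phi> \<sigma>] h by simp
  then have \<phi>: "smooth_map (UNIV \<times> UNIV) ?\<phi>" by simp
  have hol: "(\<lambda>\<zeta>. ?\<phi> (\<zeta>, t)) holomorphic_on UNIV" for t
    unfolding twist_def fst_conv snd_conv by (intro holomorphic_intros a b)
  have sm: "smooth_map (UNIV \<times> UNIV) (\<lambda>x. (hadamard_quotient ^^ e) (\<lambda>s. ?\<phi> (fst x, s)) (snd x))"
    by (rule smooth_family_hadamard_iterate[OF open_UNIV \<phi>])
  have "(\<lambda>\<zeta>. (hadamard_quotient ^^ e) (\<lambda>s. ?\<phi> (\<zeta>, s)) t) holomorphic_on UNIV" for t
    by (rule holomorphic_hadamard_iterate[OF open_UNIV \<phi> hol])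
  from holomorphic_zeta_distr[OF open_UNIV sm _ z] this show ?thesis by simp
qed

lemma holomorphic_B_regularized:
  fixes f :: "('n::{finite,linorder} + 'n) sqmat \<Rightarrow> complex"
  assumes f: "f \<in> smooth_GL UNIV" and h: "h \<in> grp_G"
    and z: "z1 holomorphic_on UNIV" "z2 holomorphic_on UNIV"
    and ab: "a holomorphic_on UNIV" "b holomorphic_on UNIV"
  shows "(\<lambda>\<zeta>. B_regularized e1 e2 (z1 \<zeta>) (z2 \<zeta>) (\<lambda>g. f g * twist (a \<zeta>) (b \<zeta>) g) h) holomorphic_on UNIV"
  unfolding B_regularized_def
  using holomorphic_zeta_curve[OF chart_affine_invertible f h z(1) ab, of e1, folded chart0_def]
    holomorphic_zeta_curve[OF chart1_invertible[unfolded chart1_def] f h z(2) ab, of e2, folded chart1_def]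
  by (intro holomorphic_on_add holomorphic_on_mult holomorphic_rGamma' z)

lemma smooth_curve_chart:
  fixes M0 M1 :: "('n::{finite,linorder} + 'n) sqmat"
  assumes inv: "\<And>t. invertible (M0 + t *\<^sub>R M1)" and f: "f \<in> smooth_GL UNIV" and h: "h \<in> grp_G"
  shows "smooth_curve (\<lambda>t. f (h ** (M0 + t *\<^sub>R M1)))"
proof -
  have S: "open ((UNIV :: (complex \<times> complex) set) \<times> (grp_G :: ('n + 'n) sqmat set))"
    by (intro open_Times open_GL_UNIV open_UNIV)
  from smooth_curve_slice[OF S smooth_family_curve[OF inv], of f "((0, 0), h)"] f h
  show ?thesis by (simp add: topspace_smooth_GL_topology)
qed

lemma smooth_curve_charts:
  fixes f :: "('n::{finite,linorder} + 'n) sqmat \<Rightarrow> complex"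
  assumes "f \<in> smooth_GL UNIV" "h \<in> grp_G"
  shows "smooth_curve (\<lambda>t. f (h ** chart0 t))" "smooth_curve (\<lambda>t. f (h ** chart1 t))"
  using smooth_curve_chart[OF chart_affine_invertible assms, folded chart0_def]
    smooth_curve_chart[OF chart1_invertible[unfolded chart1_def] assms, folded chart1_def] .

section \<open>The operator in the domain of convergence\<close>

definition B_extended :: "bit \<Rightarrow> bit \<Rightarrow> bit \<Rightarrow> complex \<Rightarrow> complex \<Rightarrow> complex \<Rightarrow>
    (('n::{finite,linorder} + 'n) sqmat \<Rightarrow> complex) \<Rightarrow> ('n + 'n) sqmat \<Rightarrow> complex" where
  "B_extended \<xi>1 \<xi>2 \<eta> l1 l2 \<nu> = B_regularized (of_bit (\<xi>1 + \<eta>)) (of_bit (\<xi>2 + \<eta>))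
     ((l1 - \<nu> + of_nat CARD('n) / 2 + of_bit (\<xi>1 + \<eta>)) / 2)
     ((\<nu> - l2 + of_nat CARD('n) / 2 + of_bit (\<xi>2 + \<eta>)) / 2)"

lemma bit_cancel: "(\<xi>1 + \<eta>) + \<xi>1 + \<xi>2 = \<xi>2 + (\<eta> :: bit)"
  by (cases "\<xi>1 = 0"; cases "\<xi>2 = 0"; cases "\<eta> = 0") simp_all

text \<open>The transformation law of \<open>f\<close> under \<open>transition (1 / u)\<close> contributes \<open>u\<close> to the power
  \<open>\<lambda>1 + n/2 - \<lambda>2 + n/2\<close>. Together with \<open>\<bar>1 / u\<bar>\<close> to the power \<open>\<lambda>1 - \<nu> + n/2\<close> this is the Mellin density in
  the second chart, with exponent \<open>\<nu> - \<lambda>2 + n/2\<close> and sign character \<open>\<xi>2 + \<eta>\<close>.\<close>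

lemma B_integral:
  fixes f :: "('n::{finite,linorder} + 'n) sqmat \<Rightarrow> complex"
  assumes f: "f \<in> rep_pi (\<xi>1, \<xi>2) (l1, l2)" and h: "h \<in> grp_G"
    and re: "Re (l1 - \<nu>) > - real CARD('n) / 2" "Re (\<nu> - l2) > - real CARD('n) / 2"
  shows "integrable lborel (B_integrand \<xi>1 l1 \<eta> \<nu> f h)"
    and "B_extended \<xi>1 \<xi>2 \<eta> l1 l2 \<nu> f h =
      inverse (n_B CARD('n) (\<xi>1, \<xi>2) (l1, l2) \<eta> \<nu>) * (LINT t|lborel. B_integrand \<xi>1 l1 \<eta> \<nu> f h t)"
proof -
  let ?n = "of_nat CARD('n) / 2 :: complex"
  let ?s1 = "l1 - \<nu> + ?n" and ?s2 = "\<nu> - l2 + ?n"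
  let ?\<phi>0 = "\<lambda>t. f (h ** chart0 t)" and ?\<phi>1 = "\<lambda>t. f (h ** chart1 t)"
  note sm = smooth_curve_charts[OF rep_pi_smooth[OF f] h]
  have s1: "Re ?s1 > 0" and s2: "Re ?s2 > 0" using re by simp_all
  have B: "B_integrand \<xi>1 l1 \<eta> \<nu> f h = mellin_density (\<xi>1 + \<eta>) ?s1 ?\<phi>0"
    by (simp add: fun_eq_iff B_integrand_def mellin_density_def chart0_def)
  have inv: "mellin_density (\<xi>1 + \<eta>) ?s1 ?\<phi>0 (1 / u) / of_real (u\<^sup>2) = mellin_density (\<xi>2 + \<eta>) ?s2 ?\<phi>1 u"
    if u: "u \<noteq> 0" for u
  proof -
    have u': "1 / u \<noteq> 0" using u by simp
    note tr = transition_parab_G[OF u', where 'n = 'n]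
    have hc: "h ** chart1 u \<in> grp_G"
      using h invertible_mult[OF _ chart1_invertible] by (simp add: GL_UNIV)
    have "?\<phi>0 (1 / u) = f ((h ** chart1 u) ** transition (1 / u))"
      unfolding chart_transition[OF u'] matrix_mul_assoc by simp
    also have "\<dots> = sgn_powr \<xi>1 (- l1 - ?n) (1 / u) * sgn_powr \<xi>2 (- l2 + ?n) u * ?\<phi>1 u"
      unfolding rep_pi_mult[OF f hc tr(1)] tr(2,3) by simp
    also have "sgn_powr \<xi>1 (- l1 - ?n) (1 / u) = sgn_powr \<xi>1 (l1 + ?n) u"
    proof -
      have "- (- l1 - ?n) = l1 + ?n" by simp
      then show ?thesis unfolding sgn_powr_inverse[OF u] by (simp only:)
    qed
    finally have \<phi>0: "?\<phi>0 (1 / u) = sgn_powr \<xi>1 (l1 + ?n) u * sgn_powr \<xi>2 (- l2 + ?n) u * ?\<phi>1 u" .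
    \<comment> \<open>Inversion changes the sign of \<open>?s1\<close>, and the transformation law of \<open>f\<close> supplies the rest.\<close>
    have e: "- ?s1 + ((l1 + ?n) + (- l2 + ?n)) = ?s2" by simp
    have bits: "\<xi>1 + \<eta> + (\<xi>1 + \<xi>2) = \<xi>2 + \<eta>" using bit_cancel[of \<xi>1 \<eta> \<xi>2] by (simp only: add.assoc)
    have sg: "sgn_powr (\<xi>1 + \<eta>) ?s1 (1 / u) * (sgn_powr \<xi>1 (l1 + ?n) u * sgn_powr \<xi>2 (- l2 + ?n) u)
        = sgn_powr (\<xi>2 + \<eta>) ?s2 u"
      by (simp only: sgn_powr_inverse[OF u] sgn_powr_combine[OF u] e bits)
    have "\<bar>1 / u\<bar> * u\<^sup>2 = \<bar>u\<bar>" using u by (simp add: power2_eq_square abs_if)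
    then have au: "complex_of_real \<bar>1 / u\<bar> * of_real (u\<^sup>2) = of_real \<bar>u\<bar>" by (metis of_real_mult)
    have "mellin_density (\<xi>1 + \<eta>) ?s1 ?\<phi>0 (1 / u) / of_real (u\<^sup>2) =
        sgn_powr (\<xi>1 + \<eta>) ?s1 (1 / u) * ?\<phi>0 (1 / u) / (of_real \<bar>1 / u\<bar> * of_real (u\<^sup>2))"
      by (simp only: mellin_density_def divide_divide_eq_left)
    also have "\<dots> = sgn_powr (\<xi>1 + \<eta>) ?s1 (1 / u) *
        (sgn_powr \<xi>1 (l1 + ?n) u * sgn_powr \<xi>2 (- l2 + ?n) u) * ?\<phi>1 u / of_real \<bar>u\<bar>"
      unfolding au \<phi>0 by (simp only: mult.assoc)
    finally show ?thesis unfolding sg mellin_density_def .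
  qed
  note I = mellin_density_inversion[OF sm s1 s2 inv]
  show "integrable lborel (B_integrand \<xi>1 l1 \<eta> \<nu> f h)" unfolding B by (rule I(1))
  let ?A = "integral {-1..1} (mellin_density (\<xi>1 + \<eta>) ?s1 ?\<phi>0)"
  let ?C = "integral {-1..1} (mellin_density (\<xi>2 + \<eta>) ?s2 ?\<phi>1)"
  have LI: "(LINT t|lborel. B_integrand \<xi>1 l1 \<eta> \<nu> f h t) = ?A + ?C" unfolding B by (rule I(2))
  have "B_extended \<xi>1 \<xi>2 \<eta> l1 l2 \<nu> f h =
      rGamma ((?s2 + of_bit (\<xi>2 + \<eta>)) / 2) * (rGamma ((?s1 + of_bit (\<xi>1 + \<eta>)) / 2) * ?A) +
      rGamma ((?s1 + of_bit (\<xi>1 + \<eta>)) / 2) * (rGamma ((?s2 + of_bit (\<xi>2 + \<eta>)) / 2) * ?C)"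
    by (simp only: B_extended_def B_regularized_def mellin_density_zeta_distr(2)[OF sm(1) s1]
        mellin_density_zeta_distr(2)[OF sm(2) s2])
  also have "\<dots> = inverse (n_B CARD('n) (\<xi>1, \<xi>2) (l1, l2) \<eta> \<nu>) * (?A + ?C)"
    unfolding n_B_def prod.case rGamma_inverse_Gamma inverse_mult_distrib by (simp only: algebra_simps)
  finally show "B_extended \<xi>1 \<xi>2 \<eta> l1 l2 \<nu> f h =
      inverse (n_B CARD('n) (\<xi>1, \<xi>2) (l1, l2) \<eta> \<nu>) * (LINT t|lborel. B_integrand \<xi>1 l1 \<eta> \<nu> f h t)"
    unfolding LI .
qed

section \<open>Equivariance under the parabolic subgroup of H\<close>

text \<open>The substitution \<open>t \<mapsto> c t\<close>, where \<open>c\<close> is the entry of \<open>p\<close> in the middle block, moves \<open>p\<close> past the curve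
  \<open>chart0\<close>. The measure \<open>dt/\<bar>t\<bar>\<close> is invariant, the character contributes a power of \<open>c\<close> with
  exponent \<open>\<lambda>1 - \<nu> + n/2\<close>, and the parabolic subgroup of \<open>G\<close> one with exponent \<open>- \<lambda>1 - n/2\<close>.\<close>

lemma B_integral_equivariant:
  fixes f :: "('n::{finite,linorder} + 'n) sqmat \<Rightarrow> complex"
  assumes f: "f \<in> rep_pi (\<xi>1, \<xi>2) (l1, l2)" and h: "h \<in> grp_G" and p: "p \<in> parab_H"
  shows "(LINT t|lborel. B_integrand \<xi>1 l1 \<eta> \<nu> f (h ** p) t) =
       sgn_powr \<xi>1 (- l1 - of_nat CARD('n) / 2) (block_det blk1 p) *
       sgn_powr \<eta> (- \<nu>) (block_det blk2 p) *
       sgn_powr \<xi>2 (- l2 + of_nat CARD('n) / 2) (block_det blk3 p) *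
       (LINT t|lborel. B_integrand \<xi>1 l1 \<eta> \<nu> f h t)"
proof -
  let ?n = "of_nat CARD('n) / 2 :: complex" and ?c = "p $ ix_n $ ix_n"
  let ?d1 = "block_det blk1 p" and ?d3 = "block_det blk3 p"
  note bd = parab_H_block_dets[OF p]
  have c: "?c \<noteq> 0" by (rule bd(3))
  let ?k = "sgn_powr \<xi>1 (- l1 - ?n) (?d1 * ?c) * sgn_powr \<xi>2 (- l2 + ?n) ?d3"
  let ?r = "sgn_powr (\<xi>1 + \<eta>) (l1 - \<nu> + ?n) ?c"
  have f_eq: "f ((h ** p) ** chart0 (?c * t)) = ?k * f (h ** chart0 t)" for t
  proof -
    note q = parab_H_conjugate[OF p, of t]
    have hc: "h ** chart0 t \<in> grp_G"
      using h invertible_mult[OF _ chart0_invertible] by (simp add: GL_UNIV)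
    have "(h ** p) ** chart0 (?c * t) = h ** (p ** chart0 (?c * t))" by (simp only: matrix_mul_assoc)
    also have "\<dots> = (h ** chart0 t) ** (chart0 (- t) ** p ** chart0 (?c * t))"
      unfolding q(1) by (simp only: matrix_mul_assoc)
    finally show ?thesis
      using rep_pi_mult[OF f hc q(2)] unfolding q(3,4) bd(1) by simp
  qed
  have int_eq: "B_integrand \<xi>1 l1 \<eta> \<nu> f (h ** p) (?c * t) =
      ?r * ?k / of_real \<bar>?c\<bar> * B_integrand \<xi>1 l1 \<eta> \<nu> f h t" for t
  proof (cases "t = 0")
    case True then show ?thesis by (simp add: B_integrand_def)
  next
    case False
    show ?thesis
      unfolding B_integrand_def chart0_def[symmetric] f_eq sgn_powr_mult[OF c False] abs_mult of_real_mult
      by simp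
  qed
  have "(LINT t|lborel. B_integrand \<xi>1 l1 \<eta> \<nu> f (h ** p) t) =
      \<bar>?c\<bar> *\<^sub>R (LINT t|lborel. B_integrand \<xi>1 l1 \<eta> \<nu> f (h ** p) (0 + ?c * t))"
    by (rule lborel_integral_real_affine[OF c])
  also have "\<dots> = of_real \<bar>?c\<bar> * (?r * ?k / of_real \<bar>?c\<bar> * (LINT t|lborel. B_integrand \<xi>1 l1 \<eta> \<nu> f h t))"
    unfolding add_0 int_eq integral_mult_right_zero scaleR_conv_of_real ..
  also have "\<dots> = ?r * ?k * (LINT t|lborel. B_integrand \<xi>1 l1 \<eta> \<nu> f h t)"
    using c by simp
  also have "?r * ?k = sgn_powr \<xi>1 (- l1 - ?n) ?d1 *
      (sgn_powr (\<xi>1 + \<eta>) (l1 - \<nu> + ?n) ?c * sgn_powr \<xi>1 (- l1 - ?n) ?c) * sgn_powr \<xi>2 (- l2 + ?n) ?d3"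
    unfolding sgn_powr_mult[OF bd(4) c] by (simp only: mult_ac)
  also have "sgn_powr (\<xi>1 + \<eta>) (l1 - \<nu> + ?n) ?c * sgn_powr \<xi>1 (- l1 - ?n) ?c = sgn_powr \<eta> (- \<nu>) ?c"
  proof -
    have "\<xi>1 + \<eta> + \<xi>1 = \<eta>" using bit_cancel[of \<xi>1 \<eta> 0] by simp
    moreover have "l1 - \<nu> + ?n + (- l1 - ?n) = - \<nu>" by simp
    ultimately show ?thesis unfolding sgn_powr_combine[OF c] by (simp only:)
  qed
  finally show ?thesis unfolding bd(2) .
qed

text \<open>Analytic continuation in \<open>\<zeta>\<close> from a half plane on which the integral converges for the parameters
  \<open>(\<lambda>1 + \<zeta>, \<lambda>2 - \<zeta>, \<nu>)\<close> down to \<open>\<zeta> = 0\<close>, applied to the flat continuation of \<open>f\<close>.\<close>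

lemma B_extended_equivariant:
  fixes f :: "('n::{finite,linorder} + 'n) sqmat \<Rightarrow> complex"
  assumes f: "f \<in> rep_pi (\<xi>1, \<xi>2) (l1, l2)" and h: "h \<in> grp_G" and p: "p \<in> parab_H"
  shows "B_extended \<xi>1 \<xi>2 \<eta> l1 l2 \<nu> f (h ** p) =
       sgn_powr \<xi>1 (- l1 - of_nat CARD('n) / 2) (block_det blk1 p) *
       sgn_powr \<eta> (- \<nu>) (block_det blk2 p) *
       sgn_powr \<xi>2 (- l2 + of_nat CARD('n) / 2) (block_det blk3 p) * B_extended \<xi>1 \<xi>2 \<eta> l1 l2 \<nu> f h"
proof -
  let ?n = "of_nat CARD('n) / 2 :: complex"
  let ?d1 = "block_det blk1 p" and ?d2 = "block_det blk2 p" and ?d3 = "block_det blk3 p"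
  define F where "F \<zeta> = (\<lambda>g. f g * twist \<zeta> (- \<zeta>) g)" for \<zeta>
  define L where "L k \<zeta> = B_extended \<xi>1 \<xi>2 \<eta> (l1 + \<zeta>) (l2 + - \<zeta>) \<nu> (F \<zeta>) k" for k \<zeta>
  define \<chi>' where "\<chi>' \<zeta> = sgn_powr \<xi>1 (- (l1 + \<zeta>) - ?n) ?d1 * sgn_powr \<eta> (- \<nu>) ?d2 *
      sgn_powr \<xi>2 (- (l2 + - \<zeta>) + ?n) ?d3" for \<zeta>
  have hol: "L k holomorphic_on UNIV" if "k \<in> grp_G" for k
    unfolding L_def B_extended_def F_def
    by (rule holomorphic_B_regularized[OF rep_pi_smooth[OF f] that]) (intro holomorphic_intros; simp)+
  have pG: "p \<in> parab_G" by (rule parab_H_subset[OF p])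
  have hp: "h ** p \<in> grp_G" using h pG GL_mult by (auto simp: parab_G_def)
  have d1: "?d1 \<noteq> 0" by (rule parab_H_block_dets(4)[OF p])
  have d3: "?d3 \<noteq> 0"
    using parab_G_det(3)[OF parab_H_conjugate(2)[OF p]] unfolding parab_H_conjugate(4)[OF p] .
  have \<chi>_eq: "\<chi>' \<zeta> = sgn_powr \<xi>1 (- l1 - ?n) ?d1 * exp (- \<zeta> * of_real (ln \<bar>?d1\<bar>)) * sgn_powr \<eta> (- \<nu>) ?d2 *
      (sgn_powr \<xi>2 (- l2 + ?n) ?d3 * exp (\<zeta> * of_real (ln \<bar>?d3\<bar>)))" for \<zeta>
  proof -
    have e: "- (l1 + \<zeta>) - ?n = (- l1 - ?n) + (- \<zeta>)" "- (l2 + - \<zeta>) + ?n = (- l2 + ?n) + \<zeta>" by simp_all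
    show ?thesis unfolding \<chi>'_def e sgn_powr_add[OF d1] sgn_powr_add[OF d3] ..
  qed
  have hol\<chi>: "\<chi>' holomorphic_on UNIV"
    unfolding \<chi>_eq[abs_def] by (intro holomorphic_intros)
  \<comment> \<open>For \<open>Re \<zeta> > R\<close> both conditions of convergence hold for \<open>(l1 + \<zeta>, l2 - \<zeta>, \<nu>)\<close>.\<close>
  define R where "R = max (- real CARD('n) / 2 - Re (l1 - \<nu>)) (- real CARD('n) / 2 - Re (\<nu> - l2))"
  have eq: "L (h ** p) \<zeta> = \<chi>' \<zeta> * L h \<zeta>" if "\<zeta> \<in> {\<zeta>. Re \<zeta> > R}" for \<zeta>
  proof -
    have re: "Re (l1 + \<zeta> - \<nu>) > - real CARD('n) / 2" "Re (\<nu> - (l2 + - \<zeta>)) > - real CARD('n) / 2"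
      using that by (auto simp: R_def)
    have F: "F \<zeta> \<in> rep_pi (\<xi>1, \<xi>2) (l1 + \<zeta>, l2 + - \<zeta>)" unfolding F_def by (rule twist_rep_pi[OF f])
    show ?thesis
      unfolding L_def B_integral(2)[OF F h re] B_integral(2)[OF F hp re] B_integral_equivariant[OF F h p] \<chi>'_def
      by (simp only: mult_ac)
  qed
  have "complex_of_real (R + 1) \<in> {\<zeta>. Re \<zeta> > R}" by simp
  then have ne: "{\<zeta>. Re \<zeta> > R} \<noteq> {}" by blast
  have "L (h ** p) 0 = \<chi>' 0 * L h 0"
    by (rule analytic_continuation_open[OF open_halfspace_Re_gt open_UNIV ne connected_UNIV subset_UNIV
          hol[OF hp] holomorphic_on_mult[OF hol\<chi> hol[OF h]] eq UNIV_I])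
  then show ?thesis by (simp add: L_def F_def \<chi>'_def)
qed

section \<open>The intertwining operators and their holomorphic dependence\<close>

text \<open>The parameters of the twist are \<open>0\<close> here: \<open>f\<close> itself is the parameter of the family, so that this
  contains both smoothness in \<open>h\<close> and continuity in \<open>f\<close>.\<close>

lemma smooth_family_B_extended:
  "smooth_family (smooth_GL_topology UNIV) (grp_G :: ('n::{finite,linorder} + 'n) sqmat set)
    (\<lambda>f h. B_extended \<xi>1 \<xi>2 \<eta> l1 l2 \<nu> f h)"
proof -
  have T: "open ((UNIV :: (complex \<times> complex) set) \<times> (UNIV :: (complex \<times> complex) set) \<times> (grp_G :: ('n + 'n) sqmat set))"
    by (intro open_Times open_GL_UNIV open_UNIV)
  let ?z = "((l1 - \<nu> + of_nat CARD('n) / 2 + of_bit (\<xi>1 + \<eta>)) / 2, (\<nu> - l2 + of_nat CARD('n) / 2 + of_bit (\<xi>2 + \<eta>)) / 2)"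
  have \<Phi>: "smooth_family (smooth_GL_topology UNIV) (grp_G :: ('n + 'n) sqmat set)
      (\<lambda>f h. (?z, ((0::complex, 0::complex), h)))"
    by (rule smooth_family_Pair[OF open_GL_UNIV smooth_family_const[OF open_GL_UNIV]
          smooth_family_Pair[OF open_GL_UNIV smooth_family_const[OF open_GL_UNIV]
            smooth_family_linear[OF open_GL_UNIV bounded_linear_ident]]])
  from smooth_family_compose[OF T open_GL_UNIV smooth_family_B_regularized[of "of_bit (\<xi>1 + \<eta>)" "of_bit (\<xi>2 + \<eta>)"]
      \<Phi> continuous_map_id[unfolded id_def]]
  show ?thesis by (simp add: B_extended_def)
qed

definition B_operator :: "bit \<times> bit \<Rightarrow> bit \<Rightarrow> complex \<times> complex \<Rightarrow> complex \<Rightarrow>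
    (('n::{finite,linorder} + 'n) sqmat \<Rightarrow> complex) \<Rightarrow> ('n + 'n) sqmat \<Rightarrow> complex" where
  "B_operator = (\<lambda>(\<xi>1, \<xi>2) \<eta> (l1, l2) \<nu> f. restrict_GL ixs_H (B_extended \<xi>1 \<xi>2 \<eta> l1 l2 \<nu> f))"

lemma B_operator_eq:
  "B_operator (\<xi>1, \<xi>2) \<eta> (l1, l2) \<nu> f = restrict_GL ixs_H (B_extended \<xi>1 \<xi>2 \<eta> l1 l2 \<nu> f)"
  by (simp add: B_operator_def)

lemma B_regularized_add:
  fixes f1 f2 :: "('n::{finite,linorder} + 'n) sqmat \<Rightarrow> complex"
  assumes f: "f1 \<in> smooth_GL UNIV" "f2 \<in> smooth_GL UNIV" and h: "h \<in> grp_G"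
  shows "B_regularized e1 e2 z1 z2 (\<lambda>x. f1 x + f2 x) h = B_regularized e1 e2 z1 z2 f1 h + B_regularized e1 e2 z1 z2 f2 h"
proof -
  have "zeta_distr z ((hadamard_quotient ^^ e) (\<lambda>t. \<psi>1 t + \<psi>2 t)) =
      zeta_distr z ((hadamard_quotient ^^ e) \<psi>1) + zeta_distr z ((hadamard_quotient ^^ e) \<psi>2)"
    if "smooth_curve \<psi>1" "smooth_curve \<psi>2" for z e \<psi>1 \<psi>2
  proof -
    have "(hadamard_quotient ^^ e) (\<lambda>t. \<psi>1 t + \<psi>2 t) =
        (\<lambda>t. (hadamard_quotient ^^ e) \<psi>1 t + (hadamard_quotient ^^ e) \<psi>2 t)"
      by (induction e) (simp_all add: hadamard_quotient_add smooth_curve_hadamard_iterate that)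
    then show ?thesis by (simp add: zeta_distr_add smooth_curve_hadamard_iterate that)
  qed
  note * = this[OF smooth_curve_charts(1)[OF f(1) h] smooth_curve_charts(1)[OF f(2) h]]
    this[OF smooth_curve_charts(2)[OF f(1) h] smooth_curve_charts(2)[OF f(2) h]]
  show ?thesis unfolding B_regularized_def * by (simp add: algebra_simps)
qed

lemma B_regularized_mult:
  fixes f :: "('n::{finite,linorder} + 'n) sqmat \<Rightarrow> complex"
  assumes f: "f \<in> smooth_GL UNIV" and h: "h \<in> grp_G"
  shows "B_regularized e1 e2 z1 z2 (\<lambda>x. c * f x) h = c * B_regularized e1 e2 z1 z2 f h"
proof -
  have "zeta_distr z ((hadamard_quotient ^^ e) (\<lambda>t. c * \<psi> t)) = c * zeta_distr z ((hadamard_quotient ^^ e) \<psi>)"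
    if "smooth_curve \<psi>" for z e \<psi>
  proof -
    have "(hadamard_quotient ^^ e) (\<lambda>t. c * \<psi> t) = (\<lambda>t. c * (hadamard_quotient ^^ e) \<psi> t)"
      by (induction e) (simp_all add: hadamard_quotient_mult smooth_curve_hadamard_iterate that)
    then show ?thesis by (simp add: zeta_distr_mult smooth_curve_hadamard_iterate that)
  qed
  note * = this[OF smooth_curve_charts(1)[OF f h]] this[OF smooth_curve_charts(2)[OF f h]]
  show ?thesis unfolding B_regularized_def * by (simp add: algebra_simps)
qed

text \<open>Smoothness of the image and continuity of the operator are both read off from
  \<open>smooth_family_B_extended\<close>. Left translation by \<open>h\<close> only replaces the curves \<open>x chart(t)\<close> by
  \<open>h\<^sup>-\<^sup>1 x chart(t)\<close>.\<close>

lemma B_operator_Hom: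
  "B_operator (\<xi>1, \<xi>2) \<eta> (l1, l2) \<nu> \<in> Hom_H
     (rep_pi (\<xi>1, \<xi>2) (l1, l2) :: (('n::{finite,linorder} + 'n) sqmat \<Rightarrow> complex) set)
     (rep_tau (\<xi>1, \<eta>, \<xi>2) (l1, \<nu>, l2))"
proof -
  let ?V = "rep_pi (\<xi>1, \<xi>2) (l1, l2) :: (('n + 'n) sqmat \<Rightarrow> complex) set"
  let ?W = "rep_tau (\<xi>1, \<eta>, \<xi>2) (l1, \<nu>, l2) :: (('n + 'n) sqmat \<Rightarrow> complex) set"
  let ?T = "B_operator (\<xi>1, \<xi>2) \<eta> (l1, l2) \<nu> :: (('n + 'n) sqmat \<Rightarrow> complex) \<Rightarrow> _"
  have HG: "h \<in> grp_G" if "h \<in> grp_H" for h :: "('n + 'n) sqmat" using that GL_subset_UNIV by blast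
  have mem: "?T f \<in> ?W" if f: "f \<in> ?V" for f
  proof -
    have "?T f \<in> smooth_GL ixs_H"
      unfolding B_operator_eq
      by (rule restrict_GL_in_smooth_GL[OF smooth_family_B_extended])
         (simp add: topspace_smooth_GL_topology rep_pi_smooth[OF f])
    moreover have "?T f (h ** p) =
       sgn_powr \<xi>1 (- l1 - of_nat CARD('n) / 2) (block_det blk1 p) *
       sgn_powr \<eta> (- \<nu>) (block_det blk2 p) *
       sgn_powr \<xi>2 (- l2 + of_nat CARD('n) / 2) (block_det blk3 p) * ?T f h"
      if h: "h \<in> grp_H" and p: "p \<in> parab_H" for h p
    proof -
      have "p \<in> grp_H" using p by (simp add: parab_H_def)
      then have hp: "h ** p \<in> grp_H" using h by (intro GL_mult)
      show ?thesis
        using B_extended_equivariant[OF f HG[OF h] p] h hp by (simp add: B_operator_eq restrict_GL_def)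
    qed
    ultimately show ?thesis unfolding rep_tau_def prod.case mem_Collect_eq by blast
  qed
  have add: "?T (\<lambda>x. f1 x + f2 x) = (\<lambda>x. ?T f1 x + ?T f2 x)" if "f1 \<in> ?V" "f2 \<in> ?V" for f1 f2
    using B_regularized_add[OF rep_pi_smooth[OF that(1)] rep_pi_smooth[OF that(2)] HG]
    by (simp add: B_operator_eq restrict_GL_def B_extended_def fun_eq_iff)
  have mult: "?T (\<lambda>x. c * f x) = (\<lambda>x. c * ?T f x)" if "f \<in> ?V" for c f
    using B_regularized_mult[OF rep_pi_smooth[OF that] HG]
    by (simp add: B_operator_eq restrict_GL_def B_extended_def fun_eq_iff)
  have cont: "continuous_map (subtopology (smooth_GL_topology UNIV) ?V) (subtopology (smooth_GL_topology ixs_H) ?W) ?T"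
    unfolding continuous_map_in_subtopology
  proof
    have "continuous_map (smooth_GL_topology UNIV) (smooth_GL_topology ixs_H) ?T"
      using continuous_map_smooth_GL[OF smooth_family_B_extended] unfolding B_operator_eq .
    then show "continuous_map (subtopology (smooth_GL_topology UNIV) ?V) (smooth_GL_topology ixs_H) ?T"
      by (rule continuous_map_from_subtopology)
    show "?T \<in> topspace (subtopology (smooth_GL_topology UNIV) ?V) \<rightarrow> ?W"
      using mem by simp
  qed
  have inter: "?T (left_reg h f) = left_reg h (?T f)" if h: "h \<in> grp_H" for h f
  proof
    fix x
    have "(\<lambda>t. left_reg h f (x ** M t)) = (\<lambda>t. f ((matrix_inv h ** x) ** M t))" for M :: "real \<Rightarrow> ('n + 'n) sqmat"
      by (simp add: left_reg_def matrix_mul_assoc)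
    then show "?T (left_reg h f) x = left_reg h (?T f) x"
      by (simp add: B_operator_eq restrict_GL_def B_extended_def B_regularized_def
          left_reg_def[of h "\<lambda>g. if g \<in> grp_H then _ g else 0"] GL_mult_cancel_left[OF h])
  qed
  show ?thesis
    unfolding Hom_H_def mem_Collect_eq by (intro conjI ballI allI mem add mult cont inter)
qed

text \<open>The flat section is a fixed function times the twist. Hence its image is a smooth family in which all
  of \<open>(\<lambda>1, \<lambda>2, \<nu>)\<close> may be smooth variables or continuous parameters. Read as parameters, they give
  continuity; along a complex line, the line parameter as a smooth variable gives
  the limit of the difference quotients. Restriction to the orthogonal group is continuous.\<close>

lemma B_operator_holomorphic:
  fixes F :: "complex \<times> complex \<Rightarrow> ('n::{finite,linorder} + 'n) sqmat \<Rightarrow> complex"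
  assumes F: "flat_section (\<xi>1, \<xi>2) F"
  shows "holomorphic_into (smooth_Orth_topology ixs_H)
    (\<lambda>(l1, l2, \<nu>). restrict_Orth ixs_H (B_operator (\<xi>1, \<xi>2) \<eta> (l1, l2) \<nu> (F (l1, l2))))"
proof -
  define f where "f = F (0, 0)"
  have "\<forall>l. F l \<in> rep_pi (\<xi>1, \<xi>2) l" using F unfolding flat_section_def by (rule conjunct1)
  then have f: "f \<in> smooth_GL UNIV" unfolding f_def using rep_pi_smooth by blast
  have F_eq: "F (l1, l2) = (\<lambda>g. f g * twist l1 l2 g)" for l1 l2
    unfolding f_def by (rule flat_section_eq[OF F])
  let ?n = "of_nat CARD('n) / 2 :: complex"
  define E1 where "E1 = (of_bit (\<xi>1 + \<eta>) :: complex)"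
  define E2 where "E2 = (of_bit (\<xi>2 + \<eta>) :: complex)"
  define G where "G l1 l2 \<nu> h = B_extended \<xi>1 \<xi>2 \<eta> l1 l2 \<nu> (\<lambda>g. f g * twist l1 l2 g) h" for l1 l2 \<nu> h
  have T_eq: "B_operator (\<xi>1, \<xi>2) \<eta> (l1, l2) \<nu> (F (l1, l2)) = restrict_GL ixs_H (G l1 l2 \<nu>)" for l1 l2 \<nu>
    unfolding B_operator_eq F_eq G_def[abs_def] ..
  have fam: "smooth_family Y S (\<lambda>y x. G (a y x) (b y x) (c y x) (h y x))"
    if S: "open S" and abc: "smooth_family Y S a" "smooth_family Y S b" "smooth_family Y S c"
      and h: "smooth_family Y S h" "\<And>y x. y \<in> topspace Y \<Longrightarrow> x \<in> S \<Longrightarrow> h y x \<in> grp_G"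
    for Y :: "'y topology" and S :: "'s::euclidean_space set" and a b c h
  proof -
    have T: "open ((UNIV :: (complex \<times> complex) set) \<times> (UNIV :: (complex \<times> complex) set) \<times> (grp_G :: ('n + 'n) sqmat set))"
      by (intro open_Times open_GL_UNIV open_UNIV)
    have lin: "smooth_family Y S (\<lambda>y x. (u y x + (-1) * v y x + k) * (1/2))"
      if "smooth_family Y S u" "smooth_family Y S v" for u v and k :: complex
      by (intro smooth_family_mult[OF S] smooth_family_add[OF S] smooth_family_const[OF S] that)
    have z: "smooth_family Y S (\<lambda>y x. ((a y x - c y x + ?n + E1) / 2, (c y x - b y x + ?n + E2) / 2))"
      using smooth_family_Pair[OF S lin[OF abc(1,3), of "?n + E1"] lin[OF abc(3,2), of "?n + E2"]]
      by (simp add: add.assoc)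
    have \<sigma>: "continuous_map Y (smooth_GL_topology UNIV) (\<lambda>_. f)"
      using f by (simp add: topspace_smooth_GL_topology)
    from smooth_family_compose[OF T S smooth_family_B_regularized[of "of_bit (\<xi>1 + \<eta>)" "of_bit (\<xi>2 + \<eta>)"]
        smooth_family_Pair[OF S z smooth_family_Pair[OF S smooth_family_Pair[OF S abc(1,2)] h(1)]] \<sigma>] h(2)
    show ?thesis by (simp add: G_def B_extended_def E1_def E2_def)
  qed
  have hol: "(\<lambda>\<zeta>. G (z1 + \<zeta> * w1) (z2 + \<zeta> * w2) (z3 + \<zeta> * w3) h) holomorphic_on UNIV"
    if "h \<in> grp_G" for z1 z2 z3 w1 w2 w3 h
    unfolding G_def B_extended_def
    by (rule holomorphic_B_regularized[OF f that]) (intro holomorphic_intros; simp)+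
  have lim: "\<exists>L. limitin (smooth_GL_topology ixs_H) (\<lambda>\<zeta>. restrict_GL ixs_H (\<lambda>h.
      (G (z1 + \<zeta> * w1) (z2 + \<zeta> * w2) (z3 + \<zeta> * w3) h - G z1 z2 z3 h) / \<zeta>)) L (at 0)" for z1 z2 z3 w1 w2 w3
  proof -
    let ?S = "(UNIV :: complex set) \<times> (grp_G :: ('n + 'n) sqmat set)"
    have S: "open ?S" by (intro open_Times open_GL_UNIV open_UNIV)
    have "smooth_map ?S (\<lambda>x. z + fst x * w)" for z w
      by (intro smooth_family_add[OF S] smooth_family_mult[OF S] smooth_family_const[OF S]
          smooth_family_linear[OF S bounded_linear_fst])
    then have "smooth_map ?S (\<lambda>x. G (z1 + fst x * w1) (z2 + fst x * w2) (z3 + fst x * w3) (snd x))"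
      by (intro fam[OF S] smooth_family_linear[OF S bounded_linear_snd]) auto
    from difference_quotient_limit[OF this, of ixs_H] hol show ?thesis by simp
  qed
  have quot: "(\<lambda>x. (restrict_Orth ixs_H (restrict_GL ixs_H u) x - restrict_Orth ixs_H (restrict_GL ixs_H v) x) / \<zeta>) =
      restrict_Orth ixs_H (restrict_GL ixs_H (\<lambda>h. (u h - v h) / \<zeta>))" for u v :: "('n + 'n) sqmat \<Rightarrow> complex" and \<zeta>
    by (auto simp: restrict_Orth_def restrict_GL_def Orth_def)
  have cont: "continuous_map euclidean (smooth_Orth_topology ixs_H)
      (\<lambda>(l1, l2, \<nu>). restrict_Orth ixs_H (restrict_GL ixs_H (G l1 l2 \<nu>)))"
  proof -
    have "smooth_family euclidean (grp_G :: ('n + 'n) sqmat set)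
        (\<lambda>y h. G (fst y) (fst (snd y)) (snd (snd y)) h)"
    proof (rule fam[OF open_GL_UNIV])
      show "smooth_family (euclidean :: (complex \<times> complex \<times> complex) topology) grp_G (\<lambda>y (x :: ('n + 'n) sqmat). fst y)"
        by (rule smooth_family_param[OF open_GL_UNIV]) (simp add: continuous_on_fst)
      show "smooth_family (euclidean :: (complex \<times> complex \<times> complex) topology) grp_G (\<lambda>y (x :: ('n + 'n) sqmat). fst (snd y))"
        by (rule smooth_family_param[OF open_GL_UNIV]) (simp add: continuous_on_fst continuous_on_snd)
      show "smooth_family (euclidean :: (complex \<times> complex \<times> complex) topology) grp_G (\<lambda>y (x :: ('n + 'n) sqmat). snd (snd y))"
        by (rule smooth_family_param[OF open_GL_UNIV]) (simp add: continuous_on_snd)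
      show "smooth_family (euclidean :: (complex \<times> complex \<times> complex) topology) grp_G (\<lambda>y (x :: ('n + 'n) sqmat). x)"
        by (rule smooth_family_linear[OF open_GL_UNIV bounded_linear_ident])
    qed
    from continuous_map_compose[OF continuous_map_smooth_GL[OF this] continuous_map_restrict_Orth]
    show ?thesis by (simp add: o_def case_prod_unfold)
  qed
  show ?thesis
    unfolding holomorphic_into_def T_eq
  proof (intro conjI allI)
    show "continuous_map euclidean (smooth_Orth_topology ixs_H)
      (\<lambda>(l1, l2, \<nu>). restrict_Orth ixs_H (restrict_GL ixs_H (G l1 l2 \<nu>)))" by (rule cont)
    fix z1 z2 z3 w1 w2 w3
    obtain L where L: "limitin (smooth_GL_topology ixs_H) (\<lambda>\<zeta>. restrict_GL ixs_H (\<lambda>h.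
        (G (z1 + \<zeta> * w1) (z2 + \<zeta> * w2) (z3 + \<zeta> * w3) h - G z1 z2 z3 h) / \<zeta>)) L (at 0)"
      using lim by blast
    from continuous_map_limit[OF continuous_map_restrict_Orth this]
    have "limitin (smooth_Orth_topology ixs_H) (\<lambda>\<zeta>. restrict_Orth ixs_H (restrict_GL ixs_H (\<lambda>h.
        (G (z1 + \<zeta> * w1) (z2 + \<zeta> * w2) (z3 + \<zeta> * w3) h - G z1 z2 z3 h) / \<zeta>))) (restrict_Orth ixs_H L) (at 0)"
      by (simp only: o_def)
    then show "\<exists>L. limitin (smooth_Orth_topology ixs_H)
        (\<lambda>\<zeta> x. ((case (z1 + \<zeta> * w1, z2 + \<zeta> * w2, z3 + \<zeta> * w3) of
            (l1, l2, \<nu>) \<Rightarrow> restrict_Orth ixs_H (restrict_GL ixs_H (G l1 l2 \<nu>))) x -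
          (case (z1, z2, z3) of (l1, l2, \<nu>) \<Rightarrow> restrict_Orth ixs_H (restrict_GL ixs_H (G l1 l2 \<nu>))) x) / \<zeta>) L (at 0)"
      unfolding prod.case quot by blast
  qed
qed

theorem proposition3p2:
  shows "(\<forall>\<xi>1 \<xi>2 \<eta> l1 l2 \<nu>.
            Re (l1 - \<nu>) > - real CARD('n::{finite,linorder}) / 2 \<and>
            Re (\<nu> - l2) > - real CARD('n) / 2 \<longrightarrow>
            (\<forall>f \<in> rep_pi (\<xi>1, \<xi>2) (l1, l2). \<forall>h \<in> (grp_H :: ('n + 'n) sqmat set).
               integrable lborel (B_integrand \<xi>1 l1 \<eta> \<nu> f h)))
       \<and> (\<exists>BB :: bit \<times> bit \<Rightarrow> bit \<Rightarrow> complex \<times> complex \<Rightarrow> complex \<Rightarrow>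
               (('n + 'n) sqmat \<Rightarrow> complex) \<Rightarrow> ('n + 'n) sqmat \<Rightarrow> complex.
            \<forall>\<xi>1 \<xi>2 \<eta>.
              (\<forall>l1 l2 \<nu>.
                 Re (l1 - \<nu>) > - real CARD('n) / 2 \<and> Re (\<nu> - l2) > - real CARD('n) / 2 \<longrightarrow>
                 (\<forall>f \<in> rep_pi (\<xi>1, \<xi>2) (l1, l2). \<forall>h \<in> grp_H.
                    BB (\<xi>1, \<xi>2) \<eta> (l1, l2) \<nu> f h =
                      inverse (n_B CARD('n) (\<xi>1, \<xi>2) (l1, l2) \<eta> \<nu>) *
                      (LINT t|lborel. B_integrand \<xi>1 l1 \<eta> \<nu> f h t))) \<and>
              holomorphic_family (\<xi>1, \<xi>2) (BB (\<xi>1, \<xi>2) \<eta>) \<and>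
              (\<forall>l1 l2 \<nu>.
                 BB (\<xi>1, \<xi>2) \<eta> (l1, l2) \<nu> \<in>
                   Hom_H (rep_pi (\<xi>1, \<xi>2) (l1, l2))
                     (rep_tau (\<xi>1, \<eta>, \<xi>2) (l1, \<nu>, l2))))"
proof (intro conjI exI[of _ B_operator] allI impI ballI)
  fix \<xi>1 \<xi>2 \<eta> l1 l2 \<nu> and f :: "('n + 'n) sqmat \<Rightarrow> complex" and h :: "('n + 'n) sqmat"
  assume re: "Re (l1 - \<nu>) > - real CARD('n) / 2 \<and> Re (\<nu> - l2) > - real CARD('n) / 2"
    and f: "f \<in> rep_pi (\<xi>1, \<xi>2) (l1, l2)" and h: "h \<in> grp_H"
  have "h \<in> grp_G" using h GL_subset_UNIV by blast
  note I = B_integral[OF f this conjunct1[OF re] conjunct2[OF re]]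
  show "integrable lborel (B_integrand \<xi>1 l1 \<eta> \<nu> f h)" by (rule I)
  show "B_operator (\<xi>1, \<xi>2) \<eta> (l1, l2) \<nu> f h =
      inverse (n_B CARD('n) (\<xi>1, \<xi>2) (l1, l2) \<eta> \<nu>) * (LINT t|lborel. B_integrand \<xi>1 l1 \<eta> \<nu> f h t)"
    using h by (simp add: B_operator_eq restrict_GL_def I(2))
next
  fix \<xi>1 \<xi>2 \<eta>
  show "holomorphic_family (\<xi>1, \<xi>2) (B_operator (\<xi>1, \<xi>2) \<eta> ::
      complex \<times> complex \<Rightarrow> complex \<Rightarrow> (('n + 'n) sqmat \<Rightarrow> complex) \<Rightarrow> ('n + 'n) sqmat \<Rightarrow> complex)"
    unfolding holomorphic_family_def by (intro allI impI B_operator_holomorphic)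
next
  fix \<xi>1 \<xi>2 \<eta> l1 l2 \<nu>
  show "B_operator (\<xi>1, \<xi>2) \<eta> (l1, l2) \<nu> \<in>
      Hom_H (rep_pi (\<xi>1, \<xi>2) (l1, l2) :: (('n + 'n) sqmat \<Rightarrow> complex) set)
        (rep_tau (\<xi>1, \<eta>, \<xi>2) (l1, \<nu>, l2))"
    by (rule B_operator_Hom)
qed

end
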